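(* Fix an integer $n\ge 2$. Let $j_1,j_2$ be join-irreducible elements of the cyclic Tamari lattice $\mathsf{CTam}=\mathsf{CTam}_{312}$. Then (i) $j_1\twoheadleftarrow j_2$ if and only if $M_{j_1}$ is a quotient of $M_{j_2}$; (ii) $j_1\hookrightarrow j_2$ if and only if $M_{j_1}$ is a submodule of $M_{j_2}$; (iii) $j_1\to j_2$ if and only if there is a nonzero map from $M_{j_1}$ to $M_{j_2}$. (In (i) and (ii), "is" means "is isomorphic to".) As a result, the poset $\mathsf{CTam}_{\mathsf{Tors}}$ of torsion classes of the cyclic Tamari algebra $C_{\mathcal Q}$ is isomorphic to $\mathsf{CTam}_{312}$, and the poset $\mathsf{ATam}_{\mathsf{Tors}}$ of torsion classes of the affine Tamari algebra $A_{\mathcal Q}$ is isomorphic to $\mathsf{ATam}_{312}$.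
   Context: Fix an integer $n\ge 2$. A translation-invariant total order (TITO) is a total order $\preceq$ on $\mathbb Z$ such that $a\preceq b$ iff $a+n\preceq b+n$. A reflection index is a pair $(a,b)$ of integers with $a<b$, up to simultaneous translation by multiples of $n$. It is an inversion of $\preceq$ if $b\preceq a$; TITOs are partially ordered by containment of inversion sets. A TITO is $312$-avoiding if there are no integers $a<b<c$ with $c\preceq a\preceq b$. A block of a TITO is a nonempty order-convex subset $I\subseteq\mathbb Z$ with no minimal or maximal element in which all intervals between two elements are finite; its size is the number of residue classes modulo $n$ it contains; it is waxing if $x\preceq x+n$ for $x\in I$ and waning otherwise. A TITO is real if every block of size $1$ is waxing. $\mathsf{CTam}_{312}$ (resp. $\mathsf{ATam}_{312}$) is the poset of $312$-avoiding (resp. $312$-avoiding real) TITOs; both are finite semidistributive lattices. Window notation: $[a_1,\ldots,a_k]$ denotes the block $\cdots\prec a_1\prec\cdots\prec a_k\prec a_1+n\prec\cdots$; $[\underline{a_1,\ldots,a_k}]$ denotes the block $\cdots\prec a_1\prec\cdots\prec a_k\prec a_1-n\prec\cdots$; concatenated windows list blocks left to right. The join-irreducibles of $\mathsf{CTam}_{312}$ are $j_{a,b}$ for reflection indices $(a,b)$ with $b\le a+n$: for $b<a+n$, $j_{a,b}=[b+1-n,\ldots,\widehat a,\ldots,b-1,b,a]$ (omit $a$ from the list $b+1-n,\ldots,b$ and append it at the end); for $b=a+n$, $j_{a,b}=[a-n+1,\ldots,a-1][\underline a]$. For a finite semidistributive lattice $L$ and a join-irreducible $j$ covering the unique element $j_*$,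 let $\kappa(j)=\max\{z\in L\mid z\wedge j=j_*\}$. For join-irreducibles: $j_1\twoheadrightarrow j_2$ (i.e. $j_2\twoheadleftarrow j_1$) iff $j_1\ge j_2$; $j_1\hookrightarrow j_2$ iff $\kappa(j_1)\ge\kappa(j_2)$; $j_1\to j_2$ iff $j_1\not\le\kappa(j_2)$. Let $\mathcal Q$ be the oriented cycle quiver with vertices $\mathbb Z/n\mathbb Z$ and arrows $i\to i+1$. $C_{\mathcal Q}$ (resp. $A_{\mathcal Q}$) is the quotient of the path algebra $\mathbb C[\mathcal Q]$ by the ideal generated by all paths of length $n$ (resp. $n-1$). A representation is a module that is finite-dimensional over $\mathbb C$; equivalently, finite-dimensional vector spaces $M^i$ and linear maps $L^i\colon M^i\to M^{i+1}$ ($i\in\mathbb Z/n\mathbb Z$) such that any composition of $n$ (resp. $n-1$) consecutive maps is $0$. For a reflection index $(a,b)$ with $b\le a+n$, $M_{a,b}$ is the representation of $C_{\mathcal Q}$ with $M^i=\mathbb C$ at (the residues of) $a\le i\le b-1$ and $0$ at other vertices, with $L^i=\mathrm{id}$ for $a\le i\le b-2$ and all other maps $0$; write $M_{j_{a,b}}=M_{a,b}$. A torsion class is a collection of representations closed under isomorphisms, quotients, and extensions; $\mathsf{CTam}_{\mathsf{Tors}}$ and $\mathsf{ATam}_{\mathsf{Tors}}$ are the posets of torsion classes of $C_{\mathcal Q}$ and $A_{\mathcal Q}$ under inclusion. *)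

theory Defs
  imports Complex_Main "HOL-Algebra.Lattice"
begin

definition TITO :: "nat \<Rightarrow> int rel \<Rightarrow> bool" where
  "TITO n r \<longleftrightarrow> linear_order r \<and>
     (\<forall>a b. (a, b) \<in> r \<longleftrightarrow> (a + int n, b + int n) \<in> r)"

definition refl_index :: "nat \<Rightarrow> int \<Rightarrow> int \<Rightarrow> int rel" where
  "refl_index n a b = {(a + k * int n, b + k * int n) | k. True}"

definition inversions :: "nat \<Rightarrow> int rel \<Rightarrow> int rel set" where
  "inversions n r = {refl_index n a b | a b. a < b \<and> (b, a) \<in> r}"

definition avoids_312 :: "int rel \<Rightarrow> bool" where
  "avoids_312 r \<longleftrightarrow> \<not> (\<exists>a b c. a < b \<and> b < c \<and> (c, a) \<in> r \<and> (a, b) \<in> r)"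

definition is_block :: "int rel \<Rightarrow> int set \<Rightarrow> bool" where
  "is_block r I \<longleftrightarrow> I \<noteq> {} \<and>
     (\<forall>x\<in>I. \<forall>z\<in>I. \<forall>y. (x, y) \<in> r \<and> (y, z) \<in> r \<longrightarrow> y \<in> I) \<and>
     (\<forall>x\<in>I. \<exists>y\<in>I. y \<noteq> x \<and> (y, x) \<in> r) \<and>
     (\<forall>x\<in>I. \<exists>y\<in>I. y \<noteq> x \<and> (x, y) \<in> r) \<and>
     (\<forall>x\<in>I. \<forall>z\<in>I. finite {y. (x, y) \<in> r \<and> (y, z) \<in> r})"

definition block_size :: "nat \<Rightarrow> int set \<Rightarrow> nat" where
  "block_size n I = card ((\<lambda>x. x mod int n) ` I)"

definition waxing :: "nat \<Rightarrow> int rel \<Rightarrow> int set \<Rightarrow> bool" where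
  "waxing n r I \<longleftrightarrow> (\<forall>x\<in>I. (x, x + int n) \<in> r)"

definition real_TITO :: "nat \<Rightarrow> int rel \<Rightarrow> bool" where
  "real_TITO n r \<longleftrightarrow> (\<forall>I. is_block r I \<and> block_size n I = 1 \<longrightarrow> waxing n r I)"

definition CTam :: "nat \<Rightarrow> int rel gorder" where
  "CTam n = \<lparr>carrier = {r. TITO n r \<and> avoids_312 r}, eq = (=),
             le = (\<lambda>r s. inversions n r \<subseteq> inversions n s)\<rparr>"

definition ATam :: "nat \<Rightarrow> int rel gorder" where
  "ATam n = \<lparr>carrier = {r. TITO n r \<and> avoids_312 r \<and> real_TITO n r}, eq = (=),
             le = (\<lambda>r s. inversions n r \<subseteq> inversions n s)\<rparr>"

text \<open>A block given by a window is an order relation on the union of the residue classes of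
  the entries; the entries are meant to lie in distinct residue classes.\<close>

definition waxing_window :: "nat \<Rightarrow> int list \<Rightarrow> int rel" where
  "waxing_window n xs =
     {(xs ! i + k * int n, xs ! j + l * int n) | i j k l.
        i < length xs \<and> j < length xs \<and> (k < l \<or> (k = l \<and> i \<le> j))}"

definition waning_window :: "nat \<Rightarrow> int list \<Rightarrow> int rel" where
  "waning_window n xs =
     {(xs ! i + k * int n, xs ! j + l * int n) | i j k l.
        i < length xs \<and> j < length xs \<and> (l < k \<or> (k = l \<and> i \<le> j))}"

definition window_concat :: "int rel \<Rightarrow> int rel \<Rightarrow> int rel" where
  "window_concat r s = r \<union> s \<union> (Field r \<times> Field s)"

definition jirr :: "nat \<Rightarrow> int \<Rightarrow> int \<Rightarrow> int rel" where
  "jirr n a b =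
     (if b < a + int n
      then waxing_window n (removeAll a [b + 1 - int n..b] @ [a])
      else window_concat (waxing_window n [a - int n + 1..a - 1]) (waning_window n [a]))"

definition join_irreducible :: "('a, 'b) gorder_scheme \<Rightarrow> 'a \<Rightarrow> bool" where
  "join_irreducible L j \<longleftrightarrow> j \<in> carrier L \<and> \<not> least L j (carrier L) \<and>
     (\<forall>x\<in>carrier L. \<forall>y\<in>carrier L. j = x \<squnion>\<^bsub>L\<^esub> y \<longrightarrow> j = x \<or> j = y)"

definition covers :: "('a, 'b) gorder_scheme \<Rightarrow> 'a \<Rightarrow> 'a \<Rightarrow> bool" where
  "covers L y x \<longleftrightarrow> x \<in> carrier L \<and> y \<in> carrier L \<and> x \<sqsubset>\<^bsub>L\<^esub> y \<and>
     \<not> (\<exists>z\<in>carrier L. x \<sqsubset>\<^bsub>L\<^esub> z \<and> z \<sqsubset>\<^bsub>L\<^esub> y)"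

definition lower_star :: "('a, 'b) gorder_scheme \<Rightarrow> 'a \<Rightarrow> 'a" where
  "lower_star L j = (THE x. covers L j x)"

definition kappa :: "('a, 'b) gorder_scheme \<Rightarrow> 'a \<Rightarrow> 'a" where
  "kappa L j =
     (THE z. greatest L z {z \<in> carrier L. z \<sqinter>\<^bsub>L\<^esub> j = lower_star L j})"

definition ji_onto :: "('a, 'b) gorder_scheme \<Rightarrow> 'a \<Rightarrow> 'a \<Rightarrow> bool" where
  "ji_onto L j1 j2 \<longleftrightarrow> j2 \<sqsubseteq>\<^bsub>L\<^esub> j1"

definition ji_into :: "('a, 'b) gorder_scheme \<Rightarrow> 'a \<Rightarrow> 'a \<Rightarrow> bool" where
  "ji_into L j1 j2 \<longleftrightarrow> kappa L j2 \<sqsubseteq>\<^bsub>L\<^esub> kappa L j1"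

definition ji_arrow :: "('a, 'b) gorder_scheme \<Rightarrow> 'a \<Rightarrow> 'a \<Rightarrow> bool" where
  "ji_arrow L j1 j2 \<longleftrightarrow> \<not> j1 \<sqsubseteq>\<^bsub>L\<^esub> kappa L j2"

definition order_isomorphic :: "('a, 'c) gorder_scheme \<Rightarrow> ('b, 'd) gorder_scheme \<Rightarrow> bool" where
  "order_isomorphic A B \<longleftrightarrow>
     (\<exists>f. bij_betw f (carrier A) (carrier B) \<and> order_emb A B f)"

text \<open>
  The vertex set \<open>\<int>/n\<int>\<close> is \<open>{0..<n}\<close>. The vector spaces of a representation are
  finite-dimensional subspaces of an ambient complex vector space \<open>'v\<close> whose scalar
  multiplication \<open>s\<close> is an explicit parameter. Values of \<open>vspace\<close> at integers outside
  \<open>{0..<n}\<close>, and values of \<open>arrow\<close> there or outside the given subspaces, carry no meaning;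
  representations that differ only in them are isomorphic.
\<close>

record 'v rep =
  vspace :: "int \<Rightarrow> 'v set"
  arrow :: "int \<Rightarrow> 'v \<Rightarrow> 'v"

definition vertices :: "nat \<Rightarrow> int set" where
  "vertices n = {0..<int n}"

definition next_vertex :: "nat \<Rightarrow> int \<Rightarrow> int" where
  "next_vertex n i = (i + 1) mod int n"

definition fd_subspace :: "(complex \<Rightarrow> 'v::ab_group_add \<Rightarrow> 'v) \<Rightarrow> 'v set \<Rightarrow> bool" where
  "fd_subspace s U \<longleftrightarrow> (\<exists>B. finite B \<and> module.span s B = U)"

definition linear_between ::
  "(complex \<Rightarrow> 'v::ab_group_add \<Rightarrow> 'v) \<Rightarrow> (complex \<Rightarrow> 'w::ab_group_add \<Rightarrow> 'w) \<Rightarrow>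
   'v set \<Rightarrow> 'w set \<Rightarrow> ('v \<Rightarrow> 'w) \<Rightarrow> bool" where
  "linear_between s t U W f \<longleftrightarrow> (\<forall>x\<in>U. f x \<in> W) \<and>
     (\<forall>x\<in>U. \<forall>y\<in>U. f (x + y) = f x + f y) \<and> (\<forall>c. \<forall>x\<in>U. f (s c x) = t c (f x))"

definition is_rep :: "(complex \<Rightarrow> 'v::ab_group_add \<Rightarrow> 'v) \<Rightarrow> nat \<Rightarrow> 'v rep \<Rightarrow> bool" where
  "is_rep s n M \<longleftrightarrow> (\<forall>i\<in>vertices n. fd_subspace s (vspace M i) \<and>
     linear_between s s (vspace M i) (vspace M (next_vertex n i)) (arrow M i))"

primrec path_map :: "nat \<Rightarrow> 'v rep \<Rightarrow> nat \<Rightarrow> int \<Rightarrow> 'v \<Rightarrow> 'v" where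
  "path_map n M 0 i x = x"
| "path_map n M (Suc k) i x = path_map n M k (next_vertex n i) (arrow M i x)"

text \<open>Representations of the quotient of the path algebra by all paths of length \<open>k\<close>.\<close>

definition cycle_reps ::
  "(complex \<Rightarrow> 'v::ab_group_add \<Rightarrow> 'v) \<Rightarrow> nat \<Rightarrow> nat \<Rightarrow> 'v rep set" where
  "cycle_reps s n k =
     {M. is_rep s n M \<and> (\<forall>i\<in>vertices n. \<forall>x\<in>vspace M i. path_map n M k i x = 0)}"

definition rep_hom ::
  "(complex \<Rightarrow> 'v::ab_group_add \<Rightarrow> 'v) \<Rightarrow> (complex \<Rightarrow> 'w::ab_group_add \<Rightarrow> 'w) \<Rightarrow> nat \<Rightarrow>
   'v rep \<Rightarrow> 'w rep \<Rightarrow> (int \<Rightarrow> 'v \<Rightarrow> 'w) \<Rightarrow> bool" where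
  "rep_hom s t n M N f \<longleftrightarrow>
     (\<forall>i\<in>vertices n. linear_between s t (vspace M i) (vspace N i) (f i) \<and>
       (\<forall>x\<in>vspace M i. f (next_vertex n i) (arrow M i x) = arrow N i (f i x)))"

definition rep_iso ::
  "(complex \<Rightarrow> 'v::ab_group_add \<Rightarrow> 'v) \<Rightarrow> (complex \<Rightarrow> 'w::ab_group_add \<Rightarrow> 'w) \<Rightarrow> nat \<Rightarrow>
   'v rep \<Rightarrow> 'w rep \<Rightarrow> bool" where
  "rep_iso s t n M N \<longleftrightarrow> (\<exists>f. rep_hom s t n M N f \<and>
     (\<forall>i\<in>vertices n. bij_betw (f i) (vspace M i) (vspace N i)))"

text \<open>Quotients are understood up to isomorphism: \<open>Q\<close> is isomorphic to \<open>M / ker f\<close> for a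
  surjective homomorphism \<open>f\<close> from \<open>M\<close> to \<open>Q\<close>.\<close>

definition is_quotient ::
  "(complex \<Rightarrow> 'v::ab_group_add \<Rightarrow> 'v) \<Rightarrow> (complex \<Rightarrow> 'w::ab_group_add \<Rightarrow> 'w) \<Rightarrow> nat \<Rightarrow>
   'v rep \<Rightarrow> 'w rep \<Rightarrow> bool" where
  "is_quotient s t n Q M \<longleftrightarrow> (\<exists>f. rep_hom t s n M Q f \<and>
     (\<forall>i\<in>vertices n. f i ` vspace M i = vspace Q i))"

definition subrep ::
  "(complex \<Rightarrow> 'v::ab_group_add \<Rightarrow> 'v) \<Rightarrow> nat \<Rightarrow> 'v rep \<Rightarrow> 'v rep \<Rightarrow> bool" where
  "subrep s n U M \<longleftrightarrow> is_rep s n U \<and>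
     (\<forall>i\<in>vertices n. vspace U i \<subseteq> vspace M i \<and> (\<forall>x\<in>vspace U i. arrow U i x = arrow M i x))"

definition is_submodule ::
  "(complex \<Rightarrow> 'v::ab_group_add \<Rightarrow> 'v) \<Rightarrow> (complex \<Rightarrow> 'w::ab_group_add \<Rightarrow> 'w) \<Rightarrow> nat \<Rightarrow>
   'v rep \<Rightarrow> 'w rep \<Rightarrow> bool" where
  "is_submodule s t n N M \<longleftrightarrow> (\<exists>U. subrep t n U M \<and> rep_iso s t n N U)"

definition nonzero_map_exists ::
  "(complex \<Rightarrow> 'v::ab_group_add \<Rightarrow> 'v) \<Rightarrow> (complex \<Rightarrow> 'w::ab_group_add \<Rightarrow> 'w) \<Rightarrow> nat \<Rightarrow>
   'v rep \<Rightarrow> 'w rep \<Rightarrow> bool" where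
  "nonzero_map_exists s t n M N \<longleftrightarrow>
     (\<exists>f. rep_hom s t n M N f \<and> (\<exists>i\<in>vertices n. \<exists>x\<in>vspace M i. f i x \<noteq> 0))"

definition short_exact ::
  "(complex \<Rightarrow> 'v::ab_group_add \<Rightarrow> 'v) \<Rightarrow> nat \<Rightarrow> 'v rep \<Rightarrow> 'v rep \<Rightarrow> 'v rep \<Rightarrow> bool" where
  "short_exact s n A E B \<longleftrightarrow>
     (\<exists>f g. rep_hom s s n A E f \<and> rep_hom s s n E B g \<and>
       (\<forall>i\<in>vertices n. inj_on (f i) (vspace A i) \<and>
          f i ` vspace A i = {x \<in> vspace E i. g i x = 0} \<and>
          g i ` vspace E i = vspace B i))"

definition Mrep :: "nat \<Rightarrow> int \<Rightarrow> int \<Rightarrow> complex rep" where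
  "Mrep n a b =
     \<lparr>vspace = (\<lambda>i. if \<exists>m. a \<le> m \<and> m \<le> b - 1 \<and> m mod int n = i then UNIV else {0}),
      arrow = (\<lambda>i. if \<exists>m. a \<le> m \<and> m \<le> b - 2 \<and> m mod int n = i then (\<lambda>x. x) else (\<lambda>x. 0))\<rparr>"

text \<open>\<open>M\<^sub>j\<close> for a join-irreducible \<open>j = j\<^sub>a\<^sub>b\<close>. The pair \<open>(a, b)\<close> is determined by \<open>j\<close> up to
  translation by multiples of \<open>n\<close>, and \<open>Mrep n a b\<close> is invariant under such translations.\<close>

definition Mji :: "nat \<Rightarrow> int rel \<Rightarrow> complex rep" where
  "Mji n j = (case (SOME (a, b). a < b \<and> b \<le> a + int n \<and> j = jirr n a b) of
     (a, b) \<Rightarrow> Mrep n a b)"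

text \<open>Nonemptiness (equivalently, containing the zero representation) is part of the usual
  meaning of a torsion class; the closure conditions alone would admit the empty collection.\<close>

definition torsion_class ::
  "(complex \<Rightarrow> 'v::ab_group_add \<Rightarrow> 'v) \<Rightarrow> nat \<Rightarrow> nat \<Rightarrow> 'v rep set \<Rightarrow> bool" where
  "torsion_class s n k T \<longleftrightarrow> T \<subseteq> cycle_reps s n k \<and> T \<noteq> {} \<and>
     (\<forall>M\<in>T. \<forall>N\<in>cycle_reps s n k. rep_iso s s n M N \<longrightarrow> N \<in> T) \<and>
     (\<forall>M\<in>T. \<forall>Q\<in>cycle_reps s n k. is_quotient s s n Q M \<longrightarrow> Q \<in> T) \<and>
     (\<forall>A\<in>T. \<forall>B\<in>T. \<forall>E\<in>cycle_reps s n k. short_exact s n A E B \<longrightarrow> E \<in> T)"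

definition torsion_poset ::
  "(complex \<Rightarrow> 'v::ab_group_add \<Rightarrow> 'v) \<Rightarrow> nat \<Rightarrow> nat \<Rightarrow> 'v rep set gorder" where
  "torsion_poset s n k =
     \<lparr>carrier = {T. torsion_class s n k T}, eq = (=), le = (\<subseteq>)\<rparr>"

definition CTam_Tors ::
  "(complex \<Rightarrow> 'v::ab_group_add \<Rightarrow> 'v) \<Rightarrow> nat \<Rightarrow> 'v rep set gorder" where
  "CTam_Tors s n = torsion_poset s n n"

definition ATam_Tors ::
  "(complex \<Rightarrow> 'v::ab_group_add \<Rightarrow> 'v) \<Rightarrow> nat \<Rightarrow> 'v rep set gorder" where
  "ATam_Tors s n = torsion_poset s n (n - 1)"

text \<open>If the ambient space \<open>'v\<close> is infinite-dimensional, every finite-dimensional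
  representation is isomorphic to one inside \<open>'v\<close>; as torsion classes are closed under
  isomorphism, those inside \<open>'v\<close> then correspond to the torsion classes of the whole
  category of finite-dimensional representations.\<close>

definition infinite_dimensional :: "(complex \<Rightarrow> 'v::ab_group_add \<Rightarrow> 'v) \<Rightarrow> bool" where
  "infinite_dimensional s \<longleftrightarrow> \<not> fd_subspace s UNIV"

end

theory Submission
  imports Defs
begin

text \<open>
  Both lattices of orders and both lattices of torsion classes are identified with lattices
  of the same combinatorial kind, whose elements are here called torsion patterns: the
  translation-invariant sets of pairs \<open>(a, b)\<close> with \<open>a < b \<le> a + k\<close> that contain \<open>(a, b)\<close> whenever they contain
  \<open>(a, c)\<close> with \<open>a < b \<le> c\<close>, and that contain \<open>(a, c)\<close> whenever they contain \<open>(a, b)\<close> and \<open>(b, c)\<close>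
  and \<open>c \<le> a + k\<close>.

  On the side of orders, closure under composition is transitivity of the inversion set and
  closure under passing to prefixes \<open>(a, b)\<close> is avoidance of 312. An inversion \<open>(a, b)\<close> with \<open>b > a + n\<close> carries no information beyond
  the inversion \<open>(a, a + n)\<close>, so for \<open>k = n\<close> a pattern is the same as a 312-avoiding
  order. An order is real exactly when each of its inversions \<open>(a, a + n)\<close> is
  the composite of two shorter ones, so that the pairs with \<open>b < a + n\<close> determine it and may form
  any pattern with \<open>k = n - 1\<close>.

  On the side of representations, a pair \<open>(a, b)\<close> stands for the uniserial module \<open>M\<^sub>a\<^sub>b\<close>. Its
  quotients are the \<open>M\<^sub>a\<^sub>c\<close> with \<open>c \<le> b\<close> and there is an exact sequence
  \<open>0 \<rightarrow> M\<^sub>b\<^sub>c \<rightarrow> M\<^sub>a\<^sub>c \<rightarrow> M\<^sub>a\<^sub>b \<rightarrow> 0\<close>, hence the uniserial modules in a torsion class form a pattern.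
  Conversely a torsion class is the left perpendicular category of the uniserial
  modules that are torsion-free for it. A map from \<open>M\<close> to \<open>M\<^sub>a\<^sub>b\<close> is a functional on the
  space of \<open>M\<close> at \<open>b - 1\<close> that vanishes on the image of the space at \<open>a - 1\<close>, so the
  perpendicular category consists of the representations for which certain composites of arrows
  are surjective (\<open>rep_class\<close>). This description is visibly closed under quotients and extensions.
  It gives back the original torsion class \<open>T\<close> because, on the one hand,
  a missing surjectivity produces a functional and with it a uniserial quotient
  (\<open>torsion_class_subset\<close>), and on the other hand a representation in the perpendicular
  category that is not in \<open>T\<close> would allow its largest subrepresentation in \<open>T\<close> to be enlarged by a uniserial module of \<open>T\<close>
  (\<open>torsion_class_supset\<close>).

  For the three relations on join-irreducibles, \<open>j\<^sub>a\<^sub>b\<close> corresponds to the least pattern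
  containing \<open>(a, b)\<close> (\<open>row\<close>), and \<open>\<kappa>(j\<^sub>a\<^sub>b)\<close> to the set of all \<open>(c, d)\<close> such that \<open>M\<^sub>c\<^sub>d\<close> has no
  nonzero map to \<open>M\<^sub>a\<^sub>b\<close> (\<open>barrier\<close>). All three relations then become inequalities
  between the end points of the two intervals up to translation, and so do the existence of a
  surjective, an injective or a nonzero map, since maps between uniserial modules are
  scalar on their overlap.
\<close>

section \<open>Torsion patterns and translation-invariant orders\<close>

text \<open>Read \<open>(a, b) \<in> J\<close> either as an inversion of an order, \<open>b\<close> preceding \<open>a\<close>, or as membership of
  the uniserial module on the vertices \<open>a, \<dots>, b - 1\<close> in a torsion class. The third condition is
  312-avoidance or closure under quotients, the last one is transitivity or closure under
  extensions.\<close>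

definition torsion_pattern :: "nat \<Rightarrow> nat \<Rightarrow> int rel \<Rightarrow> bool" where
  "torsion_pattern n k J \<longleftrightarrow>
     (\<forall>a b. (a, b) \<in> J \<longrightarrow> a < b \<and> b \<le> a + int k) \<and>
     (\<forall>a b. (a, b) \<in> J \<longleftrightarrow> (a + int n, b + int n) \<in> J) \<and>
     (\<forall>a b c. (a, c) \<in> J \<and> a < b \<and> b \<le> c \<longrightarrow> (a, b) \<in> J) \<and>
     (\<forall>a b c. (a, b) \<in> J \<and> (b, c) \<in> J \<and> c \<le> a + int k \<longrightarrow> (a, c) \<in> J)"

lemma torsion_patternD:
  assumes "torsion_pattern n k J"
  shows torsion_pattern_bounds: "(a, b) \<in> J \<Longrightarrow> a < b \<and> b \<le> a + int k"
    and torsion_pattern_prefix: "(a, c) \<in> J \<Longrightarrow> a < b \<Longrightarrow> b \<le> c \<Longrightarrow> (a, b) \<in> J"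
    and torsion_pattern_trans:
      "(a, b) \<in> J \<Longrightarrow> (b, c) \<in> J \<Longrightarrow> c \<le> a + int k \<Longrightarrow> (a, c) \<in> J"
  using assms unfolding torsion_pattern_def by blast+

lemma translation_invariant_multiple:
  fixes P :: "int \<Rightarrow> int \<Rightarrow> bool"
  assumes "\<And>a b. P a b \<longleftrightarrow> P (a + m) (b + m)"
  shows "P (a + l * m) (b + l * m) \<longleftrightarrow> P a b"
proof (induction l rule: int_induct[where k = 0])
  case (step1 i)
  then show ?case using assms[of "a + i * m" "b + i * m"] by (simp add: algebra_simps)
next
  case (step2 i)
  then show ?case
    using assms[of "a + (i - 1) * m" "b + (i - 1) * m"] by (simp add: algebra_simps)
qed auto

lemma torsion_pattern_translate:
  assumes "torsion_pattern n k J"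
  shows "(a + l * int n, b + l * int n) \<in> J \<longleftrightarrow> (a, b) \<in> J"
  using assms unfolding torsion_pattern_def
  by (intro translation_invariant_multiple[where P = "\<lambda>a b. (a, b) \<in> J"]) blast

lemma TITO_translate:
  assumes "TITO n r"
  shows "(a + l * int n, b + l * int n) \<in> r \<longleftrightarrow> (a, b) \<in> r"
  using assms unfolding TITO_def
  by (intro translation_invariant_multiple[where P = "\<lambda>a b. (a, b) \<in> r"]) blast

lemma TITO_order:
  assumes "TITO n r"
  shows TITO_refl: "(a, a) \<in> r"
    and TITO_trans: "(a, b) \<in> r \<Longrightarrow> (b, c) \<in> r \<Longrightarrow> (a, c) \<in> r"
    and TITO_antisym: "(a, b) \<in> r \<Longrightarrow> (b, a) \<in> r \<Longrightarrow> a = b"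
    and TITO_total: "(a, b) \<in> r \<or> (b, a) \<in> r"
  using assms unfolding TITO_def linear_order_on_def partial_order_on_def preorder_on_def
    refl_on_def trans_def antisym_def total_on_def by (blast, blast, blast, metis UNIV_I)

definition short_inversions :: "nat \<Rightarrow> int rel \<Rightarrow> int rel" where
  "short_inversions n r = {(a, b). a < b \<and> b \<le> a + int n \<and> (b, a) \<in> r}"

text \<open>The inversion set of the order with pattern \<open>J\<close>. The pattern only records pairs at distance at
  most \<open>n\<close>; once \<open>a + n\<close> precedes \<open>a\<close>, so does every larger integer, whence the minimum.\<close>

definition inverted :: "nat \<Rightarrow> int rel \<Rightarrow> int \<Rightarrow> int \<Rightarrow> bool" where
  "inverted n J a b \<longleftrightarrow> a < b \<and> (a, min b (a + int n)) \<in> J"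

definition order_of_pattern :: "nat \<Rightarrow> int rel \<Rightarrow> int rel" where
  "order_of_pattern n J = {(x, y). x = y \<or> x < y \<and> \<not> inverted n J x y \<or> inverted n J y x}"

text \<open>If \<open>b\<close> came after \<open>a\<close>, then \<open>a < b < c\<close> would be a 312-pattern.\<close>

lemma avoids_312_prefix:
  assumes "TITO n r" "avoids_312 r" "(c, a) \<in> r" "a < b" "b \<le> c"
  shows "(b, a) \<in> r"
  using assms TITO_total[OF assms(1)] unfolding avoids_312_def
  by (metis order_le_less)

lemma torsion_pattern_short_inversions:
  assumes "TITO n r" "avoids_312 r"
  shows "torsion_pattern n n (short_inversions n r)"
proof -
  have mem: "(a, b) \<in> short_inversions n r \<longleftrightarrow> a < b \<and> b \<le> a + int n \<and> (b, a) \<in> r" for a b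
    unfolding short_inversions_def by simp
  have "(b + int n, a + int n) \<in> r \<longleftrightarrow> (b, a) \<in> r" for a b
    using TITO_translate[OF assms(1), of b 1 a] by simp
  then have "\<forall>a b. (a, b) \<in> short_inversions n r \<longleftrightarrow> (a + int n, b + int n) \<in> short_inversions n r"
    unfolding mem by (auto simp: add.commute)
  moreover have "\<forall>a b c. (a, c) \<in> short_inversions n r \<and> a < b \<and> b \<le> c \<longrightarrow>
      (a, b) \<in> short_inversions n r"
    unfolding mem using avoids_312_prefix[OF assms] by force
  moreover have "\<forall>a b c. (a, b) \<in> short_inversions n r \<and> (b, c) \<in> short_inversions n r \<and>
      c \<le> a + int n \<longrightarrow> (a, c) \<in> short_inversions n r"
    unfolding mem using TITO_trans[OF assms(1)] by (meson less_trans)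
  ultimately show ?thesis unfolding torsion_pattern_def using mem by blast
qed

text \<open>If \<open>a + n\<close> precedes \<open>a\<close>, translation gives that all \<open>a + m n\<close> precede \<open>a\<close>, and every \<open>b > a\<close> lies
  below one of these, so that 312-avoidance puts \<open>b\<close> before \<open>a\<close> as well. Thus the short inversions
  determine all inversions.\<close>

lemma inverted_short_inversions:
  assumes "TITO n r" "avoids_312 r" "n > 0"
  shows "inverted n (short_inversions n r) a b \<longleftrightarrow> a < b \<and> (b, a) \<in> r"
proof (cases "a < b \<and> b > a + int n")
  case True
  have *: "(a + int m * int n, a) \<in> r" if "(a + int n, a) \<in> r" for m
  proof (induction m)
    case 0
    then show ?case using TITO_refl[OF assms(1)] by simp
  next
    case (Suc m)
    have "(a + int n + int m * int n, a + int m * int n) \<in> r"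
      using that TITO_translate[OF assms(1)] by blast
    then show ?case using Suc TITO_trans[OF assms(1)] by (metis add.assoc add.commute
        distrib_right mult_1 of_nat_Suc)
  qed
  \<comment> \<open>The multiple \<open>m = b - a\<close> is large enough because \<open>n \<ge> 1\<close>.\<close>
  have "b \<le> a + int (nat (b - a)) * int n"
  proof -
    have "(b - a) * 1 \<le> (b - a) * int n" using True assms(3) by (intro mult_left_mono) auto
    moreover have "int (nat (b - a)) = b - a" using True by simp
    ultimately show ?thesis by (metis add.commute diff_le_eq mult.right_neutral)
  qed
  then have "(a + int n, a) \<in> r \<longleftrightarrow> (b, a) \<in> r"
    using True * avoids_312_prefix[OF assms(1,2)] assms(3) by (metis less_add_same_cancel1
        less_imp_le of_nat_0_less_iff)
  then show ?thesis
    using True assms(3) unfolding inverted_def short_inversions_def by (auto simp: min_def)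
next
  case False
  then show ?thesis unfolding inverted_def short_inversions_def by (auto simp: min_def)
qed

lemma order_of_short_inversions:
  assumes "TITO n r" "avoids_312 r" "n > 0"
  shows "order_of_pattern n (short_inversions n r) = r"
proof -
  have "(x, y) \<in> order_of_pattern n (short_inversions n r) \<longleftrightarrow> (x, y) \<in> r" for x y
    using TITO_order[OF assms(1)] unfolding order_of_pattern_def
      inverted_short_inversions[OF assms] mem_Collect_eq case_prod_conv
    by (metis linorder_neqE)
  then show ?thesis by auto
qed

lemma
  assumes "torsion_pattern n n J" "n > 0"
  shows inverted_prefix: "inverted n J a c \<Longrightarrow> a < b \<Longrightarrow> b \<le> c \<Longrightarrow> inverted n J a b"
    and inverted_trans: "inverted n J a b \<Longrightarrow> inverted n J b c \<Longrightarrow> inverted n J a c"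
    and inverted_translate: "inverted n J (a + int n) (b + int n) \<longleftrightarrow> inverted n J a b"
proof -
  assume *: "inverted n J a c" "a < b" "b \<le> c"
  show "inverted n J a b"
    using * torsion_pattern_prefix[OF assms(1), of a "min c (a + int n)" "min b (a + int n)"]
      assms(2) unfolding inverted_def by auto
next
  assume *: "inverted n J a b" "inverted n J b c"
  show "inverted n J a c"
  proof (cases "b < a + int n")
    case True
    have "(a, b) \<in> J" "(b, min c (a + int n)) \<in> J"
      using * True assms(2)
        torsion_pattern_prefix[OF assms(1), of b "min c (b + int n)" "min c (a + int n)"]
      unfolding inverted_def by (auto simp: min_absorb1)
    then have "(a, min c (a + int n)) \<in> J"
      using torsion_pattern_trans[OF assms(1)] by simp
    then show ?thesis using * unfolding inverted_def by auto
  next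
    case False
    then show ?thesis using * unfolding inverted_def by (auto simp: min_def split: if_splits)
  qed
next
  show "inverted n J (a + int n) (b + int n) \<longleftrightarrow> inverted n J a b"
    using torsion_pattern_translate[OF assms(1), of a 1 "min b (a + int n)"]
    unfolding inverted_def by (simp add: min_add_distrib_left)
qed

text \<open>Reversing exactly the pairs of a set of inversions gives a linear order when both the set and
  its complement are transitive. Transitivity of the complement follows from the prefix
  condition alone.\<close>

lemma
  assumes "torsion_pattern n n J" "n > 0"
  shows TITO_order_of_pattern: "TITO n (order_of_pattern n J)"
    and avoids_312_order_of_pattern: "avoids_312 (order_of_pattern n J)"
    and short_inversions_order_of_pattern: "short_inversions n (order_of_pattern n J) = J"
proof -
  let ?r = "order_of_pattern n J"
  let ?i = "inverted n J"
  note pre = inverted_prefix[OF assms] and tr = inverted_trans[OF assms]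
  have lt: "?i a b \<Longrightarrow> a < b" for a b unfolding inverted_def by simp
  have mem: "(x, y) \<in> ?r \<longleftrightarrow> x = y \<or> x < y \<and> \<not> ?i x y \<or> ?i y x" for x y
    unfolding order_of_pattern_def by simp
  have trans: "(x, z) \<in> ?r" if xy: "(x, y) \<in> ?r" and yz: "(y, z) \<in> ?r" for x y z
  proof -
    consider "x = y \<or> y = z" | "x < y" "\<not> ?i x y" "y < z" "\<not> ?i y z"
      | "x < y" "\<not> ?i x y" "?i z y" | "?i y x" "y < z" "\<not> ?i y z" | "?i y x" "?i z y"
      using xy yz mem by blast
    then show ?thesis
    proof cases
      case 1 then show ?thesis using xy yz by auto
    next
      case 2 then show ?thesis using pre[of x z y] mem by auto
    next
      case 3
      then show ?thesis using pre[of z y x] tr[of x z y] mem lt[of z y]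
        by (metis linorder_neqE order_less_imp_le)
    next
      case 4
      then show ?thesis using pre[of y x z] tr[of y x z] mem lt[of y x]
        by (metis linorder_neqE order_less_imp_le)
    next
      case 5 then show ?thesis using tr mem by blast
    qed
  qed
  have "antisym ?r"
  proof (rule antisymI)
    fix x y assume "(x, y) \<in> ?r" "(y, x) \<in> ?r"
    then show "x = y" unfolding mem using lt[of x y] lt[of y x] by auto
  qed
  moreover have "total ?r" unfolding total_on_def mem by auto
  moreover have "refl ?r" unfolding refl_on_def mem by auto
  moreover have "trans ?r" using trans by (rule transI)
  ultimately have "linear_order ?r"
    unfolding linear_order_on_def partial_order_on_def preorder_on_def by auto
  moreover have "(a, b) \<in> ?r \<longleftrightarrow> (a + int n, b + int n) \<in> ?r" for a b
    unfolding mem inverted_translate[OF assms] by simp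
  ultimately show "TITO n ?r" unfolding TITO_def by simp
  show "avoids_312 ?r"
    unfolding avoids_312_def
  proof clarify
    fix a b c assume *: "a < b" "b < c" "(c, a) \<in> ?r" "(a, b) \<in> ?r"
    then have "?i a c" unfolding mem using lt[of c a] by auto
    then have "?i a b" using * pre[of a c b] by simp
    then show False using * lt[of b a] unfolding mem by auto
  qed
  have "(a, b) \<in> short_inversions n ?r \<longleftrightarrow> (a, b) \<in> J" for a b
    unfolding short_inversions_def mem_Collect_eq case_prod_conv mem
    using torsion_pattern_bounds[OF assms(1), of a b] lt[of b a]
    by (auto simp: inverted_def min_absorb1)
  then show "short_inversions n ?r = J" by auto
qed

text \<open>Inversions are stored as translation classes; by invariance of both orders nothing is lost by
  comparing representatives.\<close>

lemma inversions_subset_iff: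
  assumes "TITO n r" "avoids_312 r" "TITO n s" "avoids_312 s" "n > 0"
  shows "inversions n r \<subseteq> inversions n s \<longleftrightarrow> short_inversions n r \<subseteq> short_inversions n s"
proof
  assume sub: "inversions n r \<subseteq> inversions n s"
  show "short_inversions n r \<subseteq> short_inversions n s"
  proof clarify
    fix a b assume ab: "(a, b) \<in> short_inversions n r"
    then have "refl_index n a b \<in> inversions n s"
      using sub unfolding short_inversions_def inversions_def by blast
    then obtain a' b' where *: "refl_index n a b = refl_index n a' b'" "a' < b'" "(b', a') \<in> s"
      unfolding inversions_def by blast
    have "(a, b) \<in> refl_index n a b"
      unfolding refl_index_def by (auto intro: exI[of _ 0])
    then have "(a, b) \<in> refl_index n a' b'" using * by simp
    then obtain l where "a = a' + l * int n" "b = b' + l * int n"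
      unfolding refl_index_def by blast
    then have "(b, a) \<in> s" using * TITO_translate[OF assms(3)] by simp
    then show "(a, b) \<in> short_inversions n s" using ab unfolding short_inversions_def by simp
  qed
next
  assume "short_inversions n r \<subseteq> short_inversions n s"
  then have "a < b \<Longrightarrow> (b, a) \<in> r \<Longrightarrow> (b, a) \<in> s" for a b
    using inverted_short_inversions[OF assms(1,2,5), of a b]
      inverted_short_inversions[OF assms(3,4,5), of a b]
    unfolding inverted_def by blast
  then show "inversions n r \<subseteq> inversions n s" unfolding inversions_def by blast
qed

definition pattern_poset :: "nat \<Rightarrow> nat \<Rightarrow> int rel gorder" where
  "pattern_poset n k = \<lparr>carrier = {J. torsion_pattern n k J}, eq = (=), le = (\<subseteq>)\<rparr>"

lemma order_isomorphicI:
  assumes "weak_partial_order A" "weak_partial_order B"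
    and "bij_betw f (carrier A) (carrier B)"
    and "\<And>x y. x \<in> carrier A \<Longrightarrow> y \<in> carrier A \<Longrightarrow> f x \<sqsubseteq>\<^bsub>B\<^esub> f y \<longleftrightarrow> x \<sqsubseteq>\<^bsub>A\<^esub> y"
  shows "order_isomorphic A B"
  using assms bij_betwE unfolding order_isomorphic_def order_emb_def by blast

lemma partial_orderI:
  assumes "eq L = (=)"
    and "\<And>x. x \<in> carrier L \<Longrightarrow> x \<sqsubseteq>\<^bsub>L\<^esub> x"
    and "\<And>x y. x \<in> carrier L \<Longrightarrow> y \<in> carrier L \<Longrightarrow> x \<sqsubseteq>\<^bsub>L\<^esub> y \<Longrightarrow> y \<sqsubseteq>\<^bsub>L\<^esub> x \<Longrightarrow> x = y"
    and "\<And>x y z. x \<in> carrier L \<Longrightarrow> y \<in> carrier L \<Longrightarrow> z \<in> carrier L \<Longrightarrow>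
      x \<sqsubseteq>\<^bsub>L\<^esub> y \<Longrightarrow> y \<sqsubseteq>\<^bsub>L\<^esub> z \<Longrightarrow> x \<sqsubseteq>\<^bsub>L\<^esub> z"
  shows "partial_order L"
  by (unfold_locales; (unfold assms(1))?) (blast intro: assms(2-4))+

lemma partial_order_pattern_poset: "partial_order (pattern_poset n k)"
  by (rule partial_orderI) (auto simp: pattern_poset_def)

lemma short_inversions_inject:
  assumes "TITO n r" "avoids_312 r" "TITO n s" "avoids_312 s" "n > 0"
    and "inversions n r \<subseteq> inversions n s" "inversions n s \<subseteq> inversions n r"
  shows "r = s"
proof -
  have "short_inversions n r = short_inversions n s"
    using inversions_subset_iff[OF assms(1-5)] inversions_subset_iff[OF assms(3,4,1,2,5)] assms(6,7)
    by simp
  then show ?thesis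
    using order_of_short_inversions[OF assms(1,2,5)] order_of_short_inversions[OF assms(3-5)]
    by metis
qed

lemma
  assumes "n > 0"
  shows partial_order_CTam: "partial_order (CTam n)"
    and partial_order_ATam: "partial_order (ATam n)"
proof -
  show "partial_order (CTam n)"
  proof (rule partial_orderI)
    fix r s assume "r \<in> carrier (CTam n)" "s \<in> carrier (CTam n)" "r \<sqsubseteq>\<^bsub>CTam n\<^esub> s" "s \<sqsubseteq>\<^bsub>CTam n\<^esub> r"
    then show "r = s" using short_inversions_inject[of n r s, OF _ _ _ _ assms]
      by (simp only: CTam_def gorder.simps eq_object.simps partial_object.simps mem_Collect_eq)
  qed (auto simp add: CTam_def)
  show "partial_order (ATam n)"
  proof (rule partial_orderI)
    fix r s assume "r \<in> carrier (ATam n)" "s \<in> carrier (ATam n)" "r \<sqsubseteq>\<^bsub>ATam n\<^esub> s" "s \<sqsubseteq>\<^bsub>ATam n\<^esub> r"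
    then show "r = s" using short_inversions_inject[of n r s, OF _ _ _ _ assms]
      by (simp only: ATam_def gorder.simps eq_object.simps partial_object.simps mem_Collect_eq)
  qed (auto simp add: ATam_def)
qed

lemma order_of_pattern_in_CTam:
  "torsion_pattern n n J \<Longrightarrow> n > 0 \<Longrightarrow> order_of_pattern n J \<in> carrier (CTam n)"
  unfolding CTam_def using TITO_order_of_pattern avoids_312_order_of_pattern by simp

lemma order_of_pattern_le_iff:
  assumes "torsion_pattern n n I" "torsion_pattern n n J" "n > 0"
  shows "order_of_pattern n I \<sqsubseteq>\<^bsub>CTam n\<^esub> order_of_pattern n J \<longleftrightarrow> I \<subseteq> J"
  using inversions_subset_iff[of n "order_of_pattern n I" "order_of_pattern n J"] assms
    TITO_order_of_pattern avoids_312_order_of_pattern short_inversions_order_of_pattern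
  unfolding CTam_def by simp

lemma CTam_cases:
  assumes "r \<in> carrier (CTam n)" "n > 0"
  obtains J where "torsion_pattern n n J" "r = order_of_pattern n J"
  using assms order_of_short_inversions torsion_pattern_short_inversions unfolding CTam_def
  by (metis (no_types, lifting) mem_Collect_eq partial_object.select_convs(1))

lemma pattern_poset_isomorphic_CTam:
  assumes "n > 0"
  shows "order_isomorphic (pattern_poset n n) (CTam n)"
proof (rule order_isomorphicI)
  show "weak_partial_order (pattern_poset n n)"
    using partial_order_pattern_poset by (simp add: partial_order_def)
  show "weak_partial_order (CTam n)"
    using partial_order_CTam[OF assms] by (simp add: partial_order_def)
  show "bij_betw (order_of_pattern n) (carrier (pattern_poset n n)) (carrier (CTam n))"
    unfolding pattern_poset_def CTam_def
    by (rule bij_betw_byWitness[where f' = "short_inversions n"])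
      (auto simp: assms short_inversions_order_of_pattern order_of_short_inversions
        TITO_order_of_pattern avoids_312_order_of_pattern torsion_pattern_short_inversions)
qed (auto simp: pattern_poset_def order_of_pattern_le_iff assms)

section \<open>Real orders\<close>

text \<open>Suppose \<open>a + n\<close> precedes \<open>a\<close>. The class of \<open>a\<close> modulo \<open>n\<close> is a block by itself precisely when no
  \<open>b\<close> strictly between \<open>a\<close> and \<open>a + n\<close> lies between \<open>a + n\<close> and \<open>a\<close> in the order. As every such \<open>b\<close>
  precedes \<open>a\<close> anyway, this fails iff some such \<open>b\<close> comes after \<open>a + n\<close>. So an order is real iff
  this happens for every \<open>a\<close> of a waning block.\<close>

lemma real_TITO_iff:
  assumes "TITO n r" "avoids_312 r" "n > 0"
  shows "real_TITO n r \<longleftrightarrow>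
    (\<forall>a. (a + int n, a) \<in> r \<longrightarrow> (\<exists>b. a < b \<and> b < a + int n \<and> (a + int n, b) \<in> r))"
    (is "_ \<longleftrightarrow> (\<forall>a. ?w a \<longrightarrow> ?e a)")
proof
  note rfl = TITO_refl[OF assms(1)] and tr = TITO_trans[OF assms(1)]
    and asym = TITO_antisym[OF assms(1)] and tot = TITO_total[OF assms(1)]
    and shift = TITO_translate[OF assms(1)] and pre = avoids_312_prefix[OF assms(1,2)]
  show "\<forall>a. ?w a \<longrightarrow> ?e a" if real: "real_TITO n r"
  proof (intro allI impI, rule ccontr)
    fix a assume wane: "?w a" and none: "\<not> ?e a"
    let ?I = "{a + l * int n | l. True}"
    have step: "(a + (l + 1) * int n, a + l * int n) \<in> r" for l
      using wane shift[of "a + int n" l a] by (simp add: algebra_simps)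
    have mono: "(a + l * int n, a + m * int n) \<in> r" if "m \<le> l" for l m
      using that
    proof (induction l rule: int_ge_induct)
      case (step i)
      then show ?case using \<open>\<And>l. (a + (l + 1) * int n, a + l * int n) \<in> r\<close>[of i] tr by blast
    qed (rule rfl)
    have mono_iff: "(a + l * int n, a + m * int n) \<in> r \<longleftrightarrow> m \<le> l" for l m
      using mono[of m l] mono[of l m] asym[of "a + l * int n" "a + m * int n"] assms(3)
      by (metis add_left_cancel linorder_linear mult_cancel_right of_nat_0_less_iff order_less_irrefl)
    \<comment> \<open>Every integer outside the class of \<open>a\<close> precedes the whole class, so the class is convex.\<close>
    have below: "(y, z) \<in> r" if z: "z \<in> ?I" and y: "y \<notin> ?I" for y z
    proof -
      define m where "m = (y - a) div int n"
      define b where "b = a + (y - a) mod int n"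
      have yb: "y = b + m * int n" unfolding m_def b_def by (simp add: algebra_simps)
      have "b \<noteq> a" using y yb by auto
      then have b: "a < b" "b < a + int n"
        unfolding b_def using assms(3) pos_mod_sign[of "int n" "y - a"]
          pos_mod_bound[of "int n" "y - a"] by linarith+
      have "(a + int n, b) \<notin> r" using none b by blast
      then have top: "(a + (m + 1) * int n, y) \<notin> r"
        using shift[of "a + int n" m b] yb by (simp add: algebra_simps)
      obtain j where j: "z = a + j * int n" using z by blast
      show ?thesis
      proof (cases "j \<le> m + 1")
        case True
        then show ?thesis using mono[OF True] top tot tr j by metis
      next
        case False
        have 1: "a + (m + 1) * int n \<le> z"
          using False assms(3) unfolding j by (intro add_left_mono mult_right_mono) auto
        have 2: "y < a + (m + 1) * int n" using b yb by (simp add: algebra_simps)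
        have "(z, y) \<notin> r" using pre[of z y] 1 2 top by blast
        then show ?thesis using tot by blast
      qed
    qed
    have "is_block r ?I"
      unfolding is_block_def
    proof (intro conjI ballI allI impI)
      fix x z y assume "x \<in> ?I" "z \<in> ?I" "(x, y) \<in> r \<and> (y, z) \<in> r"
      then show "y \<in> ?I" using below[of x y] asym[of x y] by metis
    next
      fix x assume "x \<in> ?I"
      then obtain l where l: "x = a + l * int n" by blast
      show "\<exists>y\<in>?I. y \<noteq> x \<and> (y, x) \<in> r"
        using step[of l] l assms(3) by (intro bexI[of _ "a + (l + 1) * int n"]) auto
      show "\<exists>y\<in>?I. y \<noteq> x \<and> (x, y) \<in> r"
        using step[of "l - 1"] l assms(3) by (intro bexI[of _ "a + (l - 1) * int n"]) auto
    next
      fix x z assume "x \<in> ?I" "z \<in> ?I"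
      then obtain l m where lm: "x = a + l * int n" "z = a + m * int n" by blast
      have "{y. (x, y) \<in> r \<and> (y, z) \<in> r} \<subseteq> (\<lambda>j. a + j * int n) ` {m..l}"
      proof clarify
        fix y assume y: "(x, y) \<in> r" "(y, z) \<in> r"
        then have "y \<in> ?I" using below[of x y] asym[of x y] \<open>x \<in> ?I\<close> by metis
        then show "y \<in> (\<lambda>j. a + j * int n) ` {m..l}" using y lm mono_iff by auto
      qed
      then show "finite {y. (x, y) \<in> r \<and> (y, z) \<in> r}" using finite_surj by blast
    qed auto
    moreover have "(\<lambda>x. x mod int n) ` ?I = {a mod int n}" by auto
    then have "block_size n ?I = 1" unfolding block_size_def by simp
    ultimately have "waxing n r ?I" using real unfolding real_TITO_def by blast
    moreover have "a \<in> ?I" by (auto intro: exI[of _ 0])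
    ultimately have "(a, a + int n) \<in> r" unfolding waxing_def by blast
    then show False using wane asym assms(3) by fastforce
  qed
  show "real_TITO n r" if ex: "\<forall>a. ?w a \<longrightarrow> ?e a"
    unfolding real_TITO_def waxing_def
  proof (intro allI impI ballI, rule ccontr, elim conjE)
    fix I x assume block: "is_block r I" and size: "block_size n I = 1" and x: "x \<in> I"
      and "(x, x + int n) \<notin> r"
    then have wane: "(x + int n, x) \<in> r" using tot by blast
    obtain u where u: "(\<lambda>x. x mod int n) ` I = {u}"
      using size card_1_singletonE unfolding block_size_def by metis
    have cong: "y mod int n = x mod int n" if "y \<in> I" for y
      using u x that by (metis (mono_tags, lifting) image_eqI singletonD)
    have convex: "y \<in> I" if "v \<in> I" "w \<in> I" "(v, y) \<in> r" "(y, w) \<in> r" for v w y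
      using block that unfolding is_block_def by blast
    obtain y where y: "y \<in> I" "y \<noteq> x" "(y, x) \<in> r" using block x unfolding is_block_def by blast
    obtain l where l: "y = x + l * int n"
      using cong[OF y(1)] by (metis add.commute mod_eqE mult.commute)
    have chain: "(x + int j * int n, x) \<in> r" for j
    proof (induction j)
      case (Suc j)
      then show ?case using tr[OF _ Suc, of "x + int (Suc j) * int n"]
          shift[of "x + int n" "int j" x] wane by (simp add: algebra_simps)
    qed (simp add: rfl)
    \<comment> \<open>The class of \<open>x\<close> is descending, so an element of it that precedes \<open>x\<close> is larger than \<open>x\<close>.\<close>
    have "l \<ge> 1"
    proof (rule ccontr)
      assume "\<not> l \<ge> 1"
      then have "(x + - l * int n, x) \<in> r" using chain[of "nat (- l)"] by simp
      then have "(x, y) \<in> r" using shift[of "x + - l * int n" l x] l by simp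
      then show False using y asym by blast
    qed
    then have "(x + (l - 1) * int n, x) \<in> r" using chain[of "nat (l - 1)"] by simp
    then have "(y, x + int n) \<in> r"
      using shift[of "x + (l - 1) * int n" 1 x] l by (simp add: algebra_simps)
    then have "x + int n \<in> I" using convex y(1) x wane by blast
    moreover obtain b where b: "x < b" "b < x + int n" "(x + int n, b) \<in> r"
      using ex wane by blast
    moreover have "(b, x) \<in> r" using pre[OF wane] b by simp
    ultimately have "b \<in> I" using convex x by blast
    then have "(b - x) mod int n = 0" using cong by (simp add: mod_diff_eq mod_eq_dvd_iff)
    then show False using b zdvd_not_zless[of "b - x" "int n"] by auto
  qed
qed


text \<open>The pattern of the real order whose inversions at distance less than \<open>n\<close> are given: the inversion
  \<open>(a, a + n)\<close> is added only when transitivity forces it.\<close>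

definition completion :: "nat \<Rightarrow> int rel \<Rightarrow> int rel" where
  "completion n J = J \<union> {(a, a + int n) | a. \<exists>b. (a, b) \<in> J \<and> (b, a + int n) \<in> J}"

lemma torsion_pattern_completion:
  assumes J: "torsion_pattern n (n - 1) J" and "n > 0"
  shows "torsion_pattern n n (completion n J)"
proof -
  note bnd = torsion_pattern_bounds[OF J] and pre = torsion_pattern_prefix[OF J]
    and tr = torsion_pattern_trans[OF J]
  have shift: "(a + int n, b + int n) \<in> J \<longleftrightarrow> (a, b) \<in> J" for a b
    using torsion_pattern_translate[OF J, of a 1 b] by simp
  have n1: "int (n - 1) = int n - 1" using assms(2) by simp
  have mem: "(a, c) \<in> completion n J \<longleftrightarrow>
      (a, c) \<in> J \<or> c = a + int n \<and> (\<exists>b. (a, b) \<in> J \<and> (b, a + int n) \<in> J)" for a c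
    unfolding completion_def by auto
  have short: "(a, c) \<in> J" if "(a, c) \<in> completion n J" "c < a + int n" for a c
    using that unfolding mem by auto
  have pre': "(a, b) \<in> completion n J"
    if ac: "(a, c) \<in> completion n J" and ab: "a < b" and bc: "b \<le> c" for a b c
  proof (cases "(a, c) \<in> J \<or> b = c")
    case True
    then show ?thesis using ac ab bc pre[of a c b] unfolding mem by blast
  next
    case False
    then obtain x where x: "c = a + int n" "(a, x) \<in> J" "(x, a + int n) \<in> J"
      using ac unfolding mem by blast
    have "b < c" using False bc by simp
    have "(a, b) \<in> J"
    proof (cases "b \<le> x")
      case True
      then show ?thesis using pre x ab by blast
    next
      case f: False
      then have "(x, b) \<in> J" using pre[OF x(3)] x \<open>b < c\<close> by simp
      then show ?thesis using tr[OF x(2)] x \<open>b < c\<close> n1 by simp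
    qed
    then show ?thesis unfolding mem by simp
  qed
  have tr': "(a, c) \<in> completion n J"
    if "(a, b) \<in> completion n J" "(b, c) \<in> completion n J" "c \<le> a + int n" for a b c
  proof (cases "b < a + int n")
    case True
    have ab: "(a, b) \<in> J" using short that True by blast
    then have bc: "(b, c) \<in> J" using short[OF that(2)] that(3) bnd[OF ab] by simp
    show ?thesis
    proof (cases "c = a + int n")
      case c: True
      then show ?thesis using ab bc unfolding mem by auto
    next
      case False
      then show ?thesis using tr[OF ab bc] that n1 unfolding mem by simp
    qed
  next
    case False
    have "b < c" using that(2) bnd[of b c] assms(2) unfolding mem by auto
    then show ?thesis using False that by simp
  qed
  have "a < c \<and> c \<le> a + int n" if "(a, c) \<in> completion n J" for a c
    using that bnd[of a c] assms(2) n1 unfolding mem by auto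
  moreover have "(a, b) \<in> completion n J \<longleftrightarrow> (a + int n, b + int n) \<in> completion n J" for a b
  proof -
    have "(\<exists>x. (a + int n, x) \<in> J \<and> (x, a + int n + int n) \<in> J) \<longleftrightarrow>
        (\<exists>x. (a, x) \<in> J \<and> (x, a + int n) \<in> J)"
      using shift by (metis diff_add_cancel)
    then show ?thesis unfolding mem shift by auto
  qed
  ultimately show ?thesis unfolding torsion_pattern_def using pre' tr' by blast
qed

lemma completion_proper_part:
  assumes "torsion_pattern n (n - 1) J" "n > 0"
  shows "(a, b) \<in> completion n J \<and> b < a + int n \<longleftrightarrow> (a, b) \<in> J"
  using torsion_pattern_bounds[OF assms(1), of a b] assms(2) unfolding completion_def by auto

definition proper_part :: "nat \<Rightarrow> int rel \<Rightarrow> int rel" where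
  "proper_part n J = {(a, b) \<in> J. b < a + int n}"

lemma torsion_pattern_proper_part:
  assumes "torsion_pattern n n J" "n > 0"
  shows "torsion_pattern n (n - 1) (proper_part n J)"
proof -
  have n1: "int (n - 1) = int n - 1" using assms(2) by simp
  have mem: "(a, b) \<in> proper_part n J \<longleftrightarrow> (a, b) \<in> J \<and> b < a + int n" for a b
    unfolding proper_part_def by simp
  have shift: "(a + int n, b + int n) \<in> J \<longleftrightarrow> (a, b) \<in> J" for a b
    using torsion_pattern_translate[OF assms(1), of a 1 b] by simp
  have "\<forall>a b. (a, b) \<in> proper_part n J \<longrightarrow> a < b \<and> b \<le> a + int (n - 1)"
    unfolding mem n1 using torsion_pattern_bounds[OF assms(1)] by simp
  moreover have "\<forall>a b. (a, b) \<in> proper_part n J \<longleftrightarrow> (a + int n, b + int n) \<in> proper_part n J"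
    unfolding mem shift by auto
  moreover have "\<forall>a b c. (a, c) \<in> proper_part n J \<and> a < b \<and> b \<le> c \<longrightarrow> (a, b) \<in> proper_part n J"
    unfolding mem using torsion_pattern_prefix[OF assms(1)] by (meson le_less_trans)
  moreover have "\<forall>a b c. (a, b) \<in> proper_part n J \<and> (b, c) \<in> proper_part n J \<and>
      c \<le> a + int (n - 1) \<longrightarrow> (a, c) \<in> proper_part n J"
    unfolding mem n1 using torsion_pattern_trans[OF assms(1)] by (auto intro: torsion_pattern_trans[OF assms(1)])
  ultimately show ?thesis unfolding torsion_pattern_def by blast
qed

lemma real_order_of_pattern_iff:
  assumes "torsion_pattern n n J" "n > 0"
  shows "real_TITO n (order_of_pattern n J) \<longleftrightarrow>
    (\<forall>a. (a, a + int n) \<in> J \<longrightarrow> (\<exists>b. a < b \<and> b < a + int n \<and> (b, a + int n) \<in> J))"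
proof -
  let ?r = "order_of_pattern n J"
  have *: "(b, a) \<in> ?r \<longleftrightarrow> (a, b) \<in> J" if "a < b" "b \<le> a + int n" for a b
    using that short_inversions_order_of_pattern[OF assms] unfolding short_inversions_def by auto
  have "(a + int n, a) \<in> ?r \<longleftrightarrow> (a, a + int n) \<in> J"
    "a < b \<and> b < a + int n \<and> (a + int n, b) \<in> ?r \<longleftrightarrow> a < b \<and> b < a + int n \<and> (b, a + int n) \<in> J"
    for a b
    using *[of a "a + int n"] *[of b "a + int n"] assms(2) by auto
  then show ?thesis
    using real_TITO_iff[OF TITO_order_of_pattern[OF assms] avoids_312_order_of_pattern[OF assms]
        assms(2)] by simp
qed

text \<open>Realness says that every inversion \<open>(a, a + n)\<close> is forced by shorter ones.\<close>

lemma completion_proper_part_eq: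
  assumes J: "torsion_pattern n n J" and "n > 0"
    and real: "real_TITO n (order_of_pattern n J)"
  shows "completion n (proper_part n J) = J"
proof -
  note bnd = torsion_pattern_bounds[OF J]
  have "(a, c) \<in> completion n (proper_part n J) \<longleftrightarrow> (a, c) \<in> J" for a c
  proof
    assume "(a, c) \<in> completion n (proper_part n J)"
    then show "(a, c) \<in> J"
      using torsion_pattern_trans[OF J] unfolding completion_def proper_part_def by auto
  next
    assume ac: "(a, c) \<in> J"
    show "(a, c) \<in> completion n (proper_part n J)"
    proof (cases "c < a + int n")
      case True
      then show ?thesis using ac unfolding completion_def proper_part_def by simp
    next
      case False
      then have c: "c = a + int n" using bnd[OF ac] by simp
      then obtain b where b: "a < b" "b < a + int n" "(b, a + int n) \<in> J"
        using real ac unfolding real_order_of_pattern_iff[OF J assms(2)] by blast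
      then have "(a, b) \<in> J" using torsion_pattern_prefix[OF J ac] c by simp
      then show ?thesis using b c unfolding completion_def proper_part_def by auto
    qed
  qed
  then show ?thesis by auto
qed

lemma real_completion:
  assumes J: "torsion_pattern n (n - 1) J" and "n > 0"
  shows "real_TITO n (order_of_pattern n (completion n J))"
  unfolding real_order_of_pattern_iff[OF torsion_pattern_completion[OF assms] assms(2)]
proof (intro allI impI)
  fix a assume "(a, a + int n) \<in> completion n J"
  then have "\<exists>b. (a, b) \<in> J \<and> (b, a + int n) \<in> J"
    using torsion_pattern_bounds[OF J, of a "a + int n"] assms(2) unfolding completion_def by auto
  then obtain b where b: "(a, b) \<in> J" "(b, a + int n) \<in> J" by blast
  then show "\<exists>b. a < b \<and> b < a + int n \<and> (b, a + int n) \<in> completion n J"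
    using torsion_pattern_bounds[OF J b(1)] torsion_pattern_bounds[OF J b(2)]
    unfolding completion_def by auto
qed

lemma pattern_poset_isomorphic_ATam:
  assumes "n > 0"
  shows "order_isomorphic (pattern_poset n (n - 1)) (ATam n)"
proof (rule order_isomorphicI)
  let ?C = "{J. torsion_pattern n (n - 1) J}"
  let ?f = "\<lambda>J. order_of_pattern n (completion n J)"
  let ?g = "\<lambda>r. proper_part n (short_inversions n r)"
  have gf: "?g (?f J) = J" if "torsion_pattern n (n - 1) J" for J
    using completion_proper_part[OF that assms]
      short_inversions_order_of_pattern[OF torsion_pattern_completion[OF that assms] assms]
    unfolding proper_part_def by auto
  show "weak_partial_order (pattern_poset n (n - 1))" "weak_partial_order (ATam n)"
    using partial_order_pattern_poset partial_order_ATam[OF assms]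
    by (simp_all add: partial_order_def)
  have "bij_betw ?f ?C {r. TITO n r \<and> avoids_312 r \<and> real_TITO n r}"
  proof (rule bij_betw_byWitness[where f' = ?g])
    show "\<forall>J\<in>?C. ?g (?f J) = J" using gf by blast
    have *: "?f (?g r) = r \<and> torsion_pattern n (n - 1) (?g r)"
      if r: "TITO n r" "avoids_312 r" "real_TITO n r" for r
    proof -
      let ?J = "short_inversions n r"
      have J: "torsion_pattern n n ?J" and eq: "order_of_pattern n ?J = r"
        using torsion_pattern_short_inversions order_of_short_inversions r assms by blast+
      then have "completion n (proper_part n ?J) = ?J"
        using completion_proper_part_eq assms r(3) by simp
      then show ?thesis using eq torsion_pattern_proper_part[OF J assms] by simp
    qed
    then show "\<forall>r\<in>{r. TITO n r \<and> avoids_312 r \<and> real_TITO n r}. ?f (?g r) = r"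
      "?g ` {r. TITO n r \<and> avoids_312 r \<and> real_TITO n r} \<subseteq> ?C" by blast+
    show "?f ` ?C \<subseteq> {r. TITO n r \<and> avoids_312 r \<and> real_TITO n r}"
      using torsion_pattern_completion[OF _ assms] real_completion[OF _ assms]
        TITO_order_of_pattern[OF _ assms] avoids_312_order_of_pattern[OF _ assms] by blast
  qed
  then show "bij_betw ?f (carrier (pattern_poset n (n - 1))) (carrier (ATam n))"
    unfolding pattern_poset_def ATam_def by simp
  fix I J
  assume "I \<in> carrier (pattern_poset n (n - 1))" "J \<in> carrier (pattern_poset n (n - 1))"
  then have IJ: "torsion_pattern n (n - 1) I" "torsion_pattern n (n - 1) J"
    unfolding pattern_poset_def by simp_all
  have "?f I \<sqsubseteq>\<^bsub>ATam n\<^esub> ?f J \<longleftrightarrow> completion n I \<subseteq> completion n J"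
    using order_of_pattern_le_iff[OF torsion_pattern_completion[OF IJ(1) assms]
        torsion_pattern_completion[OF IJ(2) assms] assms]
    unfolding ATam_def CTam_def by simp
  also have "\<dots> \<longleftrightarrow> I \<subseteq> J"
  proof
    assume "completion n I \<subseteq> completion n J"
    then show "I \<subseteq> J"
      using completion_proper_part[OF IJ(1) assms] completion_proper_part[OF IJ(2) assms] by fast
  qed (auto simp: completion_def)
  finally show "?f I \<sqsubseteq>\<^bsub>ATam n\<^esub> ?f J \<longleftrightarrow> I \<sqsubseteq>\<^bsub>pattern_poset n (n - 1)\<^esub> J"
    unfolding pattern_poset_def by simp
qed

section \<open>Join-irreducible elements and the map kappa\<close>

text \<open>The least pattern containing \<open>(a, b)\<close>, for \<open>b \<le> a + n\<close>: the strings that are quotients of the string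
  of \<open>(a, b)\<close>.\<close>

definition row :: "nat \<Rightarrow> int \<Rightarrow> int \<Rightarrow> int rel" where
  "row n a b = {(x, y). \<exists>l. x = a + l * int n \<and> x < y \<and> y \<le> b + l * int n}"

text \<open>The pairs \<open>(a, b)\<close> whose string has no nonzero map to the string of \<open>(c, d)\<close>: such a map exists
  exactly when some translate satisfies \<open>c \<le> a < d \<le> b\<close>, its image being the string of \<open>(a, d)\<close>.\<close>

definition barrier :: "nat \<Rightarrow> int \<Rightarrow> int \<Rightarrow> int rel" where
  "barrier n c d = {(a, b). a < b \<and> b \<le> a + int n \<and>
     \<not> (\<exists>l. c + l * int n \<le> a \<and> a < d + l * int n \<and> d + l * int n \<le> b)}"

lemma multiple_gap:
  fixes l m :: int
  assumes "l < m"
  shows "l * int n + int n \<le> m * int n"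
  using mult_right_mono[of "l + 1" m "int n"] assms by (simp add: algebra_simps)

lemma row_iff: "(x, y) \<in> row n a b \<longleftrightarrow> (\<exists>l. x = a + l * int n \<and> x < y \<and> y \<le> b + l * int n)"
  unfolding row_def by simp

lemma row_top_notin: "(a, b) \<notin> row n a (b - 1)"
proof
  assume "(a, b) \<in> row n a (b - 1)"
  then obtain l where "a = a + l * int n" "b \<le> b - 1 + l * int n" unfolding row_iff by blast
  then show False by linarith
qed

lemma barrier_iff:
  "(a, b) \<in> barrier n c d \<longleftrightarrow> a < b \<and> b \<le> a + int n \<and>
     \<not> (\<exists>l. c + l * int n \<le> a \<and> a < d + l * int n \<and> d + l * int n \<le> b)"
  unfolding barrier_def by simp

lemma torsion_patternI:
  assumes "\<And>a b. (a, b) \<in> J \<Longrightarrow> a < b \<and> b \<le> a + int k"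
    and "\<And>a b l. (a, b) \<in> J \<Longrightarrow> (a + l * int n, b + l * int n) \<in> J"
    and "\<And>a b c. (a, c) \<in> J \<Longrightarrow> a < b \<Longrightarrow> b \<le> c \<Longrightarrow> (a, b) \<in> J"
    and "\<And>a b c. (a, b) \<in> J \<Longrightarrow> (b, c) \<in> J \<Longrightarrow> c \<le> a + int k \<Longrightarrow> (a, c) \<in> J"
  shows "torsion_pattern n k J"
proof -
  have "(a, b) \<in> J \<longleftrightarrow> (a + int n, b + int n) \<in> J" for a b
    using assms(2)[of a b 1] assms(2)[of "a + int n" "b + int n" "-1"] by auto
  then show ?thesis unfolding torsion_pattern_def using assms(1,3,4) by blast
qed

text \<open>Two composable pairs in a row start at distinct translates of \<open>a\<close>, which are at least \<open>n\<close> apart, so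
  their composite is too long to be required.\<close>

lemma torsion_pattern_row:
  assumes "a \<le> b" "b \<le> a + int n"
  shows "torsion_pattern n n (row n a b)"
proof (rule torsion_patternI)
  fix x y l assume "(x, y) \<in> row n a b"
  then obtain m where "x = a + m * int n" "x < y" "y \<le> b + m * int n" unfolding row_iff by blast
  then show "(x + l * int n, y + l * int n) \<in> row n a b"
    unfolding row_iff by (intro exI[of _ "m + l"]) (simp add: algebra_simps)
next
  fix x y z assume xy: "(x, y) \<in> row n a b" and yz: "(y, z) \<in> row n a b" and zx: "z \<le> x + int n"
  obtain l where l: "x = a + l * int n" "x < y" using xy unfolding row_iff by blast
  obtain m where m: "y = a + m * int n" "y < z" using yz unfolding row_iff by blast
  have "l < m"
    using l m by (metis add_less_cancel_left less_le_not_le mult_right_mono not_le of_nat_0_le_iff)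
  then have False using multiple_gap[of l m n] l m zx by simp
  then show "(x, z) \<in> row n a b" ..
qed (use assms in \<open>auto simp: row_iff\<close>)

lemma row_subset_iff:
  assumes "torsion_pattern n n J" "a < b"
  shows "row n a b \<subseteq> J \<longleftrightarrow> (a, b) \<in> J"
proof
  assume "(a, b) \<in> J"
  show "row n a b \<subseteq> J"
  proof clarify
    fix x y assume "(x, y) \<in> row n a b"
    then obtain l where l: "x = a + l * int n" "x < y" "y \<le> b + l * int n"
      unfolding row_iff by blast
    have "(x, b + l * int n) \<in> J"
      using \<open>(a, b) \<in> J\<close> torsion_pattern_translate[OF assms(1)] l by simp
    then show "(x, y) \<in> J" using torsion_pattern_prefix[OF assms(1)] l by blast
  qed
next
  have "(a, b) \<in> row n a b" unfolding row_iff using assms(2) by (intro exI[of _ 0]) simp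
  then show "row n a b \<subseteq> J \<Longrightarrow> (a, b) \<in> J" by blast
qed

text \<open>A translate of \<open>d\<close> that lies in the composite of two adjacent intervals lies in one of them, which
  gives closure under composition.\<close>

lemma torsion_pattern_barrier: "torsion_pattern n n (barrier n c d)"
proof (rule torsion_patternI)
  fix a b l assume ab: "(a, b) \<in> barrier n c d"
  show "(a + l * int n, b + l * int n) \<in> barrier n c d"
    unfolding barrier_iff
  proof (intro conjI notI)
    assume "\<exists>m. c + m * int n \<le> a + l * int n \<and> a + l * int n < d + m * int n \<and>
      d + m * int n \<le> b + l * int n"
    then obtain m where "c + m * int n \<le> a + l * int n" "a + l * int n < d + m * int n"
      "d + m * int n \<le> b + l * int n" by blast
    then have "c + (m - l) * int n \<le> a" "a < d + (m - l) * int n" "d + (m - l) * int n \<le> b"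
      by (simp_all add: algebra_simps)
    then show False using ab unfolding barrier_iff by blast
  qed (use ab in \<open>auto simp: barrier_iff\<close>)
next
  fix x y z assume xy: "(x, y) \<in> barrier n c d" and yz: "(y, z) \<in> barrier n c d"
    and zx: "z \<le> x + int n"
  show "(x, z) \<in> barrier n c d"
    unfolding barrier_iff
  proof (intro conjI notI)
    assume "\<exists>l. c + l * int n \<le> x \<and> x < d + l * int n \<and> d + l * int n \<le> z"
    then obtain l where l: "c + l * int n \<le> x" "x < d + l * int n" "d + l * int n \<le> z" by blast
    show False
    proof (cases "d + l * int n \<le> y")
      case True
      then show ?thesis using xy l unfolding barrier_iff by blast
    next
      case False
      then have "c + l * int n \<le> y" "y < d + l * int n" using l xy unfolding barrier_iff by auto
      then show ?thesis using yz l unfolding barrier_iff by blast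
    qed
  qed (use xy yz zx in \<open>auto simp: barrier_iff\<close>)
next
  fix x y z assume *: "(x, z) \<in> barrier n c d" "x < y" "y \<le> z"
  then show "(x, y) \<in> barrier n c d" unfolding barrier_iff by (meson order.trans)
qed (auto simp: barrier_iff)

lemma CTam_join:
  assumes "torsion_pattern n n I" "torsion_pattern n n J" "torsion_pattern n n (I \<union> J)" "n > 0"
  shows "order_of_pattern n I \<squnion>\<^bsub>CTam n\<^esub> order_of_pattern n J = order_of_pattern n (I \<union> J)"
proof -
  interpret partial_order "CTam n" using partial_order_CTam[OF assms(4)] .
  note carr = order_of_pattern_in_CTam[OF _ assms(4)]
  note le = order_of_pattern_le_iff[OF _ _ assms(4)]
  let ?U = "Upper (CTam n) {order_of_pattern n I, order_of_pattern n J}"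
  have "least (CTam n) (order_of_pattern n (I \<union> J)) ?U"
    unfolding least_def
  proof (intro conjI ballI)
    show "order_of_pattern n (I \<union> J) \<in> ?U" unfolding Upper_def using assms carr le by auto
    fix r assume r: "r \<in> ?U"
    then have "r \<in> carrier (CTam n)" unfolding Upper_def by blast
    then obtain K where K: "torsion_pattern n n K" "r = order_of_pattern n K"
      using CTam_cases assms(4) by blast
    then have "I \<subseteq> K" "J \<subseteq> K" using r assms carr le unfolding Upper_def by auto
    then show "order_of_pattern n (I \<union> J) \<sqsubseteq>\<^bsub>CTam n\<^esub> r" using K le[OF assms(3) K(1)] by simp
  qed auto
  then show ?thesis
    unfolding join_def sup_def using least_unique by (metis someI)
qed

lemma CTam_meet:
  assumes "torsion_pattern n n I" "torsion_pattern n n J" "n > 0"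
  shows "order_of_pattern n I \<sqinter>\<^bsub>CTam n\<^esub> order_of_pattern n J = order_of_pattern n (I \<inter> J)"
proof -
  interpret partial_order "CTam n" using partial_order_CTam[OF assms(3)] .
  note carr = order_of_pattern_in_CTam[OF _ assms(3)]
  note le = order_of_pattern_le_iff[OF _ _ assms(3)]
  have IJ: "torsion_pattern n n (I \<inter> J)"
  proof (rule torsion_patternI)
    show "(a + l * int n, b + l * int n) \<in> I \<inter> J" if "(a, b) \<in> I \<inter> J" for a b l
      using that torsion_pattern_translate[OF assms(1)] torsion_pattern_translate[OF assms(2)] by simp
  qed (use torsion_patternD[OF assms(1)] torsion_patternD[OF assms(2)] in blast)+
  let ?L = "Lower (CTam n) {order_of_pattern n I, order_of_pattern n J}"
  have "greatest (CTam n) (order_of_pattern n (I \<inter> J)) ?L"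
    unfolding greatest_def
  proof (intro conjI ballI)
    show "order_of_pattern n (I \<inter> J) \<in> ?L" unfolding Lower_def using assms IJ carr le by auto
    fix r assume r: "r \<in> ?L"
    then have "r \<in> carrier (CTam n)" unfolding Lower_def by blast
    then obtain K where K: "torsion_pattern n n K" "r = order_of_pattern n K"
      using CTam_cases assms(3) by blast
    then have "K \<subseteq> I" "K \<subseteq> J" using r assms carr le unfolding Lower_def by auto
    then show "r \<sqsubseteq>\<^bsub>CTam n\<^esub> order_of_pattern n (I \<inter> J)" using K le[OF K(1) IJ] by simp
  qed auto
  then show ?thesis
    unfolding meet_def inf_def using greatest_unique by (metis someI)
qed

lemma order_of_pattern_inject:
  assumes "torsion_pattern n n I" "torsion_pattern n n J" "n > 0"
  shows "order_of_pattern n I = order_of_pattern n J \<longleftrightarrow> I = J"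
  using short_inversions_order_of_pattern assms by metis

text \<open>Deleting from a pattern \<open>J\<close> all pairs that start at a translate of a fixed \<open>a\<close> leaves a pattern. Hence
  \<open>J\<close> is the join of this smaller pattern and of the row that was deleted, and if \<open>J\<close> is
  join-irreducible, it equals that row.\<close>

lemma CTam_join_irreducible_cases:
  assumes irr: "join_irreducible (CTam n) j" and "n > 0"
  obtains a b where "a < b" "b \<le> a + int n" "j = order_of_pattern n (row n a b)"
proof -
  have "j \<in> carrier (CTam n)" using irr unfolding join_irreducible_def by blast
  then obtain J where J: "torsion_pattern n n J" and j: "j = order_of_pattern n J"
    using CTam_cases assms(2) by blast
  note bnd = torsion_pattern_bounds[OF J] and shift = torsion_pattern_translate[OF J]
  note carr = order_of_pattern_in_CTam[OF _ assms(2)]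
  have "J \<noteq> {}"
  proof
    assume "J = {}"
    have "least (CTam n) j (carrier (CTam n))"
      unfolding least_def
    proof (intro conjI ballI)
      fix r assume "r \<in> carrier (CTam n)"
      then obtain K where "torsion_pattern n n K" "r = order_of_pattern n K"
        using CTam_cases assms(2) by blast
      then show "j \<sqsubseteq>\<^bsub>CTam n\<^esub> r"
        using order_of_pattern_le_iff[OF J _ assms(2)] j \<open>J = {}\<close> by simp
    qed (use j J carr in auto)
    then show False using irr unfolding join_irreducible_def by blast
  qed
  then obtain a b0 where ab0: "(a, b0) \<in> J" by fastforce
  define S where "S = {c. (a, c) \<in> J}"
  have S: "finite S" "S \<noteq> {}"
    using ab0 bnd finite_subset[of S "{a..a + int n}"] unfolding S_def by fastforce+
  define b where "b = Max S"
  have ab: "(a, b) \<in> J" using Max_in[OF S] unfolding b_def S_def by blast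
  have top: "c \<le> b" if "(a, c) \<in> J" for c
    using that Max_ge[OF S(1)] unfolding b_def S_def by blast
  have b: "a < b" "b \<le> a + int n" using bnd[OF ab] by auto
  have row: "torsion_pattern n n (row n a b)" using torsion_pattern_row b by simp
  have rowJ: "row n a b \<subseteq> J" using row_subset_iff[OF J b(1)] ab by simp
  define R where "R = {(x, y) \<in> J. \<not> (\<exists>l. x = a + l * int n)}"
  have R: "torsion_pattern n n R"
  proof (rule torsion_patternI)
    fix x y l assume xy: "(x, y) \<in> R"
    have "\<not> (\<exists>m. x + l * int n = a + m * int n)"
    proof
      assume "\<exists>m. x + l * int n = a + m * int n"
      then obtain m where "x = a + (m - l) * int n" by (auto simp: algebra_simps)
      then show False using xy unfolding R_def by blast
    qed
    then show "(x + l * int n, y + l * int n) \<in> R" using xy shift unfolding R_def by simp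
  next
    fix x y z assume "(x, y) \<in> R" "(y, z) \<in> R" "z \<le> x + int n"
    then show "(x, z) \<in> R" using torsion_pattern_trans[OF J, of x y z] unfolding R_def by simp
  next
    fix x y z assume "(x, z) \<in> R" "x < y" "y \<le> z"
    then show "(x, y) \<in> R" using torsion_pattern_prefix[OF J, of x z y] unfolding R_def by simp
  qed (use bnd in \<open>simp add: R_def\<close>)
  have "J \<subseteq> row n a b \<union> R"
  proof clarify
    fix x y assume xy: "(x, y) \<in> J" "(x, y) \<notin> R"
    then obtain l where l: "x = a + l * int n" unfolding R_def by blast
    have "(a, y - l * int n) \<in> J" using shift[of a l "y - l * int n"] xy l by simp
    then have "y \<le> b + l * int n" using top by fastforce
    then show "(x, y) \<in> row n a b" using l bnd[OF xy(1)] unfolding row_iff by blast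
  qed
  then have J_eq: "row n a b \<union> R = J" using rowJ unfolding R_def by blast
  then have "j = order_of_pattern n (row n a b) \<squnion>\<^bsub>CTam n\<^esub> order_of_pattern n R"
    using CTam_join[OF row R] J j assms(2) by simp
  then have "j = order_of_pattern n (row n a b) \<or> j = order_of_pattern n R"
    using irr carr[OF row] carr[OF R] unfolding join_irreducible_def by simp
  moreover have "(a, b) \<notin> R" unfolding R_def by (auto intro: exI[of _ 0])
  then have "j \<noteq> order_of_pattern n R"
    using order_of_pattern_inject[OF J R assms(2)] j ab by blast
  ultimately show thesis using that b by blast
qed

text \<open>Every proper subpattern of a row misses its longest pair, hence lies in the next shorter row.\<close>

lemma covers_CTam_row:
  assumes "a < b" "b \<le> a + int n" "torsion_pattern n n X" "n > 0"
  shows "covers (CTam n) (order_of_pattern n (row n a b)) (order_of_pattern n X)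
    \<longleftrightarrow> X = row n a (b - 1)"
proof -
  have row: "torsion_pattern n n (row n a b)" "torsion_pattern n n (row n a (b - 1))"
    using torsion_pattern_row assms(1,2) by simp_all
  have sub: "Y \<subseteq> row n a (b - 1)" if Y: "torsion_pattern n n Y" "Y \<subseteq> row n a b" "Y \<noteq> row n a b" for Y
  proof clarify
    fix x y assume xy: "(x, y) \<in> Y"
    then obtain l where l: "x = a + l * int n" "x < y" "y \<le> b + l * int n"
      using Y(2) unfolding row_def by blast
    have "y \<noteq> b + l * int n"
      using torsion_pattern_translate[OF Y(1), of a l b] l xy row_subset_iff[OF Y(1) assms(1)] Y by auto
    then show "(x, y) \<in> row n a (b - 1)" using l unfolding row_iff by auto
  qed
  have ab: "(a, b) \<in> row n a b" using row_subset_iff[OF row(1) assms(1)] by simp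
  have "row n a (b - 1) \<subseteq> row n a b" unfolding row_def by force
  moreover have "(a, b) \<notin> row n a (b - 1)" by (rule row_top_notin)
  ultimately have psub: "row n a (b - 1) \<subset> row n a b" using ab by blast
  have less: "order_of_pattern n I \<sqsubset>\<^bsub>CTam n\<^esub> order_of_pattern n J \<longleftrightarrow> I \<subset> J"
    if "torsion_pattern n n I" "torsion_pattern n n J" for I J
  proof -
    have "eq (CTam n) = (=)" unfolding CTam_def by simp
    then show ?thesis
      using order_of_pattern_le_iff[OF that assms(4)] order_of_pattern_inject[OF that assms(4)]
      unfolding lless_def by auto
  qed
  have "covers (CTam n) (order_of_pattern n (row n a b)) (order_of_pattern n X) \<longleftrightarrow>
      X \<subset> row n a b \<and> \<not> (\<exists>Y. torsion_pattern n n Y \<and> X \<subset> Y \<and> Y \<subset> row n a b)"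
    unfolding covers_def
    using CTam_cases[OF _ assms(4)] order_of_pattern_in_CTam[OF _ assms(4)] less row(1) assms(3)
    by metis
  also have "\<dots> \<longleftrightarrow> X = row n a (b - 1)"
  proof
    assume "X \<subset> row n a b \<and> \<not> (\<exists>Y. torsion_pattern n n Y \<and> X \<subset> Y \<and> Y \<subset> row n a b)"
    then show "X = row n a (b - 1)" using sub[OF assms(3)] psub row(2) by blast
  next
    assume "X = row n a (b - 1)"
    then show "X \<subset> row n a b \<and> \<not> (\<exists>Y. torsion_pattern n n Y \<and> X \<subset> Y \<and> Y \<subset> row n a b)"
      using psub sub by blast
  qed
  finally show ?thesis .
qed

lemma lower_star_row:
  assumes "a < b" "b \<le> a + int n" "n > 0"
  shows "lower_star (CTam n) (order_of_pattern n (row n a b)) = order_of_pattern n (row n a (b - 1))"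
  unfolding lower_star_def
proof (rule the_equality)
  have row: "torsion_pattern n n (row n a (b - 1))"
    using torsion_pattern_row assms(1,2) by simp
  then show "covers (CTam n) (order_of_pattern n (row n a b)) (order_of_pattern n (row n a (b - 1)))"
    using covers_CTam_row assms by blast
  fix x assume x: "covers (CTam n) (order_of_pattern n (row n a b)) x"
  then have "x \<in> carrier (CTam n)" unfolding covers_def by blast
  then show "x = order_of_pattern n (row n a (b - 1))"
    using CTam_cases x covers_CTam_row assms by metis
qed

lemma inter_row_eq_iff:
  assumes Z: "torsion_pattern n n Z" and cd: "c < d" "d \<le> c + int n"
  shows "Z \<inter> row n c d = row n c (d - 1) \<longleftrightarrow> row n c (d - 1) \<subseteq> Z \<and> (c, d) \<notin> Z"
proof -
  have row: "torsion_pattern n n (row n c d)" using torsion_pattern_row cd by simp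
  have 1: "(c, d) \<in> row n c d" "(c, d) \<notin> row n c (d - 1)" "row n c (d - 1) \<subseteq> row n c d"
    using row_subset_iff[OF row cd(1)] row_top_notin[of c d n] by (simp, simp, force simp: row_def)
  have "Z \<inter> row n c d \<subseteq> row n c (d - 1)" if "(c, d) \<notin> Z"
  proof clarify
    fix x y assume xy: "(x, y) \<in> Z" "(x, y) \<in> row n c d"
    then obtain l where l: "x = c + l * int n" "x < y" "y \<le> d + l * int n" unfolding row_iff by blast
    have "y \<noteq> d + l * int n" using torsion_pattern_translate[OF Z, of c l d] l xy that by auto
    then show "(x, y) \<in> row n c (d - 1)" using l unfolding row_iff by auto
  qed
  then show ?thesis using 1 by blast
qed

text \<open>A pattern \<open>Z\<close> meets the row of \<open>(c, d)\<close> in the shorter row iff it contains the shorter row but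
  not \<open>(c, d)\<close>. If \<open>Z\<close> had a pair \<open>(a, b)\<close> with \<open>c \<le> a < d \<le> b\<close>, then \<open>(a, d) \<in> Z\<close> as a prefix, and
  composing with \<open>(c, a) \<in> Z\<close> would give \<open>(c, d) \<in> Z\<close>; so all such \<open>Z\<close> lie in the barrier.\<close>

lemma kappa_row:
  assumes cd: "c < d" "d \<le> c + int n" and "n > 0"
  shows "kappa (CTam n) (order_of_pattern n (row n c d)) = order_of_pattern n (barrier n c d)"
proof -
  interpret partial_order "CTam n" using partial_order_CTam[OF assms(3)] .
  let ?j = "order_of_pattern n (row n c d)"
  let ?Z = "{z \<in> carrier (CTam n). z \<sqinter>\<^bsub>CTam n\<^esub> ?j = lower_star (CTam n) ?j}"
  have row: "torsion_pattern n n (row n c d)" "torsion_pattern n n (row n c (d - 1))"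
    using torsion_pattern_row cd by simp_all
  have inter: "torsion_pattern n n (Z \<inter> row n c d)" if "torsion_pattern n n Z" for Z
  proof -
    have "order_of_pattern n Z \<sqinter>\<^bsub>CTam n\<^esub> ?j = order_of_pattern n (Z \<inter> row n c d)"
      using CTam_meet that row assms(3) by blast
    show ?thesis
    proof (rule torsion_patternI)
      show "(a + l * int n, b + l * int n) \<in> Z \<inter> row n c d" if "(a, b) \<in> Z \<inter> row n c d" for a b l
        using that torsion_pattern_translate[OF \<open>torsion_pattern n n Z\<close>]
          torsion_pattern_translate[OF row(1)] by simp
    qed (use torsion_patternD[OF that] torsion_patternD[OF row(1)] in blast)+
  qed
  have mem: "order_of_pattern n Z \<in> ?Z \<longleftrightarrow> row n c (d - 1) \<subseteq> Z \<and> (c, d) \<notin> Z"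
    if "torsion_pattern n n Z" for Z
    using order_of_pattern_in_CTam[OF that assms(3)] CTam_meet[OF that row(1) assms(3)]
      lower_star_row[OF assms] order_of_pattern_inject[OF inter[OF that] row(2) assms(3)]
      inter_row_eq_iff[OF that cd] by simp
  have B: "torsion_pattern n n (barrier n c d)" by (rule torsion_pattern_barrier)
  have "(c, d) \<notin> barrier n c d" unfolding barrier_iff using cd by (auto intro: exI[of _ 0])
  moreover have "row n c (d - 1) \<subseteq> barrier n c d"
  proof (cases "c < d - 1")
    case True
    have "\<not> (\<exists>l. c + l * int n \<le> c \<and> c < d + l * int n \<and> d + l * int n \<le> d - 1)"
    proof clarify
      fix l assume *: "c < d + l * int n" "d + l * int n \<le> d - 1"
      have "l < 0"
      proof (rule ccontr)
        assume "\<not> l < 0"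
        then have "0 \<le> l * int n" by simp
        then show False using * by simp
      qed
      then show False using multiple_gap[of l 0 n] * cd by simp
    qed
    then have "(c, d - 1) \<in> barrier n c d" unfolding barrier_iff using True cd by auto
    then show ?thesis using row_subset_iff[OF B True] by simp
  next
    case False
    then show ?thesis unfolding row_def by auto
  qed
  ultimately have BZ: "order_of_pattern n (barrier n c d) \<in> ?Z" using mem[OF B] by blast
  have "greatest (CTam n) (order_of_pattern n (barrier n c d)) ?Z"
    unfolding greatest_def
  proof (intro conjI ballI)
    show "order_of_pattern n (barrier n c d) \<in> ?Z" by (rule BZ)
    fix z assume z: "z \<in> ?Z"
    then obtain Z where Z: "torsion_pattern n n Z" "z = order_of_pattern n Z"
      using CTam_cases assms(3) by (metis (no_types, lifting) mem_Collect_eq)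
    then have Z2: "row n c (d - 1) \<subseteq> Z" "(c, d) \<notin> Z" using mem z by blast+
    have "Z \<subseteq> barrier n c d"
    proof clarify
      fix a b assume ab: "(a, b) \<in> Z"
      show "(a, b) \<in> barrier n c d"
        unfolding barrier_iff
      proof (intro conjI notI)
        assume "\<exists>l. c + l * int n \<le> a \<and> a < d + l * int n \<and> d + l * int n \<le> b"
        then obtain l where l: "c + l * int n \<le> a" "a < d + l * int n" "d + l * int n \<le> b" by blast
        have 1: "(a, d + l * int n) \<in> Z" using torsion_pattern_prefix[OF Z(1) ab l(2,3)] .
        have "(c + l * int n, d + l * int n) \<in> Z"
        proof (cases "c + l * int n = a")
          case False
          then have "(c + l * int n, a) \<in> row n c (d - 1)" using l unfolding row_iff by auto
          then have "(c + l * int n, a) \<in> Z" using Z2 by blast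
          then show ?thesis using torsion_pattern_trans[OF Z(1) _ 1] cd by simp
        qed (use 1 in simp)
        then show False using torsion_pattern_translate[OF Z(1)] Z2 by simp
      qed (use torsion_pattern_bounds[OF Z(1) ab] in auto)
    qed
    then show "z \<sqsubseteq>\<^bsub>CTam n\<^esub> order_of_pattern n (barrier n c d)"
      using order_of_pattern_le_iff[OF Z(1) B assms(3)] Z(2) by simp
  qed blast
  then show ?thesis unfolding kappa_def using greatest_unique by (metis (no_types, lifting) the_equality)
qed

text \<open>Testing the inclusion on \<open>(b1 - 1, b1)\<close> forces \<open>b1\<close> to be a translate of \<open>b2\<close>, and testing it on
  \<open>(a1, b1)\<close> forces the left end points into the right order for the same translate.\<close>

lemma barrier_subset_iff:
  assumes ab: "a1 < b1" "b1 \<le> a1 + int n" and cd: "a2 < b2" "b2 \<le> a2 + int n" 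
  shows "barrier n a2 b2 \<subseteq> barrier n a1 b1 \<longleftrightarrow> (\<exists>l. a2 + l * int n \<le> a1 \<and> b1 = b2 + l * int n)"
proof
  assume sub: "barrier n a2 b2 \<subseteq> barrier n a1 b1"
  have hit: "\<exists>l. a2 + l * int n \<le> e \<and> e < b2 + l * int n \<and> b2 + l * int n \<le> b1"
    if "a1 \<le> e" "e < b1" for e
  proof -
    have "(e, b1) \<notin> barrier n a1 b1"
      unfolding barrier_iff using that by (auto intro: exI[of _ 0])
    then have "(e, b1) \<notin> barrier n a2 b2" using sub by blast
    then show ?thesis unfolding barrier_iff using that ab by auto
  qed
  obtain l where l: "a2 + l * int n \<le> b1 - 1" "b1 - 1 < b2 + l * int n" "b2 + l * int n \<le> b1"
    using hit[of "b1 - 1"] ab by auto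
  then have b1: "b1 = b2 + l * int n" by simp
  obtain m where m: "a2 + m * int n \<le> a1" "a1 < b2 + m * int n" "b2 + m * int n \<le> b1"
    using hit[of a1] ab by auto
  have "m = l"
  proof (rule ccontr)
    assume "m \<noteq> l"
    then consider "m < l" | "l < m" by linarith
    then show False
      using multiple_gap[of m l n] multiple_gap[of l m n] m b1 ab by cases linarith+
  qed
  then show "\<exists>l. a2 + l * int n \<le> a1 \<and> b1 = b2 + l * int n" using m b1 by blast
next
  assume "\<exists>l. a2 + l * int n \<le> a1 \<and> b1 = b2 + l * int n"
  then obtain l where l: "a2 + l * int n \<le> a1" "b1 = b2 + l * int n" by blast
  show "barrier n a2 b2 \<subseteq> barrier n a1 b1"
  proof clarify
    fix x y assume xy: "(x, y) \<in> barrier n a2 b2"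
    show "(x, y) \<in> barrier n a1 b1"
      unfolding barrier_iff
    proof (intro conjI notI)
      assume "\<exists>m. a1 + m * int n \<le> x \<and> x < b1 + m * int n \<and> b1 + m * int n \<le> y"
      then obtain m where m: "a1 + m * int n \<le> x" "x < b1 + m * int n" "b1 + m * int n \<le> y" by blast
      then have "a2 + (l + m) * int n \<le> x" "x < b2 + (l + m) * int n" "b2 + (l + m) * int n \<le> y"
        using l by (simp_all add: algebra_simps)
      then show False using xy unfolding barrier_iff by blast
    qed (use xy in \<open>auto simp: barrier_iff\<close>)
  qed
qed

lemma
  assumes ab: "a1 < b1" "b1 \<le> a1 + int n" and cd: "a2 < b2" "b2 \<le> a2 + int n" and "n > 0"
    and j1: "j1 = order_of_pattern n (row n a1 b1)" and j2: "j2 = order_of_pattern n (row n a2 b2)"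
  shows ji_onto_iff: "ji_onto (CTam n) j2 j1 \<longleftrightarrow> (\<exists>l. a1 = a2 + l * int n \<and> b1 \<le> b2 + l * int n)"
    and ji_into_iff: "ji_into (CTam n) j1 j2 \<longleftrightarrow> (\<exists>l. a2 + l * int n \<le> a1 \<and> b1 = b2 + l * int n)"
    and ji_arrow_iff: "ji_arrow (CTam n) j1 j2 \<longleftrightarrow>
      (\<exists>l. a2 + l * int n \<le> a1 \<and> a1 < b2 + l * int n \<and> b2 + l * int n \<le> b1)"
proof -
  have row: "torsion_pattern n n (row n a1 b1)" "torsion_pattern n n (row n a2 b2)"
    using torsion_pattern_row ab cd by simp_all
  note le = order_of_pattern_le_iff[OF _ _ assms(5)]
  show "ji_onto (CTam n) j2 j1 \<longleftrightarrow> (\<exists>l. a1 = a2 + l * int n \<and> b1 \<le> b2 + l * int n)"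
    unfolding ji_onto_def j1 j2 le[OF row] row_subset_iff[OF row(2) ab(1)] row_iff using ab by auto
  show "ji_into (CTam n) j1 j2 \<longleftrightarrow> (\<exists>l. a2 + l * int n \<le> a1 \<and> b1 = b2 + l * int n)"
    unfolding ji_into_def j1 j2 kappa_row[OF ab assms(5)] kappa_row[OF cd assms(5)]
      le[OF torsion_pattern_barrier torsion_pattern_barrier]
    by (rule barrier_subset_iff[OF ab cd])
  show "ji_arrow (CTam n) j1 j2 \<longleftrightarrow>
      (\<exists>l. a2 + l * int n \<le> a1 \<and> a1 < b2 + l * int n \<and> b2 + l * int n \<le> b1)"
    unfolding ji_arrow_def j1 j2 kappa_row[OF cd assms(5)] le[OF row(1) torsion_pattern_barrier]
      row_subset_iff[OF torsion_pattern_barrier ab(1)] barrier_iff using ab by auto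
qed

text \<open>Total relations are maximal among antisymmetric ones, so for windows only one inclusion
  has to be checked.\<close>

lemma total_order_eqI:
  assumes "R \<subseteq> S" "\<And>x y. (x, y) \<in> R \<or> (y, x) \<in> R" "\<And>x y. (x, y) \<in> S \<Longrightarrow> (y, x) \<in> S \<Longrightarrow> x = y"
  shows "R = S"
  using assms by fast

lemma order_of_row_iff:
  assumes "a < b" "b \<le> a + int n"
  shows "(x, y) \<in> order_of_pattern n (row n a b) \<longleftrightarrow>
    x = y \<or> x < y \<and> (x, min y (x + int n)) \<notin> row n a b \<or>
    y < x \<and> (y, min x (y + int n)) \<in> row n a b"
  unfolding order_of_pattern_def inverted_def by auto

lemma multiple_trichotomy:
  "l = 0 \<or> int n \<le> l * int n \<or> l * int n \<le> - int n"
  using multiple_gap[of l 0 n] multiple_gap[of 0 l n] by (cases l "0 :: int" rule: linorder_cases) auto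

lemma representative_in_window:
  fixes a x :: int
  assumes "n > 0"
  obtains e l where "a \<le> e" "e < a + int n" "x = e + l * int n"
proof
  show "a \<le> a + (x - a) mod int n" "a + (x - a) mod int n < a + int n"
    "x = (a + (x - a) mod int n) + (x - a) div int n * int n"
    using assms by simp_all
qed

text \<open>In the window of \<open>j\<^sub>a\<^sub>b\<close> with \<open>b < a + n\<close> the integers increase except that \<open>a\<close> has moved behind
  \<open>a + 1, \<dots>, b\<close>. For \<open>b = a + n\<close> the class of \<open>a\<close> has moved behind everything and is reversed.\<close>

lemma jirr_eq_order_of_row:
  assumes ab: "a < b" "b \<le> a + int n" and "n > 0"
  shows "jirr n a b = order_of_pattern n (row n a b)"
proof (cases "b < a + int n")
  case True
  define xs where "xs = removeAll a [b + 1 - int n..b]"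
  define ys where "ys = xs @ [a]"
  have set_xs: "set xs = {b + 1 - int n..b} - {a}" unfolding xs_def by simp
  have "a \<in> {b + 1 - int n..b}" using ab True by simp
  then have set_ys: "set ys = {b + 1 - int n..b}" unfolding ys_def set_append set_xs by auto
  have sorted: "sorted xs" unfolding xs_def removeAll_filter_not_eq
    by (intro sorted_wrt_filter) simp
  have len: "length ys = Suc (length xs)" unfolding ys_def by simp
  have row_start: "x = a \<and> y \<le> b" if "(x, y) \<in> row n a b" "b + 1 - int n \<le> x" "x \<le> b" for x y
  proof -
    obtain l where l: "x = a + l * int n" "y \<le> b + l * int n" using \<open>(x, y) \<in> row n a b\<close>
      unfolding row_iff by blast
    have "l = 0" using multiple_trichotomy[of l n] l that True ab(1) by linarith
    then show ?thesis using l by simp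
  qed
  have tito: "TITO n (order_of_pattern n (row n a b))"
    using TITO_order_of_pattern torsion_pattern_row[of a b n] ab assms(3) by simp
  have shift: "(x + l * int n, y + l * int n) \<in> row n a b \<longleftrightarrow> (x, y) \<in> row n a b" for x y l
    using torsion_pattern_translate torsion_pattern_row[of a b n] ab by simp
  have "waxing_window n ys = order_of_pattern n (row n a b)"
  proof (rule total_order_eqI)
    show "waxing_window n ys \<subseteq> order_of_pattern n (row n a b)"
    proof clarify
      fix x y assume "(x, y) \<in> waxing_window n ys"
      then obtain i j k l where xy: "x = ys ! i + k * int n" "y = ys ! j + l * int n"
        and ij: "i < length ys" "j < length ys" and kl: "k < l \<or> k = l \<and> i \<le> j"
        unfolding waxing_window_def by blast
      define u v where "u = ys ! i" and "v = ys ! j"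
      have "u \<in> set ys" "v \<in> set ys" using nth_mem ij unfolding u_def v_def by blast+
      then have uv: "b + 1 - int n \<le> u" "u \<le> b" "b + 1 - int n \<le> v" "v \<le> b"
        unfolding set_ys by auto
      show "(x, y) \<in> order_of_pattern n (row n a b)"
      proof (cases "k < l")
        case kl: True
        have gap: "k * int n + int n \<le> l * int n" by (rule multiple_gap[OF kl])
        have "x < y" using gap uv unfolding xy u_def[symmetric] v_def[symmetric] by linarith
        moreover have "(x, min y (x + int n)) \<notin> row n a b"
        proof
          assume r: "(x, min y (x + int n)) \<in> row n a b"
          have "(u, min y (x + int n) - k * int n) \<in> row n a b"
            using r shift[of u k "min y (x + int n) - k * int n"] xy unfolding u_def by simp
          then have "u = a" "min y (x + int n) - k * int n \<le> b" using row_start uv by blast+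
          then show False using gap uv True unfolding xy u_def[symmetric] v_def[symmetric]
            by (simp add: min_def split: if_splits)
        qed
        ultimately show ?thesis unfolding order_of_row_iff[OF ab] by blast
      next
        case False
        then have kl: "k = l" "i \<le> j" using kl by auto
        have near: "min v (u + int n) = v" "min u (v + int n) = u" using uv by auto
        have "(u, v) \<in> order_of_pattern n (row n a b)"
        proof (cases "u = v")
          case False
          then have "i < j" using kl unfolding u_def v_def by (cases "i = j") auto
          then have i: "i < length xs" "u = xs ! i" using ij len unfolding u_def ys_def
            by (simp_all add: nth_append)
          then have "u \<noteq> a" using nth_mem set_xs by fastforce
          then have ua: "(u, z) \<notin> row n a b" for z using row_start[of u z] uv by blast
          show ?thesis
          proof (cases "j = length xs")
            case True
            then have "v = a" unfolding v_def ys_def by simp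
            then have "v < u \<Longrightarrow> (v, u) \<in> row n a b"
              unfolding row_iff using uv by (intro exI[of _ 0]) simp
            then show ?thesis unfolding order_of_row_iff[OF ab] near using ua False by fastforce
          next
            case f: False
            then have "v = xs ! j" "j < length xs"
              using ij len unfolding v_def ys_def by (simp_all add: nth_append)
            then have "u \<le> v" using sorted_nth_mono[OF sorted] i kl by simp
            then show ?thesis unfolding order_of_row_iff[OF ab] near using ua False by simp
          qed
        qed (simp add: TITO_refl[OF tito])
        then show ?thesis
          using TITO_translate[OF tito] kl unfolding xy u_def[symmetric] v_def[symmetric] by simp
      qed
    qed
    have rep: "\<exists>i k. i < length ys \<and> x = ys ! i + k * int n" for x
    proof -
      obtain e l where "b + 1 - int n \<le> e" "e < b + 1 - int n + int n" "x = e + l * int n"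
        using representative_in_window[OF assms(3)] by blast
      moreover from this have "e \<in> set ys" unfolding set_ys by simp
      ultimately show ?thesis by (metis in_set_conv_nth)
    qed
    fix x y
    obtain i k j l where "i < length ys" "x = ys ! i + k * int n" "j < length ys" "y = ys ! j + l * int n"
      using rep by metis
    moreover have "(k < l \<or> k = l \<and> i \<le> j) \<or> (l < k \<or> l = k \<and> j \<le> i)" by linarith
    ultimately show "(x, y) \<in> waxing_window n ys \<or> (y, x) \<in> waxing_window n ys"
      unfolding waxing_window_def by blast
  qed (use TITO_antisym[OF tito] in blast)
  then show ?thesis unfolding jirr_def using True xs_def ys_def by simp
next
  case False
  then have b: "b = a + int n" using ab by simp
  define xs where "xs = [a - int n + 1..a - 1]"
  let ?r = "waxing_window n xs" and ?s = "waning_window n [a]"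
  have set_xs: "set xs = {a - int n + 1..a - 1}" unfolding xs_def by simp
  have sorted: "sorted xs" unfolding xs_def by simp
  have tito: "TITO n (order_of_pattern n (row n a b))"
    using TITO_order_of_pattern torsion_pattern_row[of a b n] ab assms(3) by simp
  \<comment> \<open>The integers of the waning block.\<close>
  define cls where "cls x \<longleftrightarrow> (\<exists>l. x = a + l * int n)" for x
  have row: "(x, min y (x + int n)) \<in> row n a b \<longleftrightarrow> x < y \<and> cls x" for x y
    unfolding row_iff cls_def b using assms(3) by auto
  have mem: "(x, y) \<in> order_of_pattern n (row n a b) \<longleftrightarrow>
      x = y \<or> x < y \<and> \<not> cls x \<or> y < x \<and> cls y" for x y
    unfolding order_of_row_iff[OF ab] row by blast
  have not_cls: "\<not> cls (e + k * int n)" if "e \<in> set xs" for e k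
  proof
    assume "cls (e + k * int n)"
    then obtain l where "e + k * int n = a + l * int n" unfolding cls_def by blast
    then have "e = a + (l - k) * int n" by (simp add: algebra_simps)
    moreover have "a - int n < e" "e < a" using that unfolding set_xs by auto
    ultimately show False using multiple_trichotomy[of "l - k" n] by (elim disjE) simp_all
  qed
  have s: "(x, y) \<in> ?s \<longleftrightarrow> cls x \<and> cls y \<and> y \<le> x" for x y
    unfolding waning_window_def cls_def using assms(3) by (auto simp: mult_le_cancel_right)
  have r: "\<not> cls x \<and> \<not> cls y \<and> x \<le> y" if xy: "(x, y) \<in> ?r" for x y
  proof -
    obtain i j k l where xy: "x = xs ! i + k * int n" "y = xs ! j + l * int n"
      and ij: "i < length xs" "j < length xs" and kl: "k < l \<or> k = l \<and> i \<le> j"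
      using xy unfolding waxing_window_def by blast
    have uv: "xs ! i \<in> set xs" "xs ! j \<in> set xs" using nth_mem ij by blast+
    have "x \<le> y"
    proof (cases "k < l")
      case True
      then show ?thesis using multiple_gap[OF True, of n] uv unfolding xy set_xs by simp
    next
      case False
      then show ?thesis using kl sorted_nth_mono[OF sorted, of i j] ij unfolding xy by simp
    qed
    then show ?thesis using not_cls uv xy by simp
  qed
  have rep: "\<exists>i k. i < length xs \<and> x = xs ! i + k * int n" if "\<not> cls x" for x
  proof -
    obtain e l where e: "a - int n \<le> e" "e < a - int n + int n" "x = e + l * int n"
      using representative_in_window[OF assms(3)] by blast
    have "e \<noteq> a - int n"
    proof
      assume "e = a - int n"
      then have "x = a + (l - 1) * int n" using e by (simp add: algebra_simps)
      then show False using that unfolding cls_def by blast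
    qed
    then have "e \<in> set xs" using e unfolding set_xs by simp
    then show ?thesis using e by (metis in_set_conv_nth)
  qed
  have r_total: "(x, y) \<in> ?r \<or> (y, x) \<in> ?r" if "\<not> cls x" "\<not> cls y" for x y
  proof -
    obtain i k where "i < length xs" "x = xs ! i + k * int n" using rep \<open>\<not> cls x\<close> by blast
    moreover obtain j l where "j < length xs" "y = xs ! j + l * int n" using rep \<open>\<not> cls y\<close> by blast
    moreover have "(k < l \<or> k = l \<and> i \<le> j) \<or> (l < k \<or> l = k \<and> j \<le> i)" by linarith
    ultimately show ?thesis unfolding waxing_window_def by blast
  qed
  have Field_r: "Field ?r = {x. \<not> cls x}"
    unfolding Field_def using r r_total by blast
  have Field_s: "Field ?s = {x. cls x}"
    unfolding Field_def using s by blast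
  have "window_concat ?r ?s = order_of_pattern n (row n a b)"
  proof (rule total_order_eqI)
    show "window_concat ?r ?s \<subseteq> order_of_pattern n (row n a b)"
    proof clarify
      fix x y assume "(x, y) \<in> window_concat ?r ?s"
      then consider "(x, y) \<in> ?r" | "(x, y) \<in> ?s" | "\<not> cls x" "cls y"
        unfolding window_concat_def Field_r Field_s by blast
      then show "(x, y) \<in> order_of_pattern n (row n a b)"
      proof cases
        case 1
        then show ?thesis using r[OF 1] unfolding mem order_le_less by blast
      next
        case 2
        then show ?thesis using s[of x y] unfolding mem order_le_less by blast
      next
        case 3
        then show ?thesis unfolding mem using linorder_less_linear[of x y] by blast
      qed
    qed
    show "(x, y) \<in> window_concat ?r ?s \<or> (y, x) \<in> window_concat ?r ?s" for x y
      unfolding window_concat_def Field_r Field_s using r_total[of x y] s[of x y] s[of y x]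
      by (cases "cls x"; cases "cls y") auto
  qed (use TITO_antisym[OF tito] in blast)
  then show ?thesis unfolding jirr_def xs_def using False by simp
qed

section \<open>Representations\<close>

lemma vertices_mod: "n > 0 \<Longrightarrow> m mod int n \<in> vertices n"
  unfolding vertices_def by simp

lemma vertices_mod_eq: "i \<in> vertices n \<Longrightarrow> i mod int n = i"
  unfolding vertices_def by simp

lemma next_vertex_mod: "next_vertex n (m mod int n) = (m + 1) mod int n"
  unfolding next_vertex_def by (simp add: mod_add_left_eq)

lemma next_vertex_in: "n > 0 \<Longrightarrow> next_vertex n i \<in> vertices n"
  unfolding next_vertex_def by (rule vertices_mod)

lemma path_map_add:
  "path_map n M (t + u) (m mod int n) x =
    path_map n M u ((m + int t) mod int n) (path_map n M t (m mod int n) x)"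
  by (induction t arbitrary: m x) (simp_all add: next_vertex_mod algebra_simps)

lemma path_map_Suc_end:
  "path_map n M (Suc t) (m mod int n) x =
    arrow M ((m + int t) mod int n) (path_map n M t (m mod int n) x)"
  using path_map_add[of n M t 1 m x] by simp

lemma rep_hom_path_map:
  assumes "rep_hom s t n M N f" "is_rep s n M" "n > 0" "x \<in> vspace M (m mod int n)"
  shows "path_map n M k (m mod int n) x \<in> vspace M ((m + int k) mod int n)"
    and "f ((m + int k) mod int n) (path_map n M k (m mod int n) x) =
      path_map n N k (m mod int n) (f (m mod int n) x)"
proof -
  have "path_map n M k (m mod int n) x \<in> vspace M ((m + int k) mod int n) \<and>
    f ((m + int k) mod int n) (path_map n M k (m mod int n) x) =
      path_map n N k (m mod int n) (f (m mod int n) x)"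
  proof (induction k)
    case (Suc k)
    have v: "(m + int k) mod int n \<in> vertices n" by (rule vertices_mod[OF assms(3)])
    have "next_vertex n ((m + int k) mod int n) = (m + int (Suc k)) mod int n"
      unfolding next_vertex_mod by (simp add: algebra_simps)
    then show ?case
      using Suc assms(1,2) v unfolding path_map_Suc_end rep_hom_def is_rep_def linear_between_def
      by (metis)
  qed (use assms(4) in simp)
  then show "path_map n M k (m mod int n) x \<in> vspace M ((m + int k) mod int n)"
    "f ((m + int k) mod int n) (path_map n M k (m mod int n) x) =
      path_map n N k (m mod int n) (f (m mod int n) x)" by blast+
qed

definition supported :: "nat \<Rightarrow> int \<Rightarrow> int \<Rightarrow> int \<Rightarrow> bool" where
  "supported n a b i \<longleftrightarrow> (\<exists>m. a \<le> m \<and> m < b \<and> m mod int n = i)"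

lemma supportedI: "a \<le> m \<Longrightarrow> m < b \<Longrightarrow> supported n a b (m mod int n)"
  unfolding supported_def by blast

text \<open>Both the modules \<open>M\<^sub>a\<^sub>b\<close> over the complex numbers (\<open>V = UNIV\<close>) and their copies in an ambient space
  (\<open>V\<close> a line) are of this form.\<close>

definition string_rep :: "'v set \<Rightarrow> nat \<Rightarrow> int \<Rightarrow> int \<Rightarrow> ('v::ab_group_add) rep" where
  "string_rep V n a b =
     \<lparr>vspace = (\<lambda>i. if supported n a b i then V else {0}),
      arrow = (\<lambda>i. if supported n a (b - 1) i then (\<lambda>x. x) else (\<lambda>x. 0))\<rparr>"

lemma Mrep_eq_string_rep: "Mrep n a b = string_rep UNIV n a b"
proof -
  have "m \<le> b - 1 \<longleftrightarrow> m < b" "m \<le> b - 2 \<longleftrightarrow> m < b - 1" for m by auto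
  then show ?thesis unfolding Mrep_def string_rep_def supported_def by simp
qed

lemma mod_eq_imp_shift:
  fixes m m' :: int
  assumes "m mod int n = m' mod int n"
  obtains l where "m = m' + l * int n"
proof -
  have "int n dvd m - m'" using assms by (simp add: mod_eq_dvd_iff)
  then obtain l where "m - m' = int n * l" ..
  then have "m = m' + l * int n" by (simp add: algebra_simps)
  then show thesis by (rule that)
qed

lemma mod_eq_imp_eq:
  assumes "m mod int n = m' mod int n" "m < m' + int n" "m' < m + int n"
  shows "m = m'"
proof -
  obtain l where "m = m' + l * int n" using mod_eq_imp_shift[OF assms(1)] .
  then show ?thesis using assms(2,3) multiple_trichotomy[of l n] by (elim disjE) simp_all
qed

lemma supported_mod_iff:
  assumes "a \<le> m" "m < a + int n" "b \<le> a + int n"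
  shows "supported n a b (m mod int n) \<longleftrightarrow> m < b"
proof
  assume "supported n a b (m mod int n)"
  then obtain m' where "a \<le> m'" "m' < b" "m' mod int n = m mod int n"
    unfolding supported_def by blast
  then have "m' = m" using assms by (intro mod_eq_imp_eq[of m' n m]) simp_all
  then show "m < b" using \<open>m' < b\<close> by simp
qed (use assms in \<open>auto simp: supported_def\<close>)

lemma supported_translate:
  "supported n (a + l * int n) (b + l * int n) i \<longleftrightarrow> supported n a b i"
proof -
  have "supported n (c + k * int n) (d + k * int n) i" if cd: "supported n c d i" for c d k
  proof -
    obtain m where "c \<le> m" "m < d" "m mod int n = i" using cd unfolding supported_def by blast
    then show ?thesis unfolding supported_def by (intro exI[of _ "m + k * int n"]) simp
  qed
  from this[of a b l] this[of "a + l * int n" "b + l * int n" "- l"] show ?thesis by auto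
qed

lemma string_rep_translate: "string_rep V n (a + l * int n) (b + l * int n) = string_rep V n a b"
proof -
  have "b + l * int n - 1 = b - 1 + l * int n" by simp
  then show ?thesis unfolding string_rep_def by (simp only: supported_translate)
qed

lemma path_map_string_rep:
  assumes "a \<le> m" "m < b" "b \<le> a + int n"
  shows "path_map n (string_rep V n a b) t (m mod int n) x = (if m + int t < b then x else 0)"
proof (induction t)
  case (Suc t)
  show ?case
  proof (cases "m + int t < b")
    case True
    have "supported n a (b - 1) ((m + int t) mod int n) \<longleftrightarrow> m + int t < b - 1"
      by (rule supported_mod_iff) (use assms True in auto)
    then show ?thesis using Suc unfolding path_map_Suc_end string_rep_def by auto
  next
    case False
    then show ?thesis using Suc unfolding path_map_Suc_end string_rep_def by simp
  qed
qed (use assms in simp)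

lemma path_map_zero:
  "path_map n (string_rep V n a b) t i 0 = 0"
  by (induction t arbitrary: i) (simp_all add: string_rep_def)

text \<open>A homomorphism commutes with paths. If \<open>c > a\<close>, the space at \<open>m\<close> is reached in the source from the
  vertex \<open>c - 1\<close>, whereas in the target every path from \<open>c - 1\<close> to \<open>m\<close> vanishes. If \<open>d > b\<close>, the
  path from \<open>m\<close> to \<open>b\<close> vanishes in the source but not in the target. In either case the map
  vanishes at \<open>m\<close>.\<close>

lemma string_rep_hom_bounds:
  assumes f: "rep_hom s t n (string_rep V n a b) (string_rep W n c d) f"
    and rep: "is_rep s n (string_rep V n a b)" and "n > 0"
    and ab: "a \<le> m" "m < b" "b \<le> a + int n" and cd: "c \<le> m" "m < d" "d \<le> c + int n"
    and x: "x \<in> V" "f (m mod int n) x \<noteq> 0" and V: "0 \<in> V"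
  shows "c \<le> a" "d \<le> b"
proof -
  let ?M = "string_rep V n a b" and ?N = "string_rep W n c d"
  have vs: "vspace ?M (k mod int n) = V" if "a \<le> k" "k < b" for k
    using that ab supported_mod_iff[of a k n b] unfolding string_rep_def by simp
  have lin: "linear_between s t (vspace ?M (k mod int n)) (vspace ?N (k mod int n)) (f (k mod int n))" for k
    using f vertices_mod[OF assms(3)] unfolding rep_hom_def by blast
  show "c \<le> a"
  proof (rule ccontr)
    assume "\<not> c \<le> a"
    then have c: "a \<le> c - 1" by simp
    define y where "y = f ((c - 1) mod int n) x"
    have "x \<in> vspace ?M ((c - 1) mod int n)" using vs[of "c - 1"] c cd ab x by simp
    note p = rep_hom_path_map(2)[OF f rep assms(3) this, of "nat (m - c + 1)", folded y_def]
    have *: "c - 1 < b" "b \<le> a + int n" using cd ab by simp_all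
    have e: "c - 1 + int (nat (m - c + 1)) = m" using cd by simp
    have "path_map n ?M (nat (m - c + 1)) ((c - 1) mod int n) x = x"
      unfolding path_map_string_rep[OF c *] e using ab by simp
    then have fm: "f (m mod int n) x = path_map n ?N (nat (m - c + 1)) ((c - 1) mod int n) y"
      using p unfolding e by simp
    have "path_map n ?N (nat (m - c + 1)) ((c - 1) mod int n) y = 0"
    proof -
      have "nat (m - c + 1) = Suc (nat (m - c))" using cd by simp
      moreover have "\<not> supported n c (d - 1) ((c - 1) mod int n)"
      proof
        assume "supported n c (d - 1) ((c - 1) mod int n)"
        then obtain k where k: "c \<le> k" "k < d - 1" "k mod int n = (c - 1) mod int n"
          unfolding supported_def by blast
        then have "k = c - 1" using cd by (intro mod_eq_imp_eq[of k n "c - 1"]) simp_all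
        then show False using k by simp
      qed
      ultimately show ?thesis using path_map_zero by (simp add: string_rep_def)
    qed
    then show False using fm x by simp
  qed
  show "d \<le> b"
  proof (rule ccontr)
    assume "\<not> d \<le> b"
    then have b: "b < d" by simp
    have "x \<in> vspace ?M (m mod int n)" using vs ab x by simp
    note p = rep_hom_path_map(2)[OF f rep assms(3) this, of "nat (b - m)"]
    have e: "m + int (nat (b - m)) = b" using ab by simp
    have 1: "path_map n ?M (nat (b - m)) (m mod int n) x = 0"
      unfolding path_map_string_rep[OF ab] e by simp
    have 2: "path_map n ?N (nat (b - m)) (m mod int n) (f (m mod int n) x) = f (m mod int n) x"
      unfolding path_map_string_rep[OF cd] e using b by simp
    have "0 \<in> vspace ?M (b mod int n)" unfolding string_rep_def using V by simp
    then have "f (b mod int n) (0 + 0) = f (b mod int n) 0 + f (b mod int n) 0"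
      using lin[of b] unfolding linear_between_def by blast
    then have "f (b mod int n) 0 = 0" by simp
    then show False using p x unfolding e 1 2 by simp
  qed
qed

lemma string_rep_is_rep:
  assumes V: "fd_subspace s V" "0 \<in> V" and "vector_space s" and ab: "b \<le> a + int n" and "n > 0"
  shows "is_rep s n (string_rep V n a b)"
  unfolding is_rep_def
proof (intro ballI conjI)
  interpret vector_space s by (rule assms(3))
  fix i assume "i \<in> vertices n"
  have "fd_subspace s {0}" unfolding fd_subspace_def by (rule exI[of _ "{}"]) simp
  then show "fd_subspace s (vspace (string_rep V n a b) i)"
    using V unfolding string_rep_def by simp
  have "\<And>x c. x \<in> V \<Longrightarrow> s c x \<in> V"
    using V(1) span_scale unfolding fd_subspace_def by metis
  have *: "supported n a b i \<and> supported n a b (next_vertex n i)" if sup: "supported n a (b - 1) i"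
  proof -
    obtain m where m: "a \<le> m" "m < b - 1" "m mod int n = i" using sup unfolding supported_def by blast
    then have "(m + 1) mod int n = next_vertex n i" using next_vertex_mod[of n m] by simp
    moreover have "a \<le> m + 1" "m + 1 < b" "m < b" using m by simp_all
    ultimately show ?thesis using m unfolding supported_def by blast
  qed
  show "linear_between s s (vspace (string_rep V n a b) i)
      (vspace (string_rep V n a b) (next_vertex n i)) (arrow (string_rep V n a b) i)"
    unfolding linear_between_def string_rep_def using * V by auto
qed

text \<open>The composite of the projection from the string of \<open>(a, b)\<close> onto that of \<open>(a, d)\<close> and the inclusion
  of the latter into the string of \<open>(c, d)\<close>; it depends on \<open>a\<close> and \<open>d\<close> only.\<close>

definition string_hom :: "nat \<Rightarrow> int \<Rightarrow> int \<Rightarrow> int \<Rightarrow> 'v \<Rightarrow> 'v::ab_group_add" where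
  "string_hom n a d i = (if supported n a d i then (\<lambda>x. x) else (\<lambda>x. 0))"

lemma string_hom_rep_hom:
  assumes V: "0 \<in> V" and "vector_space s" "n > 0"
    and ac: "c \<le> a" "a < d" "d \<le> b" "b \<le> a + int n" "d \<le> c + int n"
  shows "rep_hom s s n (string_rep V n a b) (string_rep V n c d) (string_hom n a d)"
  unfolding rep_hom_def
proof (intro ballI conjI)
  interpret vector_space s by (rule assms(2))
  fix i assume i: "i \<in> vertices n"
  obtain m l where m: "a \<le> m" "m < a + int n" "i = m mod int n"
  proof
    show "a \<le> a + (i - a) mod int n" "a + (i - a) mod int n < a + int n"
      "i = (a + (i - a) mod int n) mod int n"
      using assms(3) vertices_mod_eq[OF i] by (simp_all add: mod_add_right_eq)
  qed
  have sup: "supported n a b i \<longleftrightarrow> m < b" "supported n a (b - 1) i \<longleftrightarrow> m < b - 1"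
    "supported n a d i \<longleftrightarrow> m < d"
    using supported_mod_iff[OF m(1,2)] ac unfolding m(3) by simp_all
  have sup_cd: "supported n c d i" "supported n c (d - 1) i \<longleftrightarrow> m < d - 1" if "m < d"
    using supported_mod_iff[of c m n d] supported_mod_iff[of c m n "d - 1"] that ac m(1) unfolding m(3)
    by simp_all
  show "linear_between s s (vspace (string_rep V n a b) i) (vspace (string_rep V n c d) i)
      (string_hom n a d i)"
    unfolding linear_between_def string_rep_def string_hom_def using V sup sup_cd ac by auto
  fix x assume x: "x \<in> vspace (string_rep V n a b) i"
  show "string_hom n a d (next_vertex n i) (arrow (string_rep V n a b) i x) =
      arrow (string_rep V n c d) i (string_hom n a d i x)"
  proof (cases "m < b - 1")
    case True
    have "supported n a d (next_vertex n i) \<longleftrightarrow> m + 1 < d"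
      unfolding m(3) next_vertex_mod by (rule supported_mod_iff) (use True m ac in auto)
    then show ?thesis using sup sup_cd True unfolding string_rep_def string_hom_def by auto
  next
    case False
    then show ?thesis using sup sup_cd ac unfolding string_rep_def string_hom_def by auto
  qed
qed

section \<open>Quotients, submodules and maps of string representations\<close>

lemma vector_space_mult: "vector_space ((*) :: complex \<Rightarrow> complex \<Rightarrow> complex)"
  by unfold_locales (simp_all add: algebra_simps)

lemma fd_subspace_UNIV_complex: "fd_subspace (*) (UNIV :: complex set)"
proof -
  interpret vector_space "(*) :: complex \<Rightarrow> complex \<Rightarrow> complex" by (rule vector_space_mult)
  have "x \<in> span {1}" for x using span_scale[OF span_base[of 1 "{1}"], of x] by simp
  then show ?thesis unfolding fd_subspace_def by (intro exI[of _ "{1}"]) auto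
qed

lemma Mrep_is_rep: "b \<le> a + int n \<Longrightarrow> n > 0 \<Longrightarrow> is_rep (*) n (Mrep n a b)"
  unfolding Mrep_eq_string_rep
  by (rule string_rep_is_rep) (auto simp: fd_subspace_UNIV_complex vector_space_mult)

lemma Mrep_translate: "Mrep n (a + l * int n) (b + l * int n) = Mrep n a b"
  unfolding Mrep_eq_string_rep by (rule string_rep_translate)

lemma Mrep_hom_bounds:
  assumes f: "rep_hom (*) (*) n (Mrep n a b) (Mrep n c d) f" and "n > 0"
    and ab: "b \<le> a + int n" and cd: "d \<le> c + int n"
    and x: "x \<in> vspace (Mrep n a b) i" "f i x \<noteq> 0" and i: "i \<in> vertices n"
    and m: "c \<le> m" "m < d" "m mod int n = i"
  obtains l where "a + l * int n \<le> m" "m < b + l * int n" "c \<le> a + l * int n" "d \<le> b + l * int n"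
proof -
  have lin: "linear_between (*) (*) (vspace (Mrep n a b) i) (vspace (Mrep n c d) i) (f i)"
    using f i unfolding rep_hom_def by blast
  have "x \<noteq> 0"
  proof
    assume "x = 0"
    then have "f i (0 + 0) = f i 0 + f i 0" using x(1) lin unfolding linear_between_def by blast
    then show False using x \<open>x = 0\<close> by simp
  qed
  then have "supported n a b i" using x(1) unfolding Mrep_eq_string_rep string_rep_def
    by (simp split: if_splits)
  then obtain m' where m': "a \<le> m'" "m' < b" "m' mod int n = i"
    unfolding supported_def by blast
  have "m mod int n = m' mod int n" using m(3) m'(3) by simp
  then obtain l where l: "m = m' + l * int n" by (rule mod_eq_imp_shift)
  have *: "a + l * int n \<le> m" "m < b + l * int n" "b + l * int n \<le> a + l * int n + int n"
    using m' l ab by simp_all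
  have f': "rep_hom (*) (*) n (string_rep UNIV n (a + l * int n) (b + l * int n))
      (string_rep UNIV n c d) f"
    using f unfolding Mrep_eq_string_rep string_rep_translate .
  have r: "is_rep (*) n (string_rep (UNIV :: complex set) n (a + l * int n) (b + l * int n))"
    using Mrep_is_rep[OF ab assms(2)] unfolding Mrep_eq_string_rep string_rep_translate .
  show thesis
  proof (rule that[of l])
    show "c \<le> a + l * int n" "d \<le> b + l * int n"
      using string_rep_hom_bounds[OF f' r assms(2) * m(1,2) cd, of x] x m(3) by simp_all
  qed (use * in auto)
qed

lemma Mrep_string_hom:
  assumes "n > 0" "c \<le> a" "a < d" "d \<le> b" "b \<le> a + int n" "d \<le> c + int n"
  shows "rep_hom (*) (*) n (Mrep n a b) (Mrep n c d) (string_hom n a d)"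
  unfolding Mrep_eq_string_rep using string_hom_rep_hom vector_space_mult assms by blast

text \<open>The inequalities come from a vertex at which the map does not vanish: any such vertex for a nonzero
  map, the top \<open>a1\<close> of the quotient for a surjection, and the socle \<open>b1 - 1\<close> of the submodule for an
  injection.\<close>

lemma
  assumes ab: "a1 < b1" "b1 \<le> a1 + int n" and cd: "a2 < b2" "b2 \<le> a2 + int n" and n: "n > 0"
  shows nonzero_map_Mrep_iff: "nonzero_map_exists (*) (*) n (Mrep n a1 b1) (Mrep n a2 b2) \<longleftrightarrow>
      (\<exists>l. a2 + l * int n \<le> a1 \<and> a1 < b2 + l * int n \<and> b2 + l * int n \<le> b1)"
    and is_quotient_Mrep_iff: "is_quotient (*) (*) n (Mrep n a1 b1) (Mrep n a2 b2) \<longleftrightarrow>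
      (\<exists>l. a1 = a2 + l * int n \<and> b1 \<le> b2 + l * int n)"
    and is_submodule_Mrep_iff: "is_submodule (*) (*) n (Mrep n a1 b1) (Mrep n a2 b2) \<longleftrightarrow>
      (\<exists>l. a2 + l * int n \<le> a1 \<and> b1 = b2 + l * int n)"
proof -
  have vs: "vspace (Mrep n a b) i = (if supported n a b i then UNIV else {0})" for a b i
    unfolding Mrep_eq_string_rep string_rep_def by simp
  have sup: "supported n a b (m mod int n)" if "a \<le> m" "m < b" for a b m
    using that unfolding supported_def by blast
  show "nonzero_map_exists (*) (*) n (Mrep n a1 b1) (Mrep n a2 b2) \<longleftrightarrow>
      (\<exists>l. a2 + l * int n \<le> a1 \<and> a1 < b2 + l * int n \<and> b2 + l * int n \<le> b1)"
  proof
    assume "nonzero_map_exists (*) (*) n (Mrep n a1 b1) (Mrep n a2 b2)"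
    then obtain f i x where f: "rep_hom (*) (*) n (Mrep n a1 b1) (Mrep n a2 b2) f"
      and i: "i \<in> vertices n" and x: "x \<in> vspace (Mrep n a1 b1) i" "f i x \<noteq> 0"
      unfolding nonzero_map_exists_def by blast
    have "f i x \<in> vspace (Mrep n a2 b2) i"
      using f i x unfolding rep_hom_def linear_between_def by blast
    then have "supported n a2 b2 i" using x(2) unfolding vs by (auto split: if_splits)
    then obtain m where m: "a2 \<le> m" "m < b2" "m mod int n = i" unfolding supported_def by blast
    obtain l where "a1 + l * int n \<le> m" "m < b1 + l * int n" "a2 \<le> a1 + l * int n"
      "b2 \<le> b1 + l * int n"
      using Mrep_hom_bounds[OF f n ab(2) cd(2) x i m] .
    then show "\<exists>l. a2 + l * int n \<le> a1 \<and> a1 < b2 + l * int n \<and> b2 + l * int n \<le> b1"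
      using m by (intro exI[of _ "- l"]) simp
  next
    assume "\<exists>l. a2 + l * int n \<le> a1 \<and> a1 < b2 + l * int n \<and> b2 + l * int n \<le> b1"
    then obtain l where l: "a2 + l * int n \<le> a1" "a1 < b2 + l * int n" "b2 + l * int n \<le> b1" by blast
    have "rep_hom (*) (*) n (Mrep n a1 b1) (Mrep n a2 b2) (string_hom n a1 (b2 + l * int n))"
      using Mrep_string_hom[OF n l] ab cd Mrep_translate by simp
    moreover have "string_hom n a1 (b2 + l * int n) (a1 mod int n) (1::complex) \<noteq> 0"
      unfolding string_hom_def using sup l by simp
    moreover have "1 \<in> vspace (Mrep n a1 b1) (a1 mod int n)" unfolding vs using sup ab by simp
    ultimately show "nonzero_map_exists (*) (*) n (Mrep n a1 b1) (Mrep n a2 b2)"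
      unfolding nonzero_map_exists_def using vertices_mod[OF n] by blast
  qed
  show "is_quotient (*) (*) n (Mrep n a1 b1) (Mrep n a2 b2) \<longleftrightarrow>
      (\<exists>l. a1 = a2 + l * int n \<and> b1 \<le> b2 + l * int n)"
  proof
    assume "is_quotient (*) (*) n (Mrep n a1 b1) (Mrep n a2 b2)"
    then obtain f where f: "rep_hom (*) (*) n (Mrep n a2 b2) (Mrep n a1 b1) f"
      and surj: "\<And>i. i \<in> vertices n \<Longrightarrow> f i ` vspace (Mrep n a2 b2) i = vspace (Mrep n a1 b1) i"
      unfolding is_quotient_def by blast
    have i: "a1 mod int n \<in> vertices n" by (rule vertices_mod[OF n])
    have "1 \<in> vspace (Mrep n a1 b1) (a1 mod int n)" unfolding vs using sup ab by simp
    then obtain x where x: "x \<in> vspace (Mrep n a2 b2) (a1 mod int n)" "f (a1 mod int n) x = 1"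
      using surj[OF i] by (metis imageE)
    then have "f (a1 mod int n) x \<noteq> 0" by simp
    then obtain l where "a2 + l * int n \<le> a1" "a1 \<le> a2 + l * int n" "b1 \<le> b2 + l * int n"
      using Mrep_hom_bounds[OF f n cd(2) ab(2) x(1) _ i order_refl ab(1) refl] by blast
    then show "\<exists>l. a1 = a2 + l * int n \<and> b1 \<le> b2 + l * int n" by force
  next
    assume "\<exists>l. a1 = a2 + l * int n \<and> b1 \<le> b2 + l * int n"
    then obtain l where l: "a1 = a2 + l * int n" "b1 \<le> b2 + l * int n" by blast
    have "b2 + l * int n \<le> a2 + l * int n + int n" using cd by simp
    then have hom: "rep_hom (*) (*) n (Mrep n a2 b2) (Mrep n a1 b1) (string_hom n a1 b1)"
      using Mrep_string_hom[OF n, of a1 "a2 + l * int n" b1 "b2 + l * int n"] ab l Mrep_translate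
      by simp
    have "string_hom n a1 b1 i ` vspace (Mrep n a2 b2) i = vspace (Mrep n a1 b1) i" for i
    proof (cases "supported n a1 b1 i")
      case True
      then have "supported n (a2 + l * int n) (b2 + l * int n) i"
        using l unfolding supported_def by (metis order_less_le_trans)
      then show ?thesis using True unfolding vs string_hom_def supported_translate by simp
    qed (auto simp: vs string_hom_def)
    then show "is_quotient (*) (*) n (Mrep n a1 b1) (Mrep n a2 b2)"
      unfolding is_quotient_def using hom by blast
  qed
  show "is_submodule (*) (*) n (Mrep n a1 b1) (Mrep n a2 b2) \<longleftrightarrow>
      (\<exists>l. a2 + l * int n \<le> a1 \<and> b1 = b2 + l * int n)"
  proof
    assume "is_submodule (*) (*) n (Mrep n a1 b1) (Mrep n a2 b2)"
    then obtain U f where U: "subrep (*) n U (Mrep n a2 b2)" and f: "rep_hom (*) (*) n (Mrep n a1 b1) U f"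
      and bij: "\<And>i. i \<in> vertices n \<Longrightarrow> bij_betw (f i) (vspace (Mrep n a1 b1) i) (vspace U i)"
      unfolding is_submodule_def rep_iso_def by blast
    have g: "rep_hom (*) (*) n (Mrep n a1 b1) (Mrep n a2 b2) f"
      using f U unfolding rep_hom_def subrep_def linear_between_def by (smt (verit) subsetD)
    let ?i = "(b1 - 1) mod int n"
    have i: "?i \<in> vertices n" by (rule vertices_mod[OF n])
    have v1: "vspace (Mrep n a1 b1) ?i = UNIV" unfolding vs using sup[of a1 "b1 - 1" b1] ab by simp
    then have x: "0 \<in> vspace (Mrep n a1 b1) ?i" "1 \<in> vspace (Mrep n a1 b1) ?i" by auto
    have "f ?i (0 + 0) = f ?i 0 + f ?i 0"
      using g i x unfolding rep_hom_def linear_between_def by blast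
    moreover have "f ?i 0 \<noteq> f ?i 1"
      using bij[OF i] x unfolding bij_betw_def inj_on_def by (metis zero_neq_one)
    ultimately have f1: "f ?i 1 \<noteq> 0" by auto
    have "f ?i 1 \<in> vspace (Mrep n a2 b2) ?i"
      using g i x unfolding rep_hom_def linear_between_def by blast
    then have "supported n a2 b2 ?i" using f1 unfolding vs by (auto split: if_splits)
    then obtain m where m: "a2 \<le> m" "m < b2" "m mod int n = ?i" unfolding supported_def by blast
    obtain l where l: "a1 + l * int n \<le> m" "m < b1 + l * int n" "a2 \<le> a1 + l * int n"
      "b2 \<le> b1 + l * int n"
      using Mrep_hom_bounds[OF g n ab(2) cd(2) x(2) f1 i m] .
    have "(b1 - 1 + l * int n) mod int n = m mod int n" using m(3) by simp
    moreover have "b1 - 1 + l * int n < m + int n" "m < b1 - 1 + l * int n + int n"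
      using l(1,2) ab n by linarith+
    ultimately have "b1 - 1 + l * int n = m" by (rule mod_eq_imp_eq)
    then have "b1 + l * int n = b2" using l m by simp
    then show "\<exists>l. a2 + l * int n \<le> a1 \<and> b1 = b2 + l * int n"
      using l by (intro exI[of _ "- l"]) auto
  next
    assume "\<exists>l. a2 + l * int n \<le> a1 \<and> b1 = b2 + l * int n"
    then obtain l where l: "a2 + l * int n \<le> a1" "b1 = b2 + l * int n" by blast
    let ?c = "a2 + l * int n"
    have M2: "Mrep n a2 b2 = Mrep n ?c b1" using Mrep_translate l by simp
    have cb: "b1 \<le> ?c + int n" using cd l by simp
    have "subrep (*) n (Mrep n a1 b1) (Mrep n ?c b1)"
      unfolding subrep_def
    proof (intro conjI ballI Mrep_is_rep[OF ab(2) n])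
      fix i assume "i \<in> vertices n"
      show "vspace (Mrep n a1 b1) i \<subseteq> vspace (Mrep n ?c b1) i"
      proof -
        have "supported n a1 b1 i \<Longrightarrow> supported n ?c b1 i"
          unfolding supported_def using order_trans[OF l(1)] by blast
        then show ?thesis unfolding vs by simp
      qed
      fix x assume x: "x \<in> vspace (Mrep n a1 b1) i"
      show "arrow (Mrep n a1 b1) i x = arrow (Mrep n ?c b1) i x"
      proof (cases "supported n a1 b1 i")
        case True
        then obtain m where m: "a1 \<le> m" "m < b1" "m mod int n = i" unfolding supported_def by blast
        have "supported n a1 (b1 - 1) i \<longleftrightarrow> m < b1 - 1" "supported n ?c (b1 - 1) i \<longleftrightarrow> m < b1 - 1"
          using supported_mod_iff[of a1 m n "b1 - 1"] supported_mod_iff[of ?c m n "b1 - 1"] m l cb ab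
          by auto
        then show ?thesis unfolding Mrep_eq_string_rep string_rep_def by simp
      next
        case False
        then have "x = 0" using x unfolding vs by simp
        then show ?thesis unfolding Mrep_eq_string_rep string_rep_def by simp
      qed
    qed
    moreover have "rep_iso (*) (*) n (Mrep n a1 b1) (Mrep n a1 b1)"
      unfolding rep_iso_def
    proof (intro exI[of _ "\<lambda>_ x. x"] conjI ballI)
      show "rep_hom (*) (*) n (Mrep n a1 b1) (Mrep n a1 b1) (\<lambda>_ x. x)"
        unfolding rep_hom_def linear_between_def by simp
    qed (simp add: bij_betw_def)
    ultimately show "is_submodule (*) (*) n (Mrep n a1 b1) (Mrep n a2 b2)"
      unfolding is_submodule_def M2 by blast
  qed
qed

section \<open>Representations in an ambient space\<close>

text \<open>The nonzero vector \<open>v\<close> spans the line on which copies of the uniserial modules are built. The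
  parameter \<open>k\<close> is the length of the paths that vanish, \<open>n\<close> or \<open>n - 1\<close> in the application.\<close>

locale cycle_ambient = vector_space scale
  for scale :: "complex \<Rightarrow> 'v::ab_group_add \<Rightarrow> 'v" +
  fixes n k :: nat and v :: 'v
  assumes n_pos: "0 < n" and k_le: "k \<le> n" and v_nonzero: "v \<noteq> 0"
begin

abbreviation line :: "'v set" where "line \<equiv> span {v}"

abbreviation string :: "int \<Rightarrow> int \<Rightarrow> 'v rep" where "string \<equiv> string_rep line n"

abbreviation reps :: "'v rep set" where "reps \<equiv> cycle_reps scale n k"

lemma line_iff: "x \<in> line \<longleftrightarrow> (\<exists>c. x = scale c v)"
  by (auto simp: span_singleton)

lemma fd_subspace_line: "fd_subspace scale line"
  unfolding fd_subspace_def by blast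

lemma string_in_reps:
  assumes "b \<le> a + int k"
  shows "string a b \<in> reps"
proof -
  have bn: "b \<le> a + int n" using assms k_le by simp
  have "is_rep scale n (string a b)"
    using string_rep_is_rep[OF fd_subspace_line _ _ bn n_pos] span_zero vector_space_axioms by blast
  moreover have "path_map n (string a b) k i x = 0" if x: "x \<in> vspace (string a b) i" for i x
  proof (cases "supported n a b i")
    case True
    then obtain m where m: "a \<le> m" "m < b" "i = m mod int n" unfolding supported_def by blast
    show ?thesis unfolding m(3) path_map_string_rep[OF m(1,2) bn] using m assms by simp
  next
    case False
    then have "x = 0" using x unfolding string_rep_def by simp
    then show ?thesis using path_map_zero by blast
  qed
  ultimately show ?thesis unfolding cycle_reps_def by blast
qed

lemma reps_is_rep: "M \<in> reps \<Longrightarrow> is_rep scale n M"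
  unfolding cycle_reps_def by blast

lemma is_rep_subspace:
  assumes "is_rep scale n M" "i \<in> vertices n"
  shows "subspace (vspace M i)"
  using assms subspace_span unfolding is_rep_def fd_subspace_def by metis

lemma is_rep_arrow:
  assumes "is_rep scale n M" "i \<in> vertices n"
  shows "linear_between scale scale (vspace M i) (vspace M (next_vertex n i)) (arrow M i)"
  using assms unfolding is_rep_def by blast

lemma linear_betweenD:
  assumes "linear_between s t U W f"
  shows linear_between_in: "x \<in> U \<Longrightarrow> f x \<in> W"
    and linear_between_add: "x \<in> U \<Longrightarrow> y \<in> U \<Longrightarrow> f (x + y) = f x + f y"
    and linear_between_scale: "x \<in> U \<Longrightarrow> f (s c x) = t c (f x)"
  using assms unfolding linear_between_def by blast+

lemma linear_between_zero:
  assumes "linear_between s t U W f" "0 \<in> U"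
  shows "f 0 = 0"
  using linear_between_add[OF assms(1) assms(2) assms(2)] by simp

lemma linear_between_path_map:
  assumes "is_rep scale n M"
  shows "linear_between scale scale (vspace M (m mod int n)) (vspace M ((m + int t) mod int n))
    (path_map n M t (m mod int n))"
proof (induction t)
  case 0
  then show ?case unfolding linear_between_def by simp
next
  case (Suc t)
  have "next_vertex n ((m + int t) mod int n) = (m + int (Suc t)) mod int n"
    unfolding next_vertex_mod by (simp add: algebra_simps)
  then have "linear_between scale scale (vspace M ((m + int t) mod int n))
      (vspace M ((m + int (Suc t)) mod int n)) (arrow M ((m + int t) mod int n))"
    using is_rep_arrow[OF assms vertices_mod[OF n_pos]] by metis
  then show ?case using Suc unfolding linear_between_def path_map_Suc_end by simp
qed

lemma path_map_zero_rep:
  assumes "is_rep scale n M"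
  shows "path_map n M t (m mod int n) 0 = 0"
  using linear_between_zero[OF linear_between_path_map[OF assms]]
    subspace_0[OF is_rep_subspace[OF assms vertices_mod[OF n_pos]]] by blast

lemma path_map_eq_zero:
  assumes "M \<in> reps" "x \<in> vspace M (m mod int n)" "k \<le> t"
  shows "path_map n M t (m mod int n) x = 0"
proof -
  have "path_map n M k (m mod int n) x = 0"
    using assms vertices_mod[OF n_pos] unfolding cycle_reps_def by blast
  then have "path_map n M (k + (t - k)) (m mod int n) x = 0"
    unfolding path_map_add using path_map_zero_rep[OF reps_is_rep[OF assms(1)]] by simp
  then show ?thesis using assms(3) by simp
qed

lemma fd_subspace_subset:
  assumes "fd_subspace scale X" "subspace U" "U \<subseteq> X"
  shows "fd_subspace scale U"
proof -
  obtain B where B: "finite B" "span B = X" using assms(1) unfolding fd_subspace_def by blast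
  obtain C where C: "C \<subseteq> U" "independent C" "U \<subseteq> span C"
    using maximal_independent_subset[of U] .
  have "C \<subseteq> span B" using C(1) assms(3) B(2) by simp
  then have "finite C" using independent_span_bound[OF B(1) C(2)] by simp
  moreover have "span C = U" using C(3) span_minimal[OF C(1) assms(2)] by simp
  ultimately show ?thesis unfolding fd_subspace_def by blast
qed

lemma dim_mono_fd:
  assumes X: "fd_subspace scale X" and UW: "subspace U" "subspace W" "U \<subseteq> W" "W \<subseteq> X"
  shows "dim U \<le> dim W" and "x \<in> W \<Longrightarrow> x \<notin> U \<Longrightarrow> dim U < dim W"
proof -
  obtain B where B: "finite B" "span B = W"
    using fd_subspace_subset[OF X UW(2,4)] unfolding fd_subspace_def by blast
  obtain C where C: "C \<subseteq> U" "independent C" "U \<subseteq> span C" "card C = dim U"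
    using basis_exists[of U] .
  obtain D where D: "D \<subseteq> W" "independent D" "W \<subseteq> span D" "card D = dim W"
    using basis_exists[of W] .
  have "finite D" using independent_span_bound[OF B(1) D(2)] D(1) B(2) by simp
  then have bound: "finite E \<and> card E \<le> dim W" if "independent E" "E \<subseteq> W" for E
    using independent_span_bound[of D E] that D by auto
  have CW: "C \<subseteq> W" using C(1) UW(3) by simp
  show "dim U \<le> dim W" using bound[OF C(2) CW] C(4) by simp
  assume x: "x \<in> W" "x \<notin> U"
  then have "x \<notin> span C" using span_minimal[OF C(1) UW(1)] by blast
  then have "independent (insert x C)" "x \<notin> C" using independent_insertI C(2) span_base by blast+
  then show "dim U < dim W" using bound[of "insert x C"] bound[OF C(2) CW] x CW C(4) by simp
qed

lemma functional_vanishing_on: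
  assumes "subspace W" "w \<notin> W"
  obtains \<phi> :: "'v \<Rightarrow> complex" where "\<And>x y. \<phi> (x + y) = \<phi> x + \<phi> y"
    "\<And>c x. \<phi> (scale c x) = c * \<phi> x" "\<And>x. x \<in> W \<Longrightarrow> \<phi> x = 0" "\<phi> w = 1"
proof -
  interpret p: vector_space_pair scale "(*) :: complex \<Rightarrow> complex \<Rightarrow> complex"
    using vector_space_axioms vector_space_mult by (simp add: vector_space_pair_def)
  obtain B where B: "B \<subseteq> W" "independent B" "W \<subseteq> span B"
    using maximal_independent_subset[of W] .
  have "w \<notin> span B" using span_minimal[OF B(1) assms(1)] assms(2) by blast
  then have ind: "independent (insert w B)" and "w \<notin> B"
    using independent_insertI B(2) span_base by blast+
  obtain \<phi> where lin: "Vector_Spaces.linear scale (*) \<phi>"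
    and \<phi>: "\<And>x. x \<in> insert w B \<Longrightarrow> \<phi> x = (if x = w then 1 else 0)"
    using p.linear_independent_extend[OF ind, of "\<lambda>x. if x = w then 1 else 0"] by blast
  interpret \<phi>: Vector_Spaces.linear scale "(*)" \<phi> by (rule lin)
  show thesis
  proof (rule that)
    show "\<phi> x = 0" if "x \<in> W" for x
    proof (rule \<phi>.eq_0_on_span)
      show "x \<in> span B" using that B(3) by blast
      fix y assume "y \<in> B"
      then show "\<phi> y = 0" using \<phi>[of y] \<open>w \<notin> B\<close> by auto
    qed
    show "\<phi> w = 1" using \<phi> by simp
  qed (simp_all add: \<phi>.add \<phi>.scale)
qed

section \<open>From torsion classes to patterns\<close>

definition pattern_of :: "'v rep set \<Rightarrow> int rel" where
  "pattern_of T = {(a, b). a < b \<and> b \<le> a + int k \<and> string a b \<in> T}"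

lemma supported_suffix_iff:
  assumes "a \<le> b" "b \<le> c" "c \<le> a + int n" "a \<le> m" "m < a + int n"
  shows "supported n b c (m mod int n) \<longleftrightarrow> b \<le> m \<and> m < c"
proof
  assume "supported n b c (m mod int n)"
  then obtain m' where m': "b \<le> m'" "m' < c" "m' mod int n = m mod int n"
    unfolding supported_def by blast
  have "m' = m" by (rule mod_eq_imp_eq[OF m'(3)]) (use m' assms in linarith)+
  then show "b \<le> m \<and> m < c" using m' by simp
qed (auto simp: supported_def)

lemma vertex_lift:
  assumes "i \<in> vertices n"
  obtains m where "a \<le> m" "m < a + int n" "i = m mod int n"
proof
  show "a \<le> a + (i - a) mod int n" "a + (i - a) mod int n < a + int n"
    using n_pos by simp_all
  show "i = (a + (i - a) mod int n) mod int n"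
    using vertices_mod_eq[OF assms] by (simp add: mod_add_right_eq)
qed

lemma string_prefix_quotient:
  assumes "a < b" "b \<le> c" "c \<le> a + int n"
  shows "is_quotient scale scale n (string a b) (string a c)"
  unfolding is_quotient_def
proof (intro exI conjI ballI)
  show "rep_hom scale scale n (string a c) (string a b) (string_hom n a b)"
    by (rule string_hom_rep_hom) (use assms n_pos vector_space_axioms span_zero in auto)
  fix i assume "i \<in> vertices n"
  have "supported n a b i \<Longrightarrow> supported n a c i"
    unfolding supported_def using order_less_le_trans[OF _ assms(2)] by blast
  then show "string_hom n a b i ` vspace (string a c) i = vspace (string a b) i"
    unfolding string_rep_def string_hom_def using span_zero by auto
qed

lemma string_short_exact:
  assumes "a < b" "b < c" "c \<le> a + int n"
  shows "short_exact scale n (string b c) (string a c) (string a b)"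
  unfolding short_exact_def
proof (intro exI conjI ballI)
  show "rep_hom scale scale n (string b c) (string a c) (string_hom n b c)"
    by (rule string_hom_rep_hom) (use assms n_pos vector_space_axioms span_zero in auto)
  show "rep_hom scale scale n (string a c) (string a b) (string_hom n a b)"
    by (rule string_hom_rep_hom) (use assms n_pos vector_space_axioms span_zero in auto)
  fix i assume "i \<in> vertices n"
  then obtain m where m: "a \<le> m" "m < a + int n" "i = m mod int n" by (rule vertex_lift)
  have sup: "supported n a b i \<longleftrightarrow> m < b" "supported n a c i \<longleftrightarrow> m < c"
    "supported n b c i \<longleftrightarrow> b \<le> m \<and> m < c"
    using supported_mod_iff[OF m(1,2), of b] supported_mod_iff[OF m(1,2), of c]
      supported_suffix_iff[of a b c m] m assms by simp_all
  show "inj_on (string_hom n b c i) (vspace (string b c) i)"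
    unfolding string_rep_def string_hom_def by (auto simp: inj_on_def)
  show "string_hom n b c i ` vspace (string b c) i =
      {x \<in> vspace (string a c) i. string_hom n a b i x = 0}"
    unfolding string_rep_def string_hom_def using sup assms span_zero by auto
  show "string_hom n a b i ` vspace (string a c) i = vspace (string a b) i"
    unfolding string_rep_def string_hom_def using sup assms span_zero by auto
qed

text \<open>Closure under quotients and under extensions translate into the two closure conditions of a
  pattern, by \<open>string_prefix_quotient\<close> and \<open>string_short_exact\<close>.\<close>

lemma torsion_pattern_pattern_of:
  assumes T: "torsion_class scale n k T"
  shows "torsion_pattern n k (pattern_of T)"
proof (rule torsion_patternI)
  fix a b l assume "(a, b) \<in> pattern_of T"
  then show "(a + l * int n, b + l * int n) \<in> pattern_of T"
    unfolding pattern_of_def by (simp add: string_rep_translate)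
next
  fix a b c assume *: "(a, c) \<in> pattern_of T" "a < b" "b \<le> c"
  then have c: "c \<le> a + int k" "string a c \<in> T" unfolding pattern_of_def by auto
  then have "is_quotient scale scale n (string a b) (string a c)" "string a b \<in> reps"
    using string_prefix_quotient[OF *(2,3)] string_in_reps[of b a] k_le * by simp_all
  then have "string a b \<in> T" using T c(2) unfolding torsion_class_def by blast
  then show "(a, b) \<in> pattern_of T" unfolding pattern_of_def using * c by simp
next
  fix a b c assume *: "(a, b) \<in> pattern_of T" "(b, c) \<in> pattern_of T" "c \<le> a + int k"
  then have ab: "a < b" "string a b \<in> T" and bc: "b < c" "string b c \<in> T"
    unfolding pattern_of_def by auto
  have "short_exact scale n (string b c) (string a c) (string a b)" "string a c \<in> reps"
    using string_short_exact[OF ab(1) bc(1)] string_in_reps[of c a] k_le * by simp_all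
  then have "string a c \<in> T" using T ab(2) bc(2) unfolding torsion_class_def by blast
  then show "(a, c) \<in> pattern_of T" unfolding pattern_of_def using * ab bc by simp
qed (auto simp: pattern_of_def)

section \<open>From patterns to torsion classes\<close>

text \<open>The strings that receive no nonzero map from a string in \<open>J\<close>. The image of such a map would be a
  submodule, the string of some \<open>(e, b)\<close>, and by closure under quotients it would be in \<open>J\<close>.\<close>

definition torsion_free_string :: "int rel \<Rightarrow> int \<Rightarrow> int \<Rightarrow> bool" where
  "torsion_free_string J a b \<longleftrightarrow> a < b \<and> b \<le> a + int k \<and> (\<forall>e. a \<le> e \<and> e < b \<longrightarrow> (e, b) \<notin> J)"

text \<open>The representations without nonzero maps to the torsion-free strings: a map from \<open>M\<close> to the string
  of \<open>(a, b)\<close> is a functional on the space at \<open>b - 1\<close> vanishing on the image of the space at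
  \<open>a - 1\<close>, so there is none iff the path from \<open>a - 1\<close> to \<open>b - 1\<close> acts surjectively.\<close>

definition rep_class :: "int rel \<Rightarrow> 'v rep set" where
  "rep_class J = {M \<in> reps. \<forall>a b. torsion_free_string J a b \<longrightarrow>
     vspace M ((b - 1) mod int n) \<subseteq>
       path_map n M (nat (b - a)) ((a - 1) mod int n) ` vspace M ((a - 1) mod int n)}"

lemma rep_classD:
  assumes "M \<in> rep_class J" "torsion_free_string J a b" "y \<in> vspace M ((b - 1) mod int n)"
  obtains x where "x \<in> vspace M ((a - 1) mod int n)"
    "y = path_map n M (nat (b - a)) ((a - 1) mod int n) x"
  using assms unfolding rep_class_def by blast

lemma rep_classI:
  assumes "M \<in> reps"
    and "\<And>a b y. torsion_free_string J a b \<Longrightarrow> y \<in> vspace M ((b - 1) mod int n) \<Longrightarrow>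
      \<exists>x. x \<in> vspace M ((a - 1) mod int n) \<and> y = path_map n M (nat (b - a)) ((a - 1) mod int n) x"
  shows "M \<in> rep_class J"
  using assms unfolding rep_class_def by blast

lemma torsion_free_string_less: "torsion_free_string J a b \<Longrightarrow> a - 1 + int (nat (b - a)) = b - 1"
  unfolding torsion_free_string_def by simp

lemma quotient_in_rep_class:
  assumes M: "M \<in> rep_class J" and Q: "Q \<in> reps" "is_quotient scale scale n Q M"
  shows "Q \<in> rep_class J"
proof (rule rep_classI[OF Q(1)])
  obtain f where f: "rep_hom scale scale n M Q f"
    and surj: "\<And>i. i \<in> vertices n \<Longrightarrow> f i ` vspace M i = vspace Q i"
    using Q(2) unfolding is_quotient_def by blast
  have rep: "is_rep scale n M" using M reps_is_rep unfolding rep_class_def by blast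
  fix a b y assume ab: "torsion_free_string J a b" and y: "y \<in> vspace Q ((b - 1) mod int n)"
  then obtain x where x: "x \<in> vspace M ((b - 1) mod int n)" "y = f ((b - 1) mod int n) x"
    using surj[OF vertices_mod[OF n_pos]] by (metis imageE)
  obtain z where z: "z \<in> vspace M ((a - 1) mod int n)"
    "x = path_map n M (nat (b - a)) ((a - 1) mod int n) z"
    using rep_classD[OF M ab x(1)] .
  have "y = path_map n Q (nat (b - a)) ((a - 1) mod int n) (f ((a - 1) mod int n) z)"
    using rep_hom_path_map(2)[OF f rep n_pos z(1), of "nat (b - a)"] x(2) z(2)
    unfolding torsion_free_string_less[OF ab] by simp
  moreover have "f ((a - 1) mod int n) z \<in> vspace Q ((a - 1) mod int n)"
    using surj[OF vertices_mod[OF n_pos]] z(1) by blast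
  ultimately show "\<exists>x. x \<in> vspace Q ((a - 1) mod int n) \<and>
      y = path_map n Q (nat (b - a)) ((a - 1) mod int n) x"
    by (intro exI[of _ "f ((a - 1) mod int n) z"] conjI)
qed

text \<open>Surjectivity of a path on the two outer terms of an exact sequence implies surjectivity on the
  middle term: subtract from \<open>y\<close> the image of a preimage found modulo the subrepresentation, and
  correct the difference inside the subrepresentation.\<close>

lemma extension_in_rep_class:
  assumes A: "A \<in> rep_class J" and B: "B \<in> rep_class J" and E: "E \<in> reps"
    and ses: "short_exact scale n A E B"
  shows "E \<in> rep_class J"
proof (rule rep_classI[OF E])
  obtain f g where fg: "rep_hom scale scale n A E f \<and> rep_hom scale scale n E B g \<and>
      (\<forall>i\<in>vertices n. inj_on (f i) (vspace A i) \<and>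
        f i ` vspace A i = {x \<in> vspace E i. g i x = 0} \<and> g i ` vspace E i = vspace B i)"
    using ses unfolding short_exact_def by (elim exE)
  then have f: "rep_hom scale scale n A E f" and g: "rep_hom scale scale n E B g" by simp_all
  have ex: "f i ` vspace A i = {x \<in> vspace E i. g i x = 0}"
    and surj: "g i ` vspace E i = vspace B i" if "i \<in> vertices n" for i
    using fg that by simp_all
  have rep: "is_rep scale n A" "is_rep scale n E"
    using A E reps_is_rep unfolding rep_class_def by blast+
  fix a b y assume ab: "torsion_free_string J a b" and y: "y \<in> vspace E ((b - 1) mod int n)"
  let ?i = "(a - 1) mod int n" and ?j = "(b - 1) mod int n" and ?t = "nat (b - a)"
  have ij: "?i \<in> vertices n" "?j \<in> vertices n" using vertices_mod[OF n_pos] by blast+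
  note e = torsion_free_string_less[OF ab]
  have gl: "linear_between scale scale (vspace E ?j) (vspace B ?j) (g ?j)"
    using g ij unfolding rep_hom_def by blast
  have pl: "linear_between scale scale (vspace E ?i) (vspace E ?j) (path_map n E ?t ?i)"
    using linear_between_path_map[OF rep(2), of "a - 1" ?t] unfolding e .
  have sub: "subspace (vspace E ?j)" "subspace (vspace E ?i)" using is_rep_subspace rep ij by blast+
  obtain x' where x': "x' \<in> vspace B ?i" "g ?j y = path_map n B ?t ?i x'"
    using rep_classD[OF B ab] linear_between_in[OF gl y] by blast
  obtain x where x: "x \<in> vspace E ?i" "x' = g ?i x" using surj[OF ij(1)] x'(1) by (metis imageE)
  let ?p = "path_map n E ?t ?i x"
  have p: "?p \<in> vspace E ?j" by (rule linear_between_in[OF pl x(1)])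
  have gp: "g ?j ?p = g ?j y"
    using rep_hom_path_map(2)[OF g rep(2) n_pos x(1), of ?t] x x' unfolding e by simp
  have mp: "scale (-1) ?p \<in> vspace E ?j" by (rule subspace_scale[OF sub(1) p])
  have "y + scale (-1) ?p \<in> vspace E ?j" by (rule subspace_add[OF sub(1) y mp])
  moreover have "g ?j (y + scale (-1) ?p) = 0"
    unfolding linear_between_add[OF gl y mp] linear_between_scale[OF gl p] gp by simp
  ultimately have "y + scale (-1) ?p \<in> f ?j ` vspace A ?j" unfolding ex[OF ij(2)] by simp
  then obtain w where w: "w \<in> vspace A ?j" "y + scale (-1) ?p = f ?j w" by (rule imageE)
  obtain u where u: "u \<in> vspace A ?i" "w = path_map n A ?t ?i u"
    using rep_classD[OF A ab w(1)] .
  have "f ?j w = path_map n E ?t ?i (f ?i u)"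
    using rep_hom_path_map(2)[OF f rep(1) n_pos u(1), of ?t] u(2) unfolding e by simp
  moreover have fu: "f ?i u \<in> vspace E ?i" using ex[OF ij(1)] u(1) by blast
  ultimately have "y = path_map n E ?t ?i (f ?i u + x)"
    unfolding linear_between_add[OF pl fu x(1)] using w(2) by (simp add: algebra_simps)
  then show "\<exists>x. x \<in> vspace E ?i \<and> y = path_map n E ?t ?i x"
    using subspace_add[OF sub(2) fu x(1)] by (intro exI[of _ "f ?i u + x"] conjI)
qed

definition zero_rep :: "'v rep" where
  "zero_rep = \<lparr>vspace = \<lambda>_. {0}, arrow = \<lambda>_ _. 0\<rparr>"

lemma path_map_vspace_update: "path_map n (M\<lparr>vspace := W\<rparr>) t i x = path_map n M t i x"
  by (induction t arbitrary: i x) simp_all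

lemma fd_subspace_0: "fd_subspace scale {0}"
  unfolding fd_subspace_def by (rule exI[of _ "{}"]) simp

lemma zero_rep_in_reps: "zero_rep \<in> reps"
proof -
  have "path_map n zero_rep t i 0 = 0" for t i
    by (induction t arbitrary: i) (simp_all add: zero_rep_def)
  then show ?thesis
    unfolding cycle_reps_def is_rep_def linear_between_def
    using fd_subspace_0 by (simp add: zero_rep_def)
qed

lemma rep_iso_imp_quotient: "rep_iso scale scale n M N \<Longrightarrow> is_quotient scale scale n N M"
  unfolding rep_iso_def is_quotient_def bij_betw_def by blast

lemma torsion_class_rep_class: "torsion_class scale n k (rep_class J)"
  unfolding torsion_class_def
proof (intro conjI ballI impI)
  have "zero_rep \<in> rep_class J"
  proof (rule rep_classI[OF zero_rep_in_reps])
    fix a b :: int and y :: 'v assume "y \<in> vspace zero_rep ((b - 1) mod int n)"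
    then have "y = 0" unfolding zero_rep_def by simp
    then show "\<exists>x. x \<in> vspace zero_rep ((a - 1) mod int n) \<and>
        y = path_map n zero_rep (nat (b - a)) ((a - 1) mod int n) x"
      using path_map_zero_rep[OF reps_is_rep[OF zero_rep_in_reps]]
      by (intro exI[of _ 0]) (simp add: zero_rep_def)
  qed
  then show "rep_class J \<noteq> {}" by blast
  show "rep_class J \<subseteq> reps" unfolding rep_class_def by blast
  fix M N assume M: "M \<in> rep_class J" "N \<in> reps"
  show "N \<in> rep_class J" if "rep_iso scale scale n M N"
    using quotient_in_rep_class[OF M rep_iso_imp_quotient[OF that]] .
  show "N \<in> rep_class J" if "is_quotient scale scale n N M"
    using quotient_in_rep_class[OF M that] .
next
  fix A B E assume *: "A \<in> rep_class J" "B \<in> rep_class J" "E \<in> reps" "short_exact scale n A E B"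
  show "E \<in> rep_class J" by (rule extension_in_rep_class[OF *])
qed

text \<open>For a string \<open>(c, d)\<close> outside \<open>J\<close>, let \<open>b\<close> be minimal with \<open>(c, b) \<notin> J\<close>. Then \<open>(c, b)\<close> is torsion-free,
  since \<open>(e, b) \<in> J\<close> could be composed with \<open>(c, e) \<in> J\<close>, and the path from \<open>c - 1\<close> to \<open>b - 1\<close> is not
  surjective on the string of \<open>(c, d)\<close>.\<close>

lemma pattern_of_rep_class:
  assumes J: "torsion_pattern n k J"
  shows "pattern_of (rep_class J) = J"
proof -
  have "string c d \<in> rep_class J \<longleftrightarrow> (c, d) \<in> J" if cd: "c < d" "d \<le> c + int k" for c d
  proof
    assume str: "string c d \<in> rep_class J"
    show "(c, d) \<in> J"
    proof (rule ccontr)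
      assume notin: "(c, d) \<notin> J"
      define P where "P t \<longleftrightarrow> (c, c + 1 + int t) \<notin> J" for t
      have "P (nat (d - c - 1))" unfolding P_def using cd notin by simp
      define t where "t = (LEAST t. P t)"
      have t: "P t" "\<And>u. u < t \<Longrightarrow> \<not> P u" "t \<le> nat (d - c - 1)"
        unfolding t_def using \<open>P (nat (d - c - 1))\<close>
        by (auto intro: LeastI Least_le dest: not_less_Least)
      define b where "b = c + 1 + int t"
      have b: "c < b" "b \<le> d" "(c, b) \<notin> J" unfolding b_def using t(1,3) cd P_def by auto
      have "(e, b) \<notin> J" if e: "c \<le> e" "e < b" for e
      proof (cases "e = c")
        case False
        then have "\<not> P (nat (e - c - 1))" using t(2) e unfolding b_def by simp
        then have "(c, e) \<in> J" unfolding P_def using e False by simp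
        then show ?thesis using torsion_pattern_trans[OF J, of c e b] b cd by auto
      qed (use b in simp)
      then have "torsion_free_string J c b" unfolding torsion_free_string_def using b cd by auto
      moreover have vb: "v \<in> vspace (string c d) ((b - 1) mod int n)"
        unfolding string_rep_def using b supportedI[of c "b - 1" d n] span_base[of v "{v}"] by simp
      ultimately obtain x where x: "x \<in> vspace (string c d) ((c - 1) mod int n)"
        "v = path_map n (string c d) (nat (b - c)) ((c - 1) mod int n) x"
        using rep_classD[OF str] by blast
      have nb: "nat (b - c) = Suc (nat (b - 1 - c))" using b by simp
      have nx: "next_vertex n ((c - 1) mod int n) = c mod int n" unfolding next_vertex_mod by simp
      have "\<not> supported n c (d - 1) ((c - 1) mod int n)"
      proof
        assume "supported n c (d - 1) ((c - 1) mod int n)"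
        then obtain m where m: "c \<le> m" "m < d - 1" "m mod int n = (c - 1) mod int n"
          unfolding supported_def by blast
        have "m = c - 1" by (rule mod_eq_imp_eq[OF m(3)]) (use m cd k_le n_pos in linarith)+
        then show False using m by simp
      qed
      then have "arrow (string c d) ((c - 1) mod int n) x = 0" unfolding string_rep_def by simp
      then have "v = path_map n (string c d) (nat (b - 1 - c)) (c mod int n) 0"
        using x(2) unfolding nb path_map.simps nx by simp
      then show False using path_map_zero v_nonzero by metis
    qed
  next
    assume cdJ: "(c, d) \<in> J"
    show "string c d \<in> rep_class J"
    proof (rule rep_classI[OF string_in_reps[OF cd(2)]])
      fix a b y assume ab: "torsion_free_string J a b"
        and y: "y \<in> vspace (string c d) ((b - 1) mod int n)"
      show "\<exists>x. x \<in> vspace (string c d) ((a - 1) mod int n) \<and>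
          y = path_map n (string c d) (nat (b - a)) ((a - 1) mod int n) x"
      proof (cases "y = 0")
        case True
        then show ?thesis
          using path_map_zero[of n line c d] span_zero
          by (intro exI[of _ 0]) (simp add: string_rep_def)
      next
        case False
        then have "supported n c d ((b - 1) mod int n)"
          using y unfolding string_rep_def by (simp split: if_splits)
        then obtain m where m: "c \<le> m" "m < d" "m mod int n = (b - 1) mod int n"
          unfolding supported_def by blast
        obtain l where l: "m = b - 1 + l * int n" using mod_eq_imp_shift[OF m(3)] .
        let ?c = "c - l * int n" and ?d = "d - l * int n"
        \<comment> \<open>Were the string to start at or after \<open>a\<close>, its prefix ending at \<open>b\<close> would contradict that
          \<open>(a, b)\<close> is torsion-free.\<close>
        have "(?c, ?d) \<in> J" using torsion_pattern_translate[OF J, of ?c l ?d] cdJ by simp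
        then have "(?c, b) \<in> J" using torsion_pattern_prefix[OF J] l m by simp
        then have "?c < a" using ab l m unfolding torsion_free_string_def
          by (metis linorder_not_less add.commute le_diff_eq zle_diff1_eq diff_le_eq)
        moreover have "string c d = string ?c ?d"
          using string_rep_translate[of line n ?c l ?d] by simp
        moreover have a: "?c \<le> a - 1" "a - 1 < ?d" "?d \<le> ?c + int n"
          using \<open>?c < a\<close> ab l m cd k_le unfolding torsion_free_string_def by simp_all
        moreover have "y \<in> line" using y span_zero unfolding string_rep_def by (simp split: if_splits)
        moreover have "a - 1 + int (nat (b - a)) < ?d"
          unfolding torsion_free_string_less[OF ab] using l m by simp
        ultimately have "y \<in> vspace (string c d) ((a - 1) mod int n)"
          "y = path_map n (string c d) (nat (b - a)) ((a - 1) mod int n) y"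
          using path_map_string_rep[OF a, of line "nat (b - a)" y] supportedI[OF a(1,2), of n]
          by (simp_all add: string_rep_def)
        then show ?thesis by blast
      qed
    qed
  qed
  then show ?thesis
    unfolding pattern_of_def using torsion_pattern_bounds[OF J] by auto
qed

section \<open>A torsion class is determined by its strings\<close>

text \<open>The representative of the vertex \<open>i\<close> among \<open>e, \<dots>, e + n - 1\<close>.\<close>

definition lift :: "int \<Rightarrow> int \<Rightarrow> int" where
  "lift e i = e + (i - e) mod int n"

lemma lift_bounds: "e \<le> lift e i" "lift e i < e + int n"
  unfolding lift_def using n_pos by simp_all

lemma lift_mod: "i \<in> vertices n \<Longrightarrow> lift e i mod int n = i"
  unfolding lift_def using vertices_mod_eq by (simp add: mod_add_right_eq)

lemma lift_eq: "e \<le> m \<Longrightarrow> m < e + int n \<Longrightarrow> lift e (m mod int n) = m"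
  unfolding lift_def by (simp add: mod_diff_left_eq)

lemma lift_next:
  assumes "i \<in> vertices n"
  shows "lift e (next_vertex n i) = (if lift e i + 1 < e + int n then lift e i + 1 else e)"
proof -
  have nx: "next_vertex n i = (lift e i + 1) mod int n"
    using next_vertex_mod[of n "lift e i"] lift_mod[OF assms] by simp
  show ?thesis
  proof (cases "lift e i + 1 < e + int n")
    case True
    then show ?thesis using lift_eq[of e "lift e i + 1"] lift_bounds(1)[of e i] nx by simp
  next
    case False
    then have "lift e i + 1 = e + int n" using lift_bounds(2)[of e i] by simp
    then have "next_vertex n i = e mod int n" using nx by simp
    then show ?thesis using lift_eq[of e e] False n_pos by simp
  qed
qed

lemma supported_lift:
  assumes "i \<in> vertices n" "b \<le> e + int n"
  shows "supported n e b i \<longleftrightarrow> lift e i < b"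
  using supported_mod_iff[OF lift_bounds assms(2), of i] lift_mod[OF assms(1)] by simp

lemma vspace_string:
  assumes "i \<in> vertices n" "b \<le> e + int n"
  shows "vspace (string e b) i = (if lift e i < b then line else {0})"
  unfolding string_rep_def using supported_lift[OF assms] by simp

lemma arrow_string:
  assumes "i \<in> vertices n" "b \<le> e + int n"
  shows "arrow (string e b) i x = (if lift e i < b - 1 then x else 0)"
  unfolding string_rep_def using supported_lift[OF assms(1), of "b - 1" e] assms(2) by simp

text \<open>A functional on the space at \<open>b - 1\<close> extends to the earlier vertices of the string by composing it
  with paths; it has to vanish on the path that starts just before the string.\<close>

lemma string_quotient_of_functional:
  assumes M: "is_rep scale n M" and eb: "e < b" "b \<le> e + int n"
    and add: "\<And>x y. \<phi> (x + y) = \<phi> x + \<phi> y" and scl: "\<And>c x. \<phi> (scale c x) = c * \<phi> x"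
    and vanish: "\<And>x. x \<in> vspace M ((e - 1) mod int n) \<Longrightarrow>
      \<phi> (path_map n M (nat (b - e)) ((e - 1) mod int n) x) = 0"
    and onto: "\<And>m. e \<le> m \<Longrightarrow> m < b \<Longrightarrow>
      \<exists>x\<in>vspace M (m mod int n). \<phi> (path_map n M (nat (b - 1 - m)) (m mod int n) x) = 1"
  shows "is_quotient scale scale n (string e b) M"
  unfolding is_quotient_def
proof (intro exI conjI ballI)
  define f where "f i x = (if lift e i < b
      then scale (\<phi> (path_map n M (nat (b - 1 - lift e i)) i x)) v else 0)" for i x
  have lin_path: "linear_between scale scale (vspace M i) (vspace M ((lift e i + int t) mod int n))
      (path_map n M t i)" if "i \<in> vertices n" for i t
    using linear_between_path_map[OF M, of "lift e i" t] lift_mod[OF that] by simp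
  have lin: "linear_between scale scale (vspace M i) (vspace (string e b) i) (f i)"
    if i: "i \<in> vertices n" for i
    unfolding linear_between_def vspace_string[OF i eb(2)] f_def
    using linear_between_add[OF lin_path[OF i]] linear_between_scale[OF lin_path[OF i]]
    by (auto simp: add scl scale_left_distrib intro: span_scale span_base)
  show "rep_hom scale scale n M (string e b) f"
    unfolding rep_hom_def
  proof (intro ballI conjI lin)
    fix i x assume i: "i \<in> vertices n" and x: "x \<in> vspace M i"
    let ?m = "lift e i"
    note nx = lift_next[OF i, of e]
    show "f (next_vertex n i) (arrow M i x) = arrow (string e b) i (f i x)"
    proof (cases "?m + 1 < e + int n")
      case True
      show ?thesis
      proof (cases "?m + 1 < b")
        case mb: True
        then have "nat (b - 1 - ?m) = Suc (nat (b - 1 - (?m + 1)))" by simp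
        then show ?thesis
          unfolding f_def arrow_string[OF i eb(2)] nx using True mb by simp
      next
        case False
        then show ?thesis unfolding f_def arrow_string[OF i eb(2)] nx using True by simp
      qed
    next
      case False
      then have m: "?m + 1 = e + int n" using lift_bounds(2)[of e i] by simp
      then have "lift e i = e - 1 + int n" by simp
      then have i': "i = (e - 1) mod int n" using lift_mod[OF i, of e] mod_add_self2 by metis
      have "nat (b - e) = Suc (nat (b - 1 - e))" using eb by simp
      then have "\<phi> (path_map n M (nat (b - 1 - e)) (next_vertex n i) (arrow M i x)) = 0"
        using vanish[of x] x unfolding i' by simp
      then have "f (next_vertex n i) (arrow M i x) = 0"
        unfolding f_def nx using False by simp
      then show ?thesis unfolding arrow_string[OF i eb(2)] using m eb by simp
    qed
  qed
  fix i assume i: "i \<in> vertices n"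
  show "f i ` vspace M i = vspace (string e b) i"
  proof
    show "f i ` vspace M i \<subseteq> vspace (string e b) i" using linear_between_in[OF lin[OF i]] by blast
    show "vspace (string e b) i \<subseteq> f i ` vspace M i"
    proof (cases "lift e i < b")
      case True
      then obtain x where x: "x \<in> vspace M i" "\<phi> (path_map n M (nat (b - 1 - lift e i)) i x) = 1"
        using onto[OF lift_bounds(1), of i] lift_mod[OF i] by auto
      show ?thesis
      proof
        fix y assume "y \<in> vspace (string e b) i"
        then obtain c where c: "y = scale c v"
          unfolding vspace_string[OF i eb(2)] using True line_iff by auto
        have "f i (scale c x) = y"
          unfolding f_def c linear_between_scale[OF lin_path[OF i] x(1)] scl x(2) using True by simp
        moreover have "scale c x \<in> vspace M i"
          by (rule subspace_scale[OF is_rep_subspace[OF M i] x(1)])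
        ultimately show "y \<in> f i ` vspace M i" by blast
      qed
    next
      case False
      have "f i 0 = 0" unfolding f_def using False by simp
      then show ?thesis unfolding vspace_string[OF i eb(2)]
        using False subspace_0[OF is_rep_subspace[OF M i]] by force
    qed
  qed
qed

text \<open>If the path from \<open>a - 1\<close> to \<open>b - 1\<close> is not surjective on \<open>M \<in> T\<close>, take the shortest path ending at
  \<open>b - 1\<close> that is not surjective, say from \<open>e - 1\<close>. A functional vanishing on its image makes
  the string of \<open>(e, b)\<close> a quotient of \<open>M\<close>, because all shorter paths are surjective. So this
  string lies in \<open>T\<close>, and \<open>(a, b)\<close> is not torsion-free.\<close>

lemma torsion_class_subset:
  assumes T: "torsion_class scale n k T"
  shows "T \<subseteq> rep_class (pattern_of T)"
proof
  fix M assume MT: "M \<in> T"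
  then have M: "M \<in> reps" using T unfolding torsion_class_def by blast
  note rep = reps_is_rep[OF M]
  show "M \<in> rep_class (pattern_of T)"
  proof (rule rep_classI[OF M], rule ccontr)
    fix a b y assume free: "torsion_free_string (pattern_of T) a b"
      and y: "y \<in> vspace M ((b - 1) mod int n)"
      and none: "\<nexists>x. x \<in> vspace M ((a - 1) mod int n) \<and>
        y = path_map n M (nat (b - a)) ((a - 1) mod int n) x"
    have ab: "a < b" "b \<le> a + int k" using free unfolding torsion_free_string_def by auto
    define X where "X = vspace M ((b - 1) mod int n)"
    define W where "W t = path_map n M t ((b - 1 - int t) mod int n) `
        vspace M ((b - 1 - int t) mod int n)" for t
    define P where "P t \<longleftrightarrow> W t \<noteq> X" for t
    have e: "b - 1 - int t + int t = b - 1" for t by simp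
    have lin: "linear_between scale scale (vspace M ((b - 1 - int t) mod int n)) X
        (path_map n M t ((b - 1 - int t) mod int n))" for t
      using linear_between_path_map[OF rep, of "b - 1 - int t" t] unfolding e X_def .
    have "y \<notin> W (nat (b - a))" unfolding W_def using none ab by auto
    then have "P (nat (b - a))" unfolding P_def using y X_def by blast
    define t where "t = (LEAST t. P t)"
    have t: "P t" "\<And>u. u < t \<Longrightarrow> \<not> P u" "t \<le> nat (b - a)"
      unfolding t_def using \<open>P (nat (b - a))\<close>
      by (auto intro: LeastI Least_le dest: not_less_Least)
    have "\<not> P 0" unfolding P_def W_def X_def by simp
    then have t0: "0 < t" using t(1) by (cases t) auto
    define e where "e = b - int t"
    have eb: "a \<le> e" "e < b" "b \<le> e + int k" "b \<le> e + int n" "nat (b - e) = t" "b - 1 - int t = e - 1"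
      unfolding e_def using t(3) t0 ab k_le by auto
    have subX: "subspace X" unfolding X_def by (rule is_rep_subspace[OF rep vertices_mod[OF n_pos]])
    have vsub: "subspace (vspace M (m mod int n))" for m
      by (rule is_rep_subspace[OF rep vertices_mod[OF n_pos]])
    have "subspace (W t)"
      unfolding subspace_def
    proof (intro conjI ballI allI)
      let ?V = "vspace M ((b - 1 - int t) mod int n)"
      show "0 \<in> W t" unfolding W_def
        using linear_between_zero[OF lin subspace_0[OF vsub]] subspace_0[OF vsub] by (metis imageI)
      show "x + y \<in> W t" if xy: "x \<in> W t" "y \<in> W t" for x y
      proof -
        obtain x' y' where "x' \<in> ?V" "y' \<in> ?V" "x = path_map n M t ((b - 1 - int t) mod int n) x'"
          "y = path_map n M t ((b - 1 - int t) mod int n) y'"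
          using xy unfolding W_def by blast
        then show ?thesis unfolding W_def
          using linear_between_add[OF lin, of x' t y'] subspace_add[OF vsub] by (metis imageI)
      qed
      show "scale c x \<in> W t" if x: "x \<in> W t" for c x
      proof -
        obtain x' where "x' \<in> ?V" "x = path_map n M t ((b - 1 - int t) mod int n) x'"
          using x unfolding W_def by blast
        then show ?thesis unfolding W_def
          using linear_between_scale[OF lin, of x' t c] subspace_scale[OF vsub] by (metis imageI)
      qed
    qed
    moreover have "W t \<subseteq> X" unfolding W_def using linear_between_in[OF lin] by blast
    then obtain w where w: "w \<in> X" "w \<notin> W t" using t(1) unfolding P_def by blast
    ultimately obtain \<phi> :: "'v \<Rightarrow> complex" where \<phi>: "\<And>x y. \<phi> (x + y) = \<phi> x + \<phi> y"
      "\<And>c x. \<phi> (scale c x) = c * \<phi> x" "\<And>x. x \<in> W t \<Longrightarrow> \<phi> x = 0" "\<phi> w = 1"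
      using functional_vanishing_on by blast
    have "is_quotient scale scale n (string e b) M"
    proof (rule string_quotient_of_functional[OF rep eb(2,4) \<phi>(1,2)])
      fix x assume "x \<in> vspace M ((e - 1) mod int n)"
      then show "\<phi> (path_map n M (nat (b - e)) ((e - 1) mod int n) x) = 0"
        using \<phi>(3) unfolding W_def eb(5,6) by blast
    next
      fix m assume m: "e \<le> m" "m < b"
      let ?u = "nat (b - 1 - m)"
      have u: "?u < t" "b - 1 - int ?u = m" using m e_def by auto
      then have "w \<in> W ?u" using t(2)[OF u(1)] w(1) unfolding P_def by simp
      then show "\<exists>x\<in>vspace M (m mod int n). \<phi> (path_map n M ?u (m mod int n) x) = 1"
        using \<phi>(4) unfolding W_def u(2) by auto
    qed
    then have "string e b \<in> T"
      using T MT string_in_reps[OF eb(3)] unfolding torsion_class_def by blast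
    then have "(e, b) \<in> pattern_of T" unfolding pattern_of_def using eb by simp
    then show False using free eb unfolding torsion_free_string_def by blast
  qed
qed

lemma subfamily_is_rep:
  assumes M: "is_rep scale n M"
    and sub: "\<And>i. i \<in> vertices n \<Longrightarrow> subspace (W i) \<and> W i \<subseteq> vspace M i"
    and arr: "\<And>i x. i \<in> vertices n \<Longrightarrow> x \<in> W i \<Longrightarrow> arrow M i x \<in> W (next_vertex n i)"
  shows "is_rep scale n (M\<lparr>vspace := W\<rparr>)"
  unfolding is_rep_def
proof (intro ballI conjI)
  fix i assume i: "i \<in> vertices n"
  have "fd_subspace scale (vspace M i)" using M i unfolding is_rep_def by blast
  then show "fd_subspace scale (vspace (M\<lparr>vspace := W\<rparr>) i)"
    using fd_subspace_subset sub[OF i] by simp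
  show "linear_between scale scale (vspace (M\<lparr>vspace := W\<rparr>) i)
      (vspace (M\<lparr>vspace := W\<rparr>) (next_vertex n i)) (arrow (M\<lparr>vspace := W\<rparr>) i)"
    using is_rep_arrow[OF M i] sub[OF i] arr[OF i] unfolding linear_between_def by (simp add: subset_iff)
qed

text \<open>The vectors \<open>z e, \<dots>, z (b - 1)\<close> form a chain under the arrows that is nonzero modulo the
  subrepresentation \<open>W\<close> and runs into \<open>W\<close> after its last element. Adjoining the chain gives an
  extension of the string of \<open>(e, b)\<close> by \<open>W\<close>.\<close>

lemma adjoin_string:
  assumes M: "M \<in> reps" and W: "is_rep scale n (M\<lparr>vspace := W\<rparr>)"
    and WM: "\<forall>i\<in>vertices n. W i \<subseteq> vspace M i"
    and eb: "e < b" "b \<le> e + int n"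
    and zMW: "\<forall>m. e \<le> m \<and> m < b \<longrightarrow> z m \<in> vspace M (m mod int n) \<and> z m \<notin> W (m mod int n)"
    and z_step: "\<forall>m. e \<le> m \<and> m < b - 1 \<longrightarrow> arrow M (m mod int n) (z m) = z (m + 1)"
    and z_end: "arrow M ((b - 1) mod int n) (z (b - 1)) \<in> W (b mod int n)"
  defines "V \<equiv> \<lambda>i. {u + scale c (if lift e i < b then z (lift e i) else 0) | u c. u \<in> W i}"
  shows "M\<lparr>vspace := V\<rparr> \<in> reps"
    and "short_exact scale n (M\<lparr>vspace := W\<rparr>) (M\<lparr>vspace := V\<rparr>) (string e b)"
    and "i \<in> vertices n \<Longrightarrow> W i \<subseteq> V i \<and> subspace (V i) \<and> V i \<subseteq> vspace M i"
    and "z e \<in> V (e mod int n)"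
proof -
  define y where "y i = (if lift e i < b then z (lift e i) else 0)" for i
  have V_iff: "x \<in> V i \<longleftrightarrow> (\<exists>u c. x = u + scale c (y i) \<and> u \<in> W i)" for x i
    unfolding V_def y_def by blast
  have V_I: "u \<in> W i \<Longrightarrow> u + scale c (y i) \<in> V i" for u c i unfolding V_iff by blast
  have rep: "is_rep scale n M" by (rule reps_is_rep[OF M])
  have subM: "subspace (vspace M i)" if "i \<in> vertices n" for i by (rule is_rep_subspace[OF rep that])
  have subW: "subspace (W i)" if "i \<in> vertices n" for i using is_rep_subspace[OF W that] by simp
  have yM: "y i \<in> vspace M i" if i: "i \<in> vertices n" for i
    using zMW lift_bounds(1)[of e i] lift_mod[OF i] subspace_0[OF subM[OF i]] unfolding y_def by metis
  have yW: "y i \<notin> W i" if i: "i \<in> vertices n" "lift e i < b" for i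
    using zMW lift_bounds(1)[of e i] lift_mod[OF i(1), of e] i(2) unfolding y_def by metis
  have y0: "y i = 0" if "\<not> lift e i < b" for i using that unfolding y_def by simp
  have arrow_W: "arrow M i u \<in> W (next_vertex n i)" if "i \<in> vertices n" "u \<in> W i" for i u
    using linear_between_in[OF is_rep_arrow[OF W that(1)], of u] that(2) by simp
  have arrow_y: "arrow M i (y i) =
      y (next_vertex n i)" if i: "i \<in> vertices n" "lift e i < b - 1" for i
  proof -
    have "lift e (next_vertex n i) = lift e i + 1" using lift_next[OF i(1), of e] i(2) eb by simp
    then show ?thesis
      using spec[OF z_step, of "lift e i"] lift_bounds(1)[of e i] lift_mod[OF i(1), of e] i(2)
      unfolding y_def by simp
  qed
  have arrow_y': "arrow M i (y i) \<in> W (next_vertex n i)"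
    if i: "i \<in> vertices n" "\<not> lift e i < b - 1" for i
  proof (cases "lift e i < b")
    case True
    then have "lift e i = b - 1" using i by simp
    then have "i = (b - 1) mod int n" "y i = z (b - 1)" using lift_mod[OF i(1), of e] unfolding y_def by auto
    then show ?thesis using z_end next_vertex_mod[of n "b - 1"] by simp
  next
    case False
    then show ?thesis
      using y0[OF False] linear_between_zero[OF is_rep_arrow[OF rep i(1)] subspace_0[OF subM[OF i(1)]]]
        subspace_0[OF subW[OF next_vertex_in[OF n_pos]]] by simp
  qed
  have subV: "subspace (V i)" if i: "i \<in> vertices n" for i
    unfolding subspace_def
  proof (intro conjI ballI allI)
    show "0 \<in> V i" using V_I[OF subspace_0[OF subW[OF i]], of 0] by simp
    fix x assume "x \<in> V i"
    then obtain u c where x: "x = u + scale c (y i)" "u \<in> W i" unfolding V_iff by blast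
    show "scale d x \<in> V i" for d
      using V_I[OF subspace_scale[OF subW[OF i] x(2)], of d "d * c"]
      unfolding x(1) by (simp add: scale_right_distrib)
    fix x' assume "x' \<in> V i"
    then obtain u' c' where x': "x' = u' + scale c' (y i)" "u' \<in> W i" unfolding V_iff by blast
    show "x + x' \<in> V i"
      using V_I[OF subspace_add[OF subW[OF i] x(2) x'(2)], of "c + c'"]
      unfolding x(1) x'(1) by (simp add: scale_left_distrib algebra_simps)
  qed
  have WV: "W i \<subseteq> V i" for i
  proof
    fix u assume "u \<in> W i"
    then show "u \<in> V i" using V_I[of u i 0] by simp
  qed
  have VM: "V i \<subseteq> vspace M i" if i: "i \<in> vertices n" for i
  proof
    fix x assume "x \<in> V i"
    then obtain u c where x: "x = u + scale c (y i)" "u \<in> W i" unfolding V_iff by blast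
    have "u \<in> vspace M i" using x(2) WM i by blast
    then show "x \<in> vspace M i"
      unfolding x(1) using subspace_add[OF subM[OF i]] subspace_scale[OF subM[OF i] yM[OF i]] by blast
  qed
  show "i \<in> vertices n \<Longrightarrow> W i \<subseteq> V i \<and> subspace (V i) \<and> V i \<subseteq> vspace M i"
    using WV subV VM by simp
  have e: "e mod int n \<in> vertices n" "lift e (e mod int n) = e"
    using vertices_mod[OF n_pos] lift_eq[of e e] n_pos by auto
  have "y (e mod int n) \<in> V (e mod int n)"
    using V_I[OF subspace_0[OF subW[OF e(1)]], of 1] by simp
  then show "z e \<in> V (e mod int n)" unfolding y_def e(2) using eb by simp
  have arrow_sum: "arrow M i (u + scale c (y i)) = arrow M i u + scale c (arrow M i (y i))"
    if i: "i \<in> vertices n" and u: "u \<in> W i" for i u c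
  proof -
    have uM: "u \<in> vspace M i" using u WM i by blast
    show ?thesis
      unfolding linear_between_add[OF is_rep_arrow[OF rep i] uM subspace_scale[OF subM[OF i] yM[OF i]]]
        linear_between_scale[OF is_rep_arrow[OF rep i] yM[OF i]] ..
  qed
  have V_rep: "is_rep scale n (M\<lparr>vspace := V\<rparr>)"
  proof (rule subfamily_is_rep[OF rep])
    fix i x assume i: "i \<in> vertices n" and "x \<in> V i"
    then obtain u c where x: "x = u + scale c (y i)" "u \<in> W i" unfolding V_iff by blast
    let ?j = "next_vertex n i"
    have Au: "arrow M i u \<in> W ?j" by (rule arrow_W[OF i x(2)])
    show "arrow M i x \<in> V ?j"
    proof (cases "lift e i < b - 1")
      case True
      then show ?thesis unfolding x(1) arrow_sum[OF i x(2)] arrow_y[OF i True] by (intro V_I[OF Au])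
    next
      case False
      have "arrow M i u + scale c (arrow M i (y i)) \<in> W ?j"
        using subspace_add[OF subW[OF next_vertex_in[OF n_pos]] Au]
          subspace_scale[OF subW[OF next_vertex_in[OF n_pos]] arrow_y'[OF i False]] by blast
      then show ?thesis unfolding x(1) arrow_sum[OF i x(2)] using WV by blast
    qed
  qed (use subV VM in blast)
  show V_reps: "M\<lparr>vspace := V\<rparr> \<in> reps"
    using M V_rep VM unfolding cycle_reps_def
    by (auto simp: path_map_vspace_update)
  \<comment> \<open>The coordinate of a vector modulo \<open>W\<close>, which is the projection onto the string.\<close>
  define coef where "coef i x = (THE c. \<exists>u\<in>W i. x = u + scale c (y i))" for i x
  have coef: "coef i (u + scale c (y i)) = c" if i: "i \<in> vertices n" "lift e i < b" and u: "u \<in> W i" for i u c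
    unfolding coef_def
  proof (rule the_equality)
    fix d assume "\<exists>u'\<in>W i. u + scale c (y i) = u' + scale d (y i)"
    then obtain u' where u': "u' \<in> W i" "u + scale c (y i) = u' + scale d (y i)" by blast
    show "d = c"
    proof (rule ccontr)
      assume "d \<noteq> c"
      have "scale (d - c) (y i) = u - u'" using u'(2) by (simp add: scale_left_diff_distrib algebra_simps)
      also have "\<dots> \<in> W i" by (rule subspace_diff[OF subW[OF i(1)] u u'(1)])
      finally have "scale (inverse (d - c)) (scale (d - c) (y i)) \<in> W i"
        by (rule subspace_scale[OF subW[OF i(1)]])
      then show False using yW[OF i] \<open>d \<noteq> c\<close> by simp
    qed
  qed (use u in blast)
  define g where "g i x = (if lift e i < b then scale (coef i x) v else 0)" for i x
  have g: "g i (u + scale c (y i)) = (if lift e i < b then scale c v else 0)"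
    if "i \<in> vertices n" "u \<in> W i" for i u c
    unfolding g_def using coef[OF that(1) _ that(2)] by simp
  have gW: "g i u = 0" if "i \<in> vertices n" "u \<in> W i" for i u
    using g[OF that, of 0] by (simp split: if_splits)
  have g_hom: "rep_hom scale scale n (M\<lparr>vspace := V\<rparr>) (string e b) g"
    unfolding rep_hom_def
  proof (intro ballI conjI)
    fix i assume i: "i \<in> vertices n"
    show "linear_between scale scale (vspace (M\<lparr>vspace := V\<rparr>) i) (vspace (string e b) i) (g i)"
      unfolding linear_between_def
    proof (intro conjI ballI allI)
      fix x assume "x \<in> vspace (M\<lparr>vspace := V\<rparr>) i"
      then obtain u c where x: "x = u + scale c (y i)" "u \<in> W i" using V_iff by auto
      show "g i x \<in> vspace (string e b) i"
        unfolding x(1) g[OF i x(2)] vspace_string[OF i eb(2)] using line_iff by auto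
      show "g i (scale d x) = scale d (g i x)" for d
        using g[OF i subspace_scale[OF subW[OF i] x(2)], of d "d * c"]
        unfolding x(1) g[OF i x(2)] by (simp add: scale_right_distrib)
      fix x' assume "x' \<in> vspace (M\<lparr>vspace := V\<rparr>) i"
      then obtain u' c' where x': "x' = u' + scale c' (y i)" "u' \<in> W i" using V_iff by auto
      have "x + x' = (u + u') + scale (c + c') (y i)"
        unfolding x(1) x'(1) by (simp add: scale_left_distrib algebra_simps)
      then have "g i (x + x') = (if lift e i < b then scale (c + c') v else 0)"
        using g[OF i subspace_add[OF subW[OF i] x(2) x'(2)]] by simp
      moreover have "g i x = (if lift e i < b then scale c v else 0)"
        unfolding x(1) by (rule g[OF i x(2)])
      moreover have "g i x' = (if lift e i < b then scale c' v else 0)"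
        unfolding x'(1) by (rule g[OF i x'(2)])
      ultimately show "g i (x + x') = g i x + g i x'" by (simp add: scale_left_distrib)
    qed
    fix x assume "x \<in> vspace (M\<lparr>vspace := V\<rparr>) i"
    then obtain u c where x: "x = u + scale c (y i)" "u \<in> W i" using V_iff by auto
    let ?j = "next_vertex n i"
    have j: "?j \<in> vertices n" by (rule next_vertex_in[OF n_pos])
    have Au: "arrow M i u \<in> W ?j" by (rule arrow_W[OF i x(2)])
    have "g ?j (arrow M i x) = arrow (string e b) i (g i x)"
    proof (cases "lift e i < b - 1")
      case True
      then have "lift e ?j < b" using lift_next[OF i, of e] eb by simp
      then show ?thesis
        unfolding x(1) arrow_sum[OF i x(2)] arrow_y[OF i True] g[OF j Au] g[OF i x(2)]
          arrow_string[OF i eb(2)] using True by simp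
    next
      case False
      have "arrow M i u + scale c (arrow M i (y i)) \<in> W ?j"
        using subspace_add[OF subW[OF j] Au] subspace_scale[OF subW[OF j] arrow_y'[OF i False]] by blast
      then show ?thesis
        unfolding x(1) arrow_sum[OF i x(2)] arrow_string[OF i eb(2)] using gW[OF j] False by simp
    qed
    then show "g ?j (arrow (M\<lparr>vspace := V\<rparr>) i x) = arrow (string e b) i (g i x)" by simp
  qed
  have f_hom: "rep_hom scale scale n (M\<lparr>vspace := W\<rparr>) (M\<lparr>vspace := V\<rparr>) (\<lambda>_ x. x)"
    unfolding rep_hom_def linear_between_def using WV by auto
  show "short_exact scale n (M\<lparr>vspace := W\<rparr>) (M\<lparr>vspace := V\<rparr>) (string e b)"
    unfolding short_exact_def
  proof (rule exI[of _ "\<lambda>_ x. x"], rule exI[of _ g], intro conjI ballI f_hom g_hom)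
    fix i assume i: "i \<in> vertices n"
    have "W i = {x \<in> V i. g i x = 0}"
    proof
      show "W i \<subseteq> {x \<in> V i. g i x = 0}" using WV gW[OF i] by blast
      show "{x \<in> V i. g i x = 0} \<subseteq> W i"
      proof clarify
        fix x assume "x \<in> V i" and g0: "g i x = 0"
        then obtain u c where x: "x = u + scale c (y i)" "u \<in> W i" using V_iff by blast
        have "scale c (y i) = 0" using g0 y0[of i] v_nonzero unfolding x(1) g[OF i x(2)]
          by (cases "lift e i < b") auto
        then show "x \<in> W i" unfolding x(1) using x(2) by (simp only: add_0_right)
      qed
    qed
    then show "(\<lambda>x. x) ` vspace (M\<lparr>vspace := W\<rparr>) i = {x \<in> vspace (M\<lparr>vspace := V\<rparr>) i. g i x = 0}"
      by simp
    have zW: "0 \<in> W i" by (rule subspace_0[OF subW[OF i]])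
    have "g i ` V i = vspace (string e b) i"
    proof
      show "g i ` V i \<subseteq> vspace (string e b) i"
        using g_hom i unfolding rep_hom_def linear_between_def by auto
      show "vspace (string e b) i \<subseteq> g i ` V i"
      proof
        fix x assume "x \<in> vspace (string e b) i"
        then obtain c where "x = (if lift e i < b then scale c v else 0)"
          unfolding vspace_string[OF i eb(2)] using line_iff by (auto split: if_splits)
        then have "x = g i (0 + scale c (y i))" using g[OF i zW, of c] by simp
        then show "x \<in> g i ` V i" using V_I[OF zW] by blast
      qed
    qed
    then show "g i ` vspace (M\<lparr>vspace := V\<rparr>) i = vspace (string e b) i" by simp
  qed simp
qed

text \<open>Let \<open>W\<close> be a subrepresentation of \<open>M\<close> in \<open>T\<close> of largest dimension, and suppose \<open>W \<noteq> M\<close>. Choose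
  a longest path, from \<open>a\<close> to \<open>b - 1\<close> say, that maps some vector \<open>x\<close> of \<open>M\<close> outside \<open>W\<close>. Then the
  path from \<open>a - 1\<close> to \<open>b - 1\<close> maps into \<open>W\<close> and is not surjective, so \<open>(a, b)\<close> is
  not torsion-free and \<open>T\<close> contains the string of some \<open>(e, b)\<close> with \<open>a \<le> e < b\<close>. Adjoining the images of
  \<open>x\<close> at \<open>e, \<dots>, b - 1\<close> to \<open>W\<close> yields an extension of this string by \<open>W\<close>, a larger subrepresentation
  in \<open>T\<close>.\<close>

lemma torsion_class_supset:
  assumes T: "torsion_class scale n k T"
  shows "rep_class (pattern_of T) \<subseteq> T"
proof
  fix M assume MC: "M \<in> rep_class (pattern_of T)"
  then have M: "M \<in> reps" unfolding rep_class_def by blast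
  note rep = reps_is_rep[OF M]
  have T_reps: "T \<subseteq> reps"
    and T_iso: "\<And>N N'. N \<in> T \<Longrightarrow> N' \<in> reps \<Longrightarrow> rep_iso scale scale n N N' \<Longrightarrow> N' \<in> T"
    and T_quot: "\<And>N Q. N \<in> T \<Longrightarrow> Q \<in> reps \<Longrightarrow> is_quotient scale scale n Q N \<Longrightarrow> Q \<in> T"
    and T_ext: "\<And>A B E. A \<in> T \<Longrightarrow> B \<in> T \<Longrightarrow> E \<in> reps \<Longrightarrow> short_exact scale n A E B \<Longrightarrow> E \<in> T"
    using T unfolding torsion_class_def by blast+
  have subM: "subspace (vspace M i)" if "i \<in> vertices n" for i by (rule is_rep_subspace[OF rep that])
  have fdM: "fd_subspace scale (vspace M i)" if "i \<in> vertices n" for i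
    using rep that unfolding is_rep_def by blast
  define G where "G W \<longleftrightarrow> (\<forall>i\<in>vertices n. W i \<subseteq> vspace M i) \<and> M\<lparr>vspace := W\<rparr> \<in> T" for W
  define D where "D W = (\<Sum>i\<in>vertices n. dim (W i))" for W :: "int \<Rightarrow> 'v set"
  have fin: "finite (vertices n)" unfolding vertices_def by simp
  have G_rep: "is_rep scale n (M\<lparr>vspace := W\<rparr>)" if "G W" for W
    using that T_reps reps_is_rep unfolding G_def by blast
  have G_sub: "subspace (W i)" "W i \<subseteq> vspace M i" if "G W" "i \<in> vertices n" for W i
    using is_rep_subspace[OF G_rep[OF that(1)] that(2)] that unfolding G_def by auto
  have "G (\<lambda>_. {0})"
  proof -
    obtain N where N: "N \<in> T" using T unfolding torsion_class_def by blast
    have Nr: "is_rep scale n N" using N T_reps reps_is_rep by blast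
    have arr0: "arrow M i 0 = 0" if "i \<in> vertices n" for i
      by (rule linear_between_zero[OF is_rep_arrow[OF rep that] subspace_0[OF subM[OF that]]])
    have zr: "is_rep scale n (M\<lparr>vspace := \<lambda>_. {0}\<rparr>)"
      by (rule subfamily_is_rep[OF rep]) (auto simp: arr0 subspace_0 subM subspace_single_0)
    have "M\<lparr>vspace := \<lambda>_. {0}\<rparr> \<in> reps"
      using zr M subspace_0[OF subM] unfolding cycle_reps_def
    by (auto simp: path_map_vspace_update)
    moreover have "is_quotient scale scale n (M\<lparr>vspace := \<lambda>_. {0}\<rparr>) N"
      unfolding is_quotient_def
    proof (intro exI[of _ "\<lambda>_ _. 0"] conjI ballI)
      show "rep_hom scale scale n N (M\<lparr>vspace := \<lambda>_. {0}\<rparr>) (\<lambda>_ _. 0)"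
        unfolding rep_hom_def linear_between_def using arr0 by simp
      fix i assume "i \<in> vertices n"
      then show "(\<lambda>_. 0) ` vspace N i = vspace (M\<lparr>vspace := \<lambda>_. {0}\<rparr>) i"
        using subspace_0[OF is_rep_subspace[OF Nr]] by auto
    qed
    ultimately show ?thesis
      unfolding G_def using T_quot[OF N] subspace_0[OF subM] by auto
  qed
  moreover have bound: "D W < Suc (D (vspace M))" if "G W" for W
    unfolding D_def less_Suc_eq_le by (rule sum_mono) (use G_sub[OF that] dim_mono_fd(1) fdM subM in blast)
  ultimately obtain W where W: "G W" and W_max: "\<And>W'. G W' \<Longrightarrow> D W' \<le> D W"
    using ex_has_greatest_nat[of G "\<lambda>_. {0}" D "Suc (D (vspace M))"] by blast
  have W_rep: "is_rep scale n (M\<lparr>vspace := W\<rparr>)" by (rule G_rep[OF W])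
  have "W i = vspace M i" if i: "i \<in> vertices n" for i
  proof (rule ccontr)
    assume "W i \<noteq> vspace M i"
    then obtain x0 where x0: "x0 \<in> vspace M i" "x0 \<notin> W i" using G_sub(2)[OF W i] by blast
    define P where "P t \<longleftrightarrow> (\<exists>m. \<exists>x\<in>vspace M (m mod int n).
        path_map n M t (m mod int n) x \<notin> W ((m + int t) mod int n))" for t
    have "P 0" unfolding P_def using x0 vertices_mod_eq[OF i] by (intro exI[of _ i]) auto
    have P_less: "t < k" if "P t" for t
    proof (rule ccontr)
      assume "\<not> t < k"
      then have "k \<le> t" by simp
      obtain m x where mx: "x \<in> vspace M (m mod int n)"
        "path_map n M t (m mod int n) x \<notin> W ((m + int t) mod int n)"
        using \<open>P t\<close> unfolding P_def by blast
      then show False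
        using path_map_eq_zero[OF M mx(1) \<open>k \<le> t\<close>] subspace_0[OF G_sub(1)[OF W vertices_mod[OF n_pos]]]
        by simp
    qed
    obtain t where t: "P t" "\<not> P (Suc t)"
      using \<open>P 0\<close> P_less[of k] by (metis less_irrefl nat_induct)
    obtain a x where x: "x \<in> vspace M (a mod int n)"
      "path_map n M t (a mod int n) x \<notin> W ((a + int t) mod int n)"
      using t(1) unfolding P_def by blast
    define b where "b = a + int t + 1"
    have b: "b \<le> a + int k" "b \<le> a + int n" "a < b" "b - 1 = a + int t" "nat (b - a) = Suc t"
      unfolding b_def using P_less[OF t(1)] k_le by simp_all
    have Suc_W: "path_map n M (Suc t) (m mod int n) y \<in> W ((m + int (Suc t)) mod int n)"
      if "y \<in> vspace M (m mod int n)" for m y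
      using t(2) that unfolding P_def by blast
    have "\<not> torsion_free_string (pattern_of T) a b"
    proof
      assume free: "torsion_free_string (pattern_of T) a b"
      have "path_map n M t (a mod int n) x \<in> vspace M ((b - 1) mod int n)"
        unfolding b(4) by (rule linear_between_in[OF linear_between_path_map[OF rep] x(1)])
      then obtain y where y: "y \<in> vspace M ((a - 1) mod int n)"
        "path_map n M t (a mod int n) x = path_map n M (nat (b - a)) ((a - 1) mod int n) y"
        by (rule rep_classD[OF MC free])
      have "a - 1 + int (Suc t) = a + int t" by simp
      then show False using Suc_W[OF y(1)] y(2) x(2) unfolding b(5) by metis
    qed
    then obtain e where e: "a \<le> e" "e < b" "(e, b) \<in> pattern_of T"
      unfolding torsion_free_string_def using b by blast
    then have eT: "string e b \<in> T" "b \<le> e + int n" unfolding pattern_of_def using k_le by auto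
    define z where "z m = path_map n M (nat (m - a)) (a mod int n) x" for m
    have z_step: "arrow M (m mod int n) (z m) = z (m + 1)" if "a \<le> m" for m
    proof -
      have "nat (m + 1 - a) = Suc (nat (m - a))" "a + int (nat (m - a)) = m" using that by auto
      then show ?thesis unfolding z_def using path_map_Suc_end[of n M "nat (m - a)" a x] by simp
    qed
    have zM: "z m \<in> vspace M (m mod int n)" if "a \<le> m" for m
      using linear_between_in[OF linear_between_path_map[OF rep] x(1), of "nat (m - a)"] that
      unfolding z_def by simp
    have zW: "z m \<notin> W (m mod int n)" if m: "a \<le> m" "m < b" for m
    proof
      assume "z m \<in> W (m mod int n)"
      then have "path_map n M (nat (b - 1 - m)) (m mod int n) (z m) \<in> W ((b - 1) mod int n)"
        using linear_between_in[OF linear_between_path_map[OF W_rep, of m "nat (b - 1 - m)"], of "z m"]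
          m unfolding path_map_vspace_update by simp
      moreover have "path_map n M (nat (b - 1 - m)) (m mod int n) (z m) = path_map n M t (a mod int n) x"
      proof -
        have 1: "nat (m - a) + nat (b - 1 - m) = t" "a + int (nat (m - a)) = m" using m b(4) by auto
        show ?thesis
          using path_map_add[of n M "nat (m - a)" "nat (b - 1 - m)" a x] unfolding 1 z_def by simp
      qed
      ultimately show False using x(2) unfolding b(4) by simp
    qed
    have z_end: "arrow M ((b - 1) mod int n) (z (b - 1)) \<in> W (b mod int n)"
    proof -
      have 1: "a + int (Suc t) = b" "nat (b - 1 + 1 - a) = Suc t" unfolding b_def by auto
      have "a \<le> b - 1" using b by simp
      then show ?thesis unfolding z_step[OF \<open>a \<le> b - 1\<close>] unfolding z_def 1(2)
        using Suc_W[OF x(1)] unfolding 1(1) by blast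
    qed
    let ?V = "\<lambda>i. {u + scale c (if lift e i < b then z (lift e i) else 0) | u c. u \<in> W i}"
    have z1: "\<forall>m. e \<le> m \<and> m < b \<longrightarrow> z m \<in> vspace M (m mod int n) \<and> z m \<notin> W (m mod int n)"
      using zM zW e(1) by simp
    have z2: "\<forall>m. e \<le> m \<and> m < b - 1 \<longrightarrow> arrow M (m mod int n) (z m) = z (m + 1)"
      using z_step e(1) by simp
    have WM: "\<forall>i\<in>vertices n. W i \<subseteq> vspace M i" using G_sub(2)[OF W] by blast
    note adj = adjoin_string[OF M W_rep WM e(2) eT(2) z1 z2 z_end]
    have WT: "M\<lparr>vspace := W\<rparr> \<in> T" using W unfolding G_def by blast
    have "M\<lparr>vspace := ?V\<rparr> \<in> T" by (rule T_ext[OF WT eT(1) adj(1,2)])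
    then have GV: "G ?V" unfolding G_def using adj(3) by blast
    have ev: "e mod int n \<in> vertices n" by (rule vertices_mod[OF n_pos])
    have "D W < D ?V"
      unfolding D_def
    proof (rule sum_strict_mono_ex1[OF fin])
      show "\<forall>i\<in>vertices n. dim (W i) \<le> dim (?V i)"
        using dim_mono_fd(1)[OF fdM G_sub(1)[OF W]] adj(3) by blast
      have "dim (W (e mod int n)) < dim (?V (e mod int n))"
        using dim_mono_fd(2)[OF fdM[OF ev] G_sub(1)[OF W ev] _ _ _ adj(4) zW[OF e(1,2)]] adj(3)[OF ev]
        by blast
      then show "\<exists>i\<in>vertices n. dim (W i) < dim (?V i)" using ev by blast
    qed
    then show False using W_max[OF GV] by simp
  qed
  then have "rep_iso scale scale n (M\<lparr>vspace := W\<rparr>) M"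
    unfolding rep_iso_def rep_hom_def linear_between_def
    using is_rep_arrow[OF rep] next_vertex_in[OF n_pos]
    by (intro exI[of _ "\<lambda>_ x. x"]) (auto simp: bij_betw_def)
  then show "M \<in> T" using T_iso[OF _ M] W unfolding G_def by blast
qed

lemma rep_class_mono: "I \<subseteq> J \<Longrightarrow> rep_class I \<subseteq> rep_class J"
  unfolding rep_class_def torsion_free_string_def by blast

lemma torsion_poset_isomorphic_pattern_poset:
  "order_isomorphic (torsion_poset scale n k) (pattern_poset n k)"
proof (rule order_isomorphicI)
  have po: "partial_order (torsion_poset scale n k)"
    by (rule partial_orderI) (auto simp: torsion_poset_def)
  then show "weak_partial_order (torsion_poset scale n k)" by (simp add: partial_order_def)
  show "weak_partial_order (pattern_poset n k)"
    using partial_order_pattern_poset by (simp add: partial_order_def)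
  have inv: "rep_class (pattern_of T) = T" if "torsion_class scale n k T" for T
    using torsion_class_subset[OF that] torsion_class_supset[OF that] by blast
  have "bij_betw pattern_of {T. torsion_class scale n k T} {J. torsion_pattern n k J}"
    by (rule bij_betw_byWitness[where f' = rep_class])
      (use inv pattern_of_rep_class torsion_pattern_pattern_of torsion_class_rep_class in auto)
  then show "bij_betw pattern_of (carrier (torsion_poset scale n k)) (carrier (pattern_poset n k))"
    unfolding torsion_poset_def pattern_poset_def by simp
  fix S T assume "S \<in> carrier (torsion_poset scale n k)" "T \<in> carrier (torsion_poset scale n k)"
  then have ST: "torsion_class scale n k S" "torsion_class scale n k T"
    unfolding torsion_poset_def by simp_all
  have "pattern_of S \<subseteq> pattern_of T \<longleftrightarrow> S \<subseteq> T"
  proof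
    assume "pattern_of S \<subseteq> pattern_of T"
    then show "S \<subseteq> T" using rep_class_mono inv[OF ST(1)] inv[OF ST(2)] by blast
  qed (auto simp: pattern_of_def)
  then show "pattern_of S \<sqsubseteq>\<^bsub>pattern_poset n k\<^esub> pattern_of T \<longleftrightarrow> S \<sqsubseteq>\<^bsub>torsion_poset scale n k\<^esub> T"
    unfolding torsion_poset_def pattern_poset_def by simp
qed

end

section \<open>The comparison of orders and representations\<close>

lemma order_isomorphic_trans:
  assumes "order_isomorphic A B" "order_isomorphic B C"
  shows "order_isomorphic A C"
proof -
  obtain f g where f: "bij_betw f (carrier A) (carrier B)" "order_emb A B f"
    and g: "bij_betw g (carrier B) (carrier C)" "order_emb B C g"
    using assms unfolding order_isomorphic_def by blast
  have "order_emb A C (g \<circ> f)"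
    using f g bij_betw_apply[OF f(1)] unfolding order_emb_def by simp
  then show ?thesis
    unfolding order_isomorphic_def using bij_betw_trans[OF f(1) g(1)] by blast
qed

text \<open>Different choices of \<open>(a, b)\<close> for the same \<open>j\<close> are harmless: the choice made in the definition of
  \<open>Mji\<close> is itself an interval whose row is \<open>j\<close>.\<close>

lemma Mji_join_irreducible:
  assumes "join_irreducible (CTam n) j" "n > 0"
  obtains a b where "a < b" "b \<le> a + int n" "j = order_of_pattern n (row n a b)"
    "Mji n j = Mrep n a b"
proof -
  obtain a0 b0 where "a0 < b0" "b0 \<le> a0 + int n" "j = order_of_pattern n (row n a0 b0)"
    using CTam_join_irreducible_cases[OF assms] .
  then have ex: "\<exists>p. (\<lambda>(a, b). a < b \<and> b \<le> a + int n \<and> j = jirr n a b) p"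
    using jirr_eq_order_of_row assms(2) by (intro exI[of _ "(a0, b0)"]) simp
  obtain a b where ab: "(SOME (a, b). a < b \<and> b \<le> a + int n \<and> j = jirr n a b) = (a, b)"
    by (rule prod.exhaust)
  have "a < b" "b \<le> a + int n" "j = jirr n a b" using someI_ex[OF ex] unfolding ab by simp_all
  then show thesis
    using that[of a b] jirr_eq_order_of_row[of a b n] assms(2) unfolding Mji_def ab by simp
qed

theorem proposition6p3:
  fixes n :: nat and scale :: "complex \<Rightarrow> 'v::ab_group_add \<Rightarrow> 'v"
  assumes "n \<ge> 2" and "vector_space scale" and "infinite_dimensional scale"
  shows "(\<forall>j1 j2. join_irreducible (CTam n) j1 \<and> join_irreducible (CTam n) j2 \<longrightarrow>
            (ji_onto (CTam n) j2 j1 \<longleftrightarrow> is_quotient (*) (*) n (Mji n j1) (Mji n j2)) \<and>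
            (ji_into (CTam n) j1 j2 \<longleftrightarrow> is_submodule (*) (*) n (Mji n j1) (Mji n j2)) \<and>
            (ji_arrow (CTam n) j1 j2 \<longleftrightarrow> nonzero_map_exists (*) (*) n (Mji n j1) (Mji n j2)))
         \<and> order_isomorphic (CTam_Tors scale n) (CTam n)
         \<and> order_isomorphic (ATam_Tors scale n) (ATam n)"
proof (intro conjI allI impI)
  have n: "n > 0" using assms(1) by simp
  interpret vector_space scale by (rule assms(2))
  have "\<exists>v :: 'v. v \<noteq> 0"
  proof (rule ccontr)
    assume "\<not> (\<exists>v :: 'v. v \<noteq> 0)"
    then have "span {} = (UNIV :: 'v set)" by auto
    then show False using assms(3) unfolding infinite_dimensional_def fd_subspace_def by blast
  qed
  then obtain v :: 'v where "v \<noteq> 0" by blast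
  then have amb: "cycle_ambient scale n k v" if "k \<le> n" for k
    using that n assms(2) unfolding cycle_ambient_def cycle_ambient_axioms_def by simp
  show "order_isomorphic (CTam_Tors scale n) (CTam n)"
    unfolding CTam_Tors_def
    using order_isomorphic_trans[OF cycle_ambient.torsion_poset_isomorphic_pattern_poset[OF amb]
        pattern_poset_isomorphic_CTam[OF n]] n by simp
  show "order_isomorphic (ATam_Tors scale n) (ATam n)"
    unfolding ATam_Tors_def
    using order_isomorphic_trans[OF cycle_ambient.torsion_poset_isomorphic_pattern_poset[OF amb]
        pattern_poset_isomorphic_ATam[OF n]] assms(1) by simp
  fix j1 j2
  assume irr: "join_irreducible (CTam n) j1 \<and> join_irreducible (CTam n) j2"
  obtain a1 b1 where 1: "a1 < b1" "b1 \<le> a1 + int n" "j1 = order_of_pattern n (row n a1 b1)"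
    "Mji n j1 = Mrep n a1 b1"
    using Mji_join_irreducible[OF conjunct1[OF irr] n] .
  obtain a2 b2 where 2: "a2 < b2" "b2 \<le> a2 + int n" "j2 = order_of_pattern n (row n a2 b2)"
    "Mji n j2 = Mrep n a2 b2"
    using Mji_join_irreducible[OF conjunct2[OF irr] n] .
  note args = 1(1,2) 2(1,2) n
  show "ji_onto (CTam n) j2 j1 \<longleftrightarrow> is_quotient (*) (*) n (Mji n j1) (Mji n j2)"
    unfolding ji_onto_iff[OF args 1(3) 2(3)] 1(4) 2(4) is_quotient_Mrep_iff[OF args] ..
  show "ji_into (CTam n) j1 j2 \<longleftrightarrow> is_submodule (*) (*) n (Mji n j1) (Mji n j2)"
    unfolding ji_into_iff[OF args 1(3) 2(3)] 1(4) 2(4) is_submodule_Mrep_iff[OF args] ..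
  show "ji_arrow (CTam n) j1 j2 \<longleftrightarrow> nonzero_map_exists (*) (*) n (Mji n j1) (Mji n j2)"
    unfolding ji_arrow_iff[OF args 1(3) 2(3)] 1(4) 2(4) nonzero_map_Mrep_iff[OF args] ..
qed

end
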